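(* Let $X=\mathbb D^3$, with $\Psi=\{z_1,z_2,z_3\}$ (the coordinate functions) as the collection of test functions on $X$, $\Lambda=\{e_1,e_2,e_3\}$, and let $H^\infty(X,\mathcal K_\Lambda)$ be the algebra determined by the corresponding set of admissible kernels. Let $U,V\in\mathcal L(\mathcal K)$ be unitary operators on a Hilbert space $\mathcal K$ with the property that $UV=-VU$ (for example, one might choose $U=\begin{pmatrix}1&0\\0&-1\end{pmatrix}$ and $V=\begin{pmatrix}0&1\\1&0\end{pmatrix}$). Then on $\mathcal K\oplus\mathcal K$, $$\pi(z_1):=T_1=\begin{pmatrix}0&1\\0&0\end{pmatrix},\qquad\pi(z_2):=T_2=\begin{pmatrix}0&U\\0&0\end{pmatrix},\qquad\pi(z_3):=T_3=\begin{pmatrix}0&V\\0&0\end{pmatrix}$$ defines a (completely contractive) boundary representation of $H^\infty(X,\mathcal K_\Lambda)$.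
   Context: For $n\ge1$, let $\mathcal K_{\Lambda,\mathbb C^n}$ be the set of positive $M_n(\mathbb C)$-valued kernels $k$ on $\mathbb D^3$ (i.e. $\sum_{i,j}\langle k(x_i,x_j)h_j,h_i\rangle\ge0$ for all finite families) such that $(1-z_j\overline{w_j})k(z,w)$ is positive for $j=1,2,3$; these are the admissible kernels. $H^\infty(X,\mathcal K_{\Lambda,\mathbb C^n})$ is the algebra of functions $\varphi:\mathbb D^3\to M_n(\mathbb C)$ for which there is $c\ge0$ with $(c^21_n-\varphi(z)\varphi(w)^* )\otimes k(z,w)$ a positive kernel for all $k\in\mathcal K_{\Lambda,\mathbb C^n}$, normed by the smallest such $c$. $H^\infty(X,\mathcal K_\Lambda)$ (the classical Agler algebra of the tridisk) is the case $n=1$, and $M_n(H^\infty(X,\mathcal K_\Lambda))$ is normed as $H^\infty(X,\mathcal K_{\Lambda,\mathbb C^n})$; all its elements are analytic. The representation determined by the commuting nilpotent tuple $T=(T_1,T_2,T_3)$ is $\varphi\mapsto\varphi(T)$, given by substituting $T$ in the Taylor series of $\varphi$ at $0$ (a finite sum). A boundary representation is an irreducible completely contractive unital representation with the property that any completely contractive dilation of it must contain it as a direct summand; a representation $\tilde\pi$ dilates $\pi$ if $\pi$ is the restriction (compression) of $\tilde\pi$ to a semi-invariant subspace (a difference of two invariant subspaces).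
   Formalization: As stated, irreducibility fails for reducible pairs such as U⊕U, V⊕V (or K = 0); the formal theorem proves all other claims for every anticommuting unitary pair and that π is a boundary representation if and only if {U, V} is irreducible; the example matrices are not treated separately. *)

theory Defs
  imports "HOL-Analysis.Analysis"
begin

section \<open>Complex Hilbert spaces\<close>

text \<open>The inner product is linear in the first argument.\<close>

class chilbert_space = banach +
  fixes scaleC :: "complex \<Rightarrow> 'a \<Rightarrow> 'a" (infixr "*\<^sub>C" 75)
    and cinner :: "'a \<Rightarrow> 'a \<Rightarrow> complex"
  assumes scaleC_add_right: "c *\<^sub>C (x + y) = c *\<^sub>C x + c *\<^sub>C y"
    and scaleC_add_left: "(c + d) *\<^sub>C x = c *\<^sub>C x + d *\<^sub>C x"
    and scaleC_scaleC: "c *\<^sub>C (d *\<^sub>C x) = (c * d) *\<^sub>C x"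
    and scaleR_scaleC: "r *\<^sub>R x = complex_of_real r *\<^sub>C x"
    and cinner_commute: "cinner x y = cnj (cinner y x)"
    and cinner_add_left: "cinner (x + y) w = cinner x w + cinner y w"
    and cinner_scaleC_left: "cinner (c *\<^sub>C x) y = c * cinner x y"
    and cinner_self: "cinner x x = complex_of_real ((norm x)\<^sup>2)"

instantiation prod :: (chilbert_space, chilbert_space) chilbert_space
begin

definition scaleC_prod :: "complex \<Rightarrow> 'a \<times> 'b \<Rightarrow> 'a \<times> 'b"
  where "scaleC_prod c v = (c *\<^sub>C fst v, c *\<^sub>C snd v)"

definition cinner_prod :: "'a \<times> 'b \<Rightarrow> 'a \<times> 'b \<Rightarrow> complex"
  where "cinner_prod v w = cinner (fst v) (fst w) + cinner (snd v) (snd w)"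

instance
proof
  fix x y w :: "'a \<times> 'b" and c d :: complex and r :: real
  show "c *\<^sub>C (x + y) = c *\<^sub>C x + c *\<^sub>C y"
    by (simp add: scaleC_prod_def scaleC_add_right)
  show "(c + d) *\<^sub>C x = c *\<^sub>C x + d *\<^sub>C x"
    by (simp add: scaleC_prod_def scaleC_add_left)
  show "c *\<^sub>C (d *\<^sub>C x) = (c * d) *\<^sub>C x"
    by (simp add: scaleC_prod_def scaleC_scaleC)
  show "r *\<^sub>R x = complex_of_real r *\<^sub>C x"
    by (simp add: scaleC_prod_def scaleR_prod_def scaleR_scaleC)
  show "cinner x y = cnj (cinner y x)"
    using cinner_commute[of "fst x" "fst y"] cinner_commute[of "snd x" "snd y"]
    by (simp add: cinner_prod_def)
  show "cinner (x + y) w = cinner x w + cinner y w"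
    by (simp add: cinner_prod_def cinner_add_left)
  show "cinner (c *\<^sub>C x) y = c * cinner x y"
    by (simp add: cinner_prod_def scaleC_prod_def cinner_scaleC_left distrib_left)
  show "cinner x x = complex_of_real ((norm x)\<^sup>2)"
    by (simp add: cinner_prod_def norm_prod_def cinner_self)
qed

end

definition clinear_map :: "('a::chilbert_space \<Rightarrow> 'b::chilbert_space) \<Rightarrow> bool"
  where "clinear_map A \<longleftrightarrow>
    (\<forall>x y. A (x + y) = A x + A y) \<and> (\<forall>c x. A (c *\<^sub>C x) = c *\<^sub>C A x)"

definition bounded_op :: "('a::chilbert_space \<Rightarrow> 'b::chilbert_space) \<Rightarrow> bool"
  where "bounded_op A \<longleftrightarrow> clinear_map A \<and> (\<exists>b. \<forall>x. norm (A x) \<le> b * norm x)"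

definition isometric_op :: "('a::chilbert_space \<Rightarrow> 'b::chilbert_space) \<Rightarrow> bool"
  where "isometric_op A \<longleftrightarrow> clinear_map A \<and> (\<forall>x y. cinner (A x) (A y) = cinner x y)"

definition unitary_op :: "('a::chilbert_space \<Rightarrow> 'a) \<Rightarrow> bool"
  where "unitary_op A \<longleftrightarrow> isometric_op A \<and> surj A"

definition closed_csubspace :: "'a::chilbert_space set \<Rightarrow> bool"
  where "closed_csubspace M \<longleftrightarrow> closed M \<and> 0 \<in> M \<and>
    (\<forall>x\<in>M. \<forall>y\<in>M. x + y \<in> M) \<and> (\<forall>c. \<forall>x\<in>M. c *\<^sub>C x \<in> M)"

definition ocomp :: "'a::chilbert_space set \<Rightarrow> 'a set"
  where "ocomp M = {x. \<forall>y\<in>M. cinner x y = 0}"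

definition invariant :: "'a set \<Rightarrow> ('a \<Rightarrow> 'a) \<Rightarrow> bool"
  where "invariant M A \<longleftrightarrow> (\<forall>x\<in>M. A x \<in> M)"

definition reduces :: "'a::chilbert_space set \<Rightarrow> ('a \<Rightarrow> 'a) \<Rightarrow> bool"
  where "reduces M A \<longleftrightarrow> invariant M A \<and> invariant (ocomp M) A"

definition irreducible_ops :: "('a::chilbert_space \<Rightarrow> 'a) set \<Rightarrow> bool"
  where "irreducible_ops S \<longleftrightarrow> (\<exists>x::'a. x \<noteq> 0) \<and>
    (\<forall>M. closed_csubspace M \<and> (\<forall>A\<in>S. reduces M A) \<longrightarrow> M = {0} \<or> M = UNIV)"

section \<open>Admissible kernels and the associated function algebras\<close>

text \<open>
  Since the size \<open>n\<close> is quantified over, \<open>n\<close> by \<open>n\<close> matrices are functions on indices, of which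
  only the entries with indices below \<open>n\<close> are significant.  In general a matrix-valued kernel has an
  arbitrary finite index set \<open>I\<close>; this serves for tensor products, whose index set is a product.
\<close>

definition positive_kernel ::
    "'x set \<Rightarrow> 'i set \<Rightarrow> ('x \<Rightarrow> 'x \<Rightarrow> 'i \<Rightarrow> 'i \<Rightarrow> complex) \<Rightarrow> bool"
  where "positive_kernel X I k \<longleftrightarrow>
    (\<forall>(m::nat) (x::nat \<Rightarrow> 'x) (h::nat \<Rightarrow> 'i \<Rightarrow> complex). (\<forall>p<m. x p \<in> X) \<longrightarrow>
      (\<Sum>p<m. \<Sum>q<m. \<Sum>a\<in>I. \<Sum>b\<in>I. k (x p) (x q) a b * h q b * cnj (h p a)) \<in> \<real>\<^sub>\<ge>\<^sub>0)"

definition admissible_kernels ::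
    "'x set \<Rightarrow> ('x \<Rightarrow> complex) set \<Rightarrow> nat \<Rightarrow> ('x \<Rightarrow> 'x \<Rightarrow> nat \<Rightarrow> nat \<Rightarrow> complex) set"
  where "admissible_kernels X \<Psi> n =
    {k. positive_kernel X {..<n} k \<and>
      (\<forall>\<psi>\<in>\<Psi>. positive_kernel X {..<n} (\<lambda>z w a b. (1 - \<psi> z * cnj (\<psi> w)) * k z w a b))}"

text \<open>
  \<open>Hinf_bound X \<Psi> n \<phi> c\<close> says that \<open>(c\<^sup>2 1\<^sub>n - \<phi>(z) \<phi>(w)\<^sup>*) \<otimes> k(z,w)\<close> is positive for every
  admissible \<open>k\<close>.
\<close>

definition Hinf_bound ::
    "'x set \<Rightarrow> ('x \<Rightarrow> complex) set \<Rightarrow> nat \<Rightarrow> ('x \<Rightarrow> nat \<Rightarrow> nat \<Rightarrow> complex) \<Rightarrow> real \<Rightarrow> bool"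
  where "Hinf_bound X \<Psi> n \<phi> c \<longleftrightarrow> 0 \<le> c \<and>
    (\<forall>k\<in>admissible_kernels X \<Psi> n.
      positive_kernel X ({..<n} \<times> {..<n})
        (\<lambda>z w (a, a') (b, b').
          ((if a = b then complex_of_real (c\<^sup>2) else 0) - (\<Sum>l<n. \<phi> z a l * cnj (\<phi> w b l)))
            * k z w a' b'))"

definition Hinf ::
    "'x set \<Rightarrow> ('x \<Rightarrow> complex) set \<Rightarrow> nat \<Rightarrow> ('x \<Rightarrow> nat \<Rightarrow> nat \<Rightarrow> complex) set"
  where "Hinf X \<Psi> n = {\<phi>. \<exists>c. Hinf_bound X \<Psi> n \<phi> c}"

definition Hinf_norm ::
    "'x set \<Rightarrow> ('x \<Rightarrow> complex) set \<Rightarrow> nat \<Rightarrow> ('x \<Rightarrow> nat \<Rightarrow> nat \<Rightarrow> complex) \<Rightarrow> real"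
  where "Hinf_norm X \<Psi> n \<phi> = Inf {c. Hinf_bound X \<Psi> n \<phi> c}"

text \<open>
  The scalar algebra, i.e. \<open>n = 1\<close>.  Membership depends only on the values on \<open>X\<close>; functions that
  agree on \<open>X\<close> are the same element of the algebra.
\<close>

definition Hinf_scalar :: "'x set \<Rightarrow> ('x \<Rightarrow> complex) set \<Rightarrow> ('x \<Rightarrow> complex) set"
  where "Hinf_scalar X \<Psi> = {f. (\<lambda>z i j. f z) \<in> Hinf X \<Psi> 1}"

section \<open>Representations, dilations and boundary representations\<close>

definition alg_representation ::
    "'x set \<Rightarrow> ('x \<Rightarrow> complex) set \<Rightarrow> (('x \<Rightarrow> complex) \<Rightarrow> 'h::chilbert_space \<Rightarrow> 'h) \<Rightarrow> bool"
  where "alg_representation X \<Psi> \<pi> \<longleftrightarrow>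
    (\<forall>f\<in>Hinf_scalar X \<Psi>. bounded_op (\<pi> f)) \<and>
    (\<forall>f\<in>Hinf_scalar X \<Psi>. \<forall>g\<in>Hinf_scalar X \<Psi>. (\<forall>z\<in>X. f z = g z) \<longrightarrow> \<pi> f = \<pi> g) \<and>
    (\<forall>f\<in>Hinf_scalar X \<Psi>. \<forall>g\<in>Hinf_scalar X \<Psi>. \<pi> (\<lambda>z. f z + g z) = (\<lambda>x. \<pi> f x + \<pi> g x)) \<and>
    (\<forall>c. \<forall>f\<in>Hinf_scalar X \<Psi>. \<pi> (\<lambda>z. c * f z) = (\<lambda>x. c *\<^sub>C \<pi> f x)) \<and>
    (\<forall>f\<in>Hinf_scalar X \<Psi>. \<forall>g\<in>Hinf_scalar X \<Psi>. \<pi> (\<lambda>z. f z * g z) = \<pi> f \<circ> \<pi> g)"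

definition unital :: "(('x \<Rightarrow> complex) \<Rightarrow> 'h \<Rightarrow> 'h) \<Rightarrow> bool"
  where "unital \<pi> \<longleftrightarrow> \<pi> (\<lambda>z. 1) = id"

text \<open>
  A matrix over the scalar algebra carries the norm \<open>Hinf_norm X \<Psi> n\<close>; its image
  \<open>(\<pi>(\<phi>\<^sub>i\<^sub>j))\<close> acts on the \<open>n\<close>-fold direct sum of the Hilbert space.
\<close>

definition completely_contractive ::
    "'x set \<Rightarrow> ('x \<Rightarrow> complex) set \<Rightarrow> (('x \<Rightarrow> complex) \<Rightarrow> 'h::chilbert_space \<Rightarrow> 'h) \<Rightarrow> bool"
  where "completely_contractive X \<Psi> \<pi> \<longleftrightarrow>
    (\<forall>n\<ge>1. \<forall>\<phi>. (\<forall>i<n. \<forall>j<n. (\<lambda>z. \<phi> z i j) \<in> Hinf_scalar X \<Psi>) \<longrightarrow>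
      (\<forall>h::nat \<Rightarrow> 'h.
        sqrt (\<Sum>i<n. (norm (\<Sum>j<n. \<pi> (\<lambda>z. \<phi> z i j) (h j)))\<^sup>2)
          \<le> Hinf_norm X \<Psi> n \<phi> * sqrt (\<Sum>j<n. (norm (h j))\<^sup>2)))"

text \<open>
  \<open>dilates X \<Psi> J \<pi>' \<pi>\<close>: after identifying the space of \<open>\<pi>\<close> with \<open>range J\<close> by the isometry \<open>J\<close>,
  this range is the difference of two invariant subspaces \<open>M\<close> and \<open>N\<close> of \<open>\<pi>'\<close>, and \<open>\<pi>\<close> is the
  compression of \<open>\<pi>'\<close> to it.  In the last clause \<open>J (\<pi> f x)\<close> is the orthogonal projection of
  \<open>\<pi>' f (J x)\<close> to \<open>range J\<close>.
\<close>

definition dilates ::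
    "'x set \<Rightarrow> ('x \<Rightarrow> complex) set \<Rightarrow> ('h::chilbert_space \<Rightarrow> 'b::chilbert_space) \<Rightarrow>
     (('x \<Rightarrow> complex) \<Rightarrow> 'b \<Rightarrow> 'b) \<Rightarrow> (('x \<Rightarrow> complex) \<Rightarrow> 'h \<Rightarrow> 'h) \<Rightarrow> bool"
  where "dilates X \<Psi> J \<pi>' \<pi> \<longleftrightarrow> isometric_op J \<and>
    (\<exists>M N. closed_csubspace M \<and> closed_csubspace N \<and> N \<subseteq> M \<and>
      (\<forall>f\<in>Hinf_scalar X \<Psi>. invariant M (\<pi>' f) \<and> invariant N (\<pi>' f)) \<and>
      range J = M \<inter> ocomp N) \<and>
    (\<forall>f\<in>Hinf_scalar X \<Psi>. \<forall>x. \<pi>' f (J x) - J (\<pi> f x) \<in> ocomp (range J))"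

definition direct_summand ::
    "'x set \<Rightarrow> ('x \<Rightarrow> complex) set \<Rightarrow> ('h::chilbert_space \<Rightarrow> 'b::chilbert_space) \<Rightarrow>
     (('x \<Rightarrow> complex) \<Rightarrow> 'b \<Rightarrow> 'b) \<Rightarrow> (('x \<Rightarrow> complex) \<Rightarrow> 'h \<Rightarrow> 'h) \<Rightarrow> bool"
  where "direct_summand X \<Psi> J \<pi>' \<pi> \<longleftrightarrow>
    (\<forall>f\<in>Hinf_scalar X \<Psi>. reduces (range J) (\<pi>' f) \<and> (\<forall>x. \<pi>' f (J x) = J (\<pi> f x)))"

text \<open>
  HOL cannot quantify over the Hilbert spaces on which dilations act inside a formula; they are the
  instances of the type argument \<open>'b\<close>, which is a free type variable in the theorem.
\<close>

definition dilations_trivial ::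
    "'b::chilbert_space itself \<Rightarrow> 'x set \<Rightarrow> ('x \<Rightarrow> complex) set \<Rightarrow>
     (('x \<Rightarrow> complex) \<Rightarrow> 'h::chilbert_space \<Rightarrow> 'h) \<Rightarrow> bool"
  where "dilations_trivial _ X \<Psi> \<pi> \<longleftrightarrow>
    (\<forall>(\<pi>'::('x \<Rightarrow> complex) \<Rightarrow> 'b \<Rightarrow> 'b) J.
      alg_representation X \<Psi> \<pi>' \<and> completely_contractive X \<Psi> \<pi>' \<and> dilates X \<Psi> J \<pi>' \<pi> \<longrightarrow>
      direct_summand X \<Psi> J \<pi>' \<pi>)"

definition boundary_representation ::
    "'b::chilbert_space itself \<Rightarrow> 'x set \<Rightarrow> ('x \<Rightarrow> complex) set \<Rightarrow>
     (('x \<Rightarrow> complex) \<Rightarrow> 'h::chilbert_space \<Rightarrow> 'h) \<Rightarrow> bool"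
  where "boundary_representation B X \<Psi> \<pi> \<longleftrightarrow>
    alg_representation X \<Psi> \<pi> \<and> unital \<pi> \<and> completely_contractive X \<Psi> \<pi> \<and>
    irreducible_ops (\<pi> ` Hinf_scalar X \<Psi>) \<and> dilations_trivial B X \<Psi> \<pi>"

section \<open>The tridisk and substitution of nilpotent tuples\<close>

definition tridisk :: "(complex ^ 3) set"
  where "tridisk = {z. \<forall>j. norm (z $ j) < 1}"

definition coords :: "(complex ^ 3 \<Rightarrow> complex) set"
  where "coords = range (\<lambda>j z. z $ j)"

text \<open>Taylor coefficient at \<open>0\<close>: the iterated partial derivative divided by \<open>\<alpha>!\<close>.\<close>

fun taylor_coeff :: "(complex ^ 3 \<Rightarrow> complex) \<Rightarrow> nat \<times> nat \<times> nat \<Rightarrow> complex"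
  where "taylor_coeff f (p, q, r) =
    (deriv ^^ p) (\<lambda>z1. (deriv ^^ q) (\<lambda>z2. (deriv ^^ r) (\<lambda>z3. f (vector [z1, z2, z3])) 0) 0) 0
      / (fact p * fact q * fact r)"

fun monomial_op :: "(3 \<Rightarrow> 'h \<Rightarrow> 'h) \<Rightarrow> nat \<times> nat \<times> nat \<Rightarrow> 'h \<Rightarrow> 'h"
  where "monomial_op T (p, q, r) = (T 1 ^^ p) \<circ> (T 2 ^^ q) \<circ> (T 3 ^^ r)"

text \<open>
  For commuting nilpotent \<open>T\<close>, only finitely many monomials in \<open>T\<close> are nonzero, and \<open>eval_tuple T f\<close>
  is the Taylor series of \<open>f\<close> evaluated at \<open>T\<close>.
\<close>

definition eval_tuple ::
    "(3 \<Rightarrow> 'h::chilbert_space \<Rightarrow> 'h) \<Rightarrow> (complex ^ 3 \<Rightarrow> complex) \<Rightarrow> 'h \<Rightarrow> 'h"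
  where "eval_tuple T f x =
    (\<Sum>\<alpha> | monomial_op T \<alpha> \<noteq> (\<lambda>_. 0). taylor_coeff f \<alpha> *\<^sub>C monomial_op T \<alpha> x)"

end

theory Submission
  imports Defs
begin

text \<open>
  Write \<open>W 1 = 1\<close>, \<open>W 2 = U\<close>, \<open>W 3 = V\<close>, so that \<open>T j (x, y) = (W j y, 0)\<close>.

  Dilations: let \<open>S j\<close> dilate \<open>T j\<close>.  Since \<open>T j\<close> is isometric on \<open>0 \<oplus> K\<close> and \<open>S j\<close> is contractive, \<open>S j\<close> agrees
  with \<open>T j\<close> there.  The possible remainder \<open>N j x = S j (x, 0)\<close> satisfies \<open>N i W j = N j W i\<close> because the \<open>S j\<close>
  commute, and \<open>UV = - VU\<close> then forces \<open>N = 0\<close>; the adjoints are treated in the same way.  To pass from the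
  coordinates to the whole algebra, every \<open>f\<close> is written as \<open>f(0) + z\<^sub>1 g\<^sub>1 + z\<^sub>2 g\<^sub>2 + z\<^sub>3 g\<^sub>3\<close> with \<open>g\<^sub>j\<close> in the
  algebra again.

  Complete contractivity: \<open>T\<close> is itself not the compression of the multiplication tuple of an admissible kernel, but it
  is a limit of such compressions, with kernels supported on the four points \<open>0\<close> and \<open>t e\<^sub>j\<close>, \<open>t \<rightarrow> 0\<close>.
\<close>

section \<open>Complex inner products\<close>

text \<open>The theorem states an equivalence because the hypotheses also admit pairs such as
  \<open>U \<oplus> U\<close>, \<open>V \<oplus> V\<close>, for which \<pi> is reducible; the
  boundary property then depends exactly on irreducibility of the pair. Since any product of two
  \<open>T j\<close> vanishes, \<pi> sees only \<open>f 0\<close> and the three first partial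
  derivatives at 0; their existence is itself extracted from kernel positivity at three points.
  Polynomials are not norm dense in the algebra and a dilation has no further continuity, so its
  values on the coordinates do not determine it. This is why the quotients must be elements of the
  algebra again; a quotient is obtained as a corner of \<open>f\<close> at a two-by-two operator
  matrix. The obstacle to complete contractivity is that admissible kernels are Gram matrices of
  joint eigenvectors, whereas the adjoints of the nilpotent \<open>T j\<close> have only the
  eigenvalue 0 and their joint eigenvectors do not span. The approximating tuples have eigenvectors
  over \<open>t e\<^sub>j\<close> as well, and difference quotients turn into derivatives as
  \<open>t\<close> tends to 0.\<close>

lemma scaleC_0_left [simp]: "0 *\<^sub>C (x::'a::chilbert_space) = 0"
  using scaleR_scaleC[of 0 x] by simp

lemma scaleC_0_right [simp]: "c *\<^sub>C (0::'a::chilbert_space) = 0"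
  using scaleC_add_right[of c 0 "0::'a"] by simp

lemma scaleC_1 [simp]: "1 *\<^sub>C (x::'a::chilbert_space) = x"
  using scaleR_scaleC[of 1 x] by simp

lemma scaleC_minus_left [simp]: "(- c) *\<^sub>C (x::'a::chilbert_space) = - (c *\<^sub>C x)"
  using scaleC_add_left[of c "- c" x] by (simp add: minus_unique)

lemma scaleC_minus_right [simp]: "c *\<^sub>C (- x::'a::chilbert_space) = - (c *\<^sub>C x)"
  using scaleC_add_right[of c x "- x"] by (simp add: minus_unique)

lemma scaleC_diff_left: "(c - d) *\<^sub>C (x::'a::chilbert_space) = c *\<^sub>C x - d *\<^sub>C x"
  using scaleC_add_left[of c "- d" x] by simp

lemma scaleC_diff_right: "c *\<^sub>C (x - y::'a::chilbert_space) = c *\<^sub>C x - c *\<^sub>C y"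
  using scaleC_add_right[of c x "- y"] by simp

lemma scaleC_sum_right: "c *\<^sub>C (\<Sum>i\<in>I. f i :: 'a::chilbert_space) = (\<Sum>i\<in>I. c *\<^sub>C f i)"
  by (induction I rule: infinite_finite_induct) (auto simp: scaleC_add_right)

lemma cinner_add_right: "cinner (x::'a::chilbert_space) (y + z) = cinner x y + cinner x z"
  by (metis cinner_add_left cinner_commute complex_cnj_add)

lemma cinner_scaleC_right: "cinner (x::'a::chilbert_space) (c *\<^sub>C y) = cnj c * cinner x y"
  by (metis cinner_commute cinner_scaleC_left complex_cnj_cnj complex_cnj_mult)

lemma cinner_0_left [simp]: "cinner 0 (x::'a::chilbert_space) = 0"
  using cinner_scaleC_left[of 0 x x] by simp

lemma cinner_0_right [simp]: "cinner (x::'a::chilbert_space) 0 = 0"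
  using cinner_scaleC_right[of x 0 x] by simp

lemma cinner_minus_left [simp]: "cinner (- x) (y::'a::chilbert_space) = - cinner x y"
  using cinner_scaleC_left[of "-1" x y] by simp

lemma cinner_minus_right [simp]: "cinner (x::'a::chilbert_space) (- y) = - cinner x y"
  using cinner_scaleC_right[of x "-1" y] by simp

lemma cinner_diff_left: "cinner (x - y) (z::'a::chilbert_space) = cinner x z - cinner y z"
  using cinner_add_left[of x "- y" z] by simp

lemma cinner_sum_left: "cinner (\<Sum>i\<in>I. f i) (x::'a::chilbert_space) = (\<Sum>i\<in>I. cinner (f i) x)"
  by (induction I rule: infinite_finite_induct) (auto simp: cinner_add_left)

lemma cinner_sum_right: "cinner (x::'a::chilbert_space) (\<Sum>i\<in>I. f i) = (\<Sum>i\<in>I. cinner x (f i))"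
  by (induction I rule: infinite_finite_induct) (auto simp: cinner_add_right)

lemma Re_cinner_self: "Re (cinner x x) = (norm (x::'a::chilbert_space))\<^sup>2"
  by (simp add: cinner_self)

lemma norm_scaleC: "norm (c *\<^sub>C (x::'a::chilbert_space)) = cmod c * norm x"
proof -
  have "cinner (c *\<^sub>C x) (c *\<^sub>C x) = (c * cnj c) * cinner x x"
    by (simp add: cinner_scaleC_left cinner_scaleC_right)
  then have "complex_of_real ((norm (c *\<^sub>C x))\<^sup>2) = complex_of_real ((cmod c * norm x)\<^sup>2)"
    unfolding cinner_self complex_norm_square[symmetric] by (simp add: power_mult_distrib)
  then show ?thesis
    by (metis mult_nonneg_nonneg norm_ge_zero of_real_eq_iff power2_eq_imp_eq)
qed

lemma norm_add_square:
  "(norm (x + y :: 'a::chilbert_space))\<^sup>2 = (norm x)\<^sup>2 + 2 * Re (cinner x y) + (norm y)\<^sup>2"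
proof -
  have "Re (cinner y x) = Re (cinner x y)"
    by (metis cinner_commute cnj.simps(1))
  then show ?thesis
    unfolding Re_cinner_self[symmetric] by (simp add: cinner_add_left cinner_add_right)
qed

lemma norm_diff_square:
  "(norm (x - y :: 'a::chilbert_space))\<^sup>2 = (norm x)\<^sup>2 - 2 * Re (cinner x y) + (norm y)\<^sup>2"
  using norm_add_square[of x "- y"] by simp

lemma parallelogram:
  "(norm (x + y :: 'a::chilbert_space))\<^sup>2 + (norm (x - y))\<^sup>2 = 2 * (norm x)\<^sup>2 + 2 * (norm y)\<^sup>2"
  by (simp add: norm_add_square norm_diff_square)

lemma complex_eqI_Re_rotations:
  assumes "Re a = Re b" "Re (\<i> * a) = Re (\<i> * b)"
  shows "a = b"
  using assms by (simp add: complex_eq_iff)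

lemma quadratic_nonneg_imp_zero:
  fixes b :: real
  assumes "\<And>t. 0 \<le> 2 * t * b + t\<^sup>2 * e"
  shows "b = 0"
proof (rule ccontr)
  assume "b \<noteq> 0"
  \<comment> \<open>\<open>E\<close> is a positive upper bound of \<open>e\<close>, so that
    \<open>2 * t * b + t\<^sup>2 * E\<close> has a minimum, at \<open>- b / E\<close>, also when
    \<open>e\<close> is not positive.\<close>
  define E where "E = \<bar>e\<bar> + 1"
  have "E > 0"
    by (simp add: E_def)
  define s where "s = - b / E"
  have "2 * s * b + s\<^sup>2 * e \<le> 2 * s * b + s\<^sup>2 * E"
    by (intro add_left_mono mult_left_mono) (auto simp: E_def)
  also have "\<dots> = - (b\<^sup>2 / E)"
    using \<open>E > 0\<close> by (simp add: s_def power2_eq_square)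
  also have "\<dots> < 0"
    using \<open>b \<noteq> 0\<close> \<open>E > 0\<close> by simp
  finally show False
    using assms[of s] by simp
qed

text \<open>\<open>1 - S\<^sup>*S\<close> is positive, so it annihilates \<open>u\<close> as soon as \<open>\<langle>(1 - S\<^sup>*S) u, u\<rangle> = 0\<close>.\<close>

lemma contraction_attains_cinner:
  fixes S :: "'a::chilbert_space \<Rightarrow> 'b::chilbert_space"
  assumes lin: "clinear_map S" and contr: "\<And>x. norm (S x) \<le> norm x"
    and attains: "norm (S u) = norm u"
  shows "cinner (S z) (S u) = cinner z u"
proof -
  have Re_eq: "Re (cinner (S z) (S u)) = Re (cinner z u)" for z
  proof -
    have "0 \<le> 2 * t * (Re (cinner z u) - Re (cinner (S z) (S u))) + t\<^sup>2 * ((norm z)\<^sup>2 - (norm (S z))\<^sup>2)"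
      for t :: real
    proof -
      have "S (complex_of_real t *\<^sub>C z + u) = complex_of_real t *\<^sub>C S z + S u"
        using lin by (simp add: clinear_map_def)
      then have "(norm (complex_of_real t *\<^sub>C S z + S u))\<^sup>2 \<le> (norm (complex_of_real t *\<^sub>C z + u))\<^sup>2"
        using contr[of "complex_of_real t *\<^sub>C z + u"] by (simp add: power_mono)
      then show ?thesis
        unfolding norm_add_square
        by (simp add: norm_scaleC cinner_scaleC_left attains power_mult_distrib algebra_simps)
    qed
    from quadratic_nonneg_imp_zero[OF this] show ?thesis by simp
  qed
  show ?thesis
  proof (rule complex_eqI_Re_rotations)
    have "S (\<i> *\<^sub>C z) = \<i> *\<^sub>C S z"
      using lin by (simp add: clinear_map_def)
    then show "Re (\<i> * cinner (S z) (S u)) = Re (\<i> * cinner z u)"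
      using Re_eq[of "\<i> *\<^sub>C z"] by (simp add: cinner_scaleC_left)
  qed (rule Re_eq)
qed

section \<open>Positive semidefinite families\<close>

text \<open>Membership in the nonnegative reals includes being real, so for finite \<open>I\<close>
  the form is automatically Hermitian. Indices are kept apart from points, which lets a family visit
  the same point several times.\<close>

definition psd :: "'i set \<Rightarrow> ('i \<Rightarrow> 'i \<Rightarrow> complex) \<Rightarrow> bool"
  where "psd I G \<longleftrightarrow> (\<forall>d. (\<Sum>i\<in>I. \<Sum>j\<in>I. G i j * d j * cnj (d i)) \<in> \<real>\<^sub>\<ge>\<^sub>0)"

lemma psdI:
  "(\<And>d. (\<Sum>i\<in>I. \<Sum>j\<in>I. G i j * d j * cnj (d i)) \<in> \<real>\<^sub>\<ge>\<^sub>0) \<Longrightarrow> psd I G"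
  by (simp add: psd_def)

lemma psdD:
  "psd I G \<Longrightarrow> (\<Sum>i\<in>I. \<Sum>j\<in>I. G i j * d j * cnj (d i)) \<in> \<real>\<^sub>\<ge>\<^sub>0"
  by (simp add: psd_def)

lemma psd_cong:
  assumes "\<And>i j. i \<in> I \<Longrightarrow> j \<in> I \<Longrightarrow> G i j = H i j"
  shows "psd I G \<longleftrightarrow> psd I H"
  unfolding psd_def using assms by (simp cong: sum.cong)

lemma psd_add:
  assumes "psd I G" "psd I H"
  shows "psd I (\<lambda>i j. G i j + H i j)"
proof (rule psdI)
  fix d
  show "(\<Sum>i\<in>I. \<Sum>j\<in>I. (G i j + H i j) * d j * cnj (d i)) \<in> \<real>\<^sub>\<ge>\<^sub>0"
    using nonneg_Reals_add_I[OF psdD[OF assms(1)] psdD[OF assms(2)], of d d]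
    by (simp add: distrib_right sum.distrib)
qed

lemma psd_scale:
  assumes "psd I G" "0 \<le> r"
  shows "psd I (\<lambda>i j. complex_of_real r * G i j)"
proof (rule psdI)
  fix d
  have "complex_of_real r \<in> \<real>\<^sub>\<ge>\<^sub>0"
    using assms(2) by simp
  from nonneg_Reals_mult_I[OF this psdD[OF assms(1)], of d]
  show "(\<Sum>i\<in>I. \<Sum>j\<in>I. (complex_of_real r * G i j) * d j * cnj (d i)) \<in> \<real>\<^sub>\<ge>\<^sub>0"
    by (simp add: sum_distrib_left mult.assoc)
qed

lemma psd_sum:
  assumes "\<And>l. l \<in> L \<Longrightarrow> psd I (G l)"
  shows "psd I (\<lambda>i j. \<Sum>l\<in>L. G l i j)"
  using assms
proof (induction L rule: infinite_finite_induct)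
  case (insert l L)
  then show ?case using psd_add[of I "G l" "\<lambda>i j. \<Sum>l\<in>L. G l i j"] by simp
qed (auto intro!: psdI)

lemma psd_congruence:
  assumes "psd I G" "finite T"
  shows "psd T (\<lambda>s s'. \<Sum>i\<in>I. \<Sum>j\<in>I. G i j * A j s' * cnj (A i s))"
proof (rule psdI)
  fix e
  have "(\<Sum>s\<in>T. \<Sum>s'\<in>T. (\<Sum>i\<in>I. \<Sum>j\<in>I. G i j * A j s' * cnj (A i s)) * e s' * cnj (e s))
    = (\<Sum>s\<in>T. \<Sum>s'\<in>T. \<Sum>i\<in>I. \<Sum>j\<in>I. G i j * A j s' * cnj (A i s) * e s' * cnj (e s))"
    by (simp add: sum_distrib_right)
  also have "\<dots> = (\<Sum>s\<in>T. \<Sum>i\<in>I. \<Sum>j\<in>I. \<Sum>s'\<in>T. G i j * A j s' * cnj (A i s) * e s' * cnj (e s))"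
    by (intro sum.cong refl, subst sum.swap, intro sum.cong refl, rule sum.swap)
  also have "\<dots> = (\<Sum>i\<in>I. \<Sum>j\<in>I. \<Sum>s\<in>T. \<Sum>s'\<in>T. G i j * A j s' * cnj (A i s) * e s' * cnj (e s))"
    by (subst sum.swap, intro sum.cong refl, rule sum.swap)
  also have "\<dots> = (\<Sum>i\<in>I. \<Sum>j\<in>I. G i j * (\<Sum>s'\<in>T. A j s' * e s') * cnj (\<Sum>s\<in>T. A i s * e s))"
    by (intro sum.cong refl, subst sum.swap) (simp add: sum_distrib_left sum_distrib_right mult_ac)
  also have "\<dots> \<in> \<real>\<^sub>\<ge>\<^sub>0"
    by (rule psdD[OF assms(1)])
  finally show "(\<Sum>s\<in>T. \<Sum>s'\<in>T. (\<Sum>i\<in>I. \<Sum>j\<in>I. G i j * A j s' * cnj (A i s)) * e s' * cnj (e s)) \<in> \<real>\<^sub>\<ge>\<^sub>0" .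
qed

text \<open>Congruence by the 0-1 matrix of \<open>h\<close>. As \<open>h\<close> may identify
  indices, this duplicates them as well as renaming them.\<close>

lemma psd_pullback:
  assumes "psd J G" "finite J" "finite I" "h ` I \<subseteq> J"
  shows "psd I (\<lambda>i j. G (h i) (h j))"
proof -
  have "(\<Sum>s\<in>J. \<Sum>t\<in>J. G s t * (if t = h j then 1 else 0) * cnj (if s = h i then 1 else 0)) = G (h i) (h j)"
    if "i \<in> I" "j \<in> I" for i j
  proof -
    have "h i \<in> J" "h j \<in> J" using that assms(4) by auto
    have "(\<Sum>s\<in>J. \<Sum>t\<in>J. G s t * (if t = h j then 1 else 0) * cnj (if s = h i then 1 else 0))
      = (\<Sum>s\<in>J. if s = h i then (\<Sum>t\<in>J. if t = h j then G s t else 0) else 0)"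
      by (intro sum.cong refl) (auto intro!: sum.cong sum.neutral)
    also have "\<dots> = G (h i) (h j)"
      using assms(2) \<open>h i \<in> J\<close> \<open>h j \<in> J\<close> by simp
    finally show ?thesis .
  qed
  then show ?thesis
    using psd_congruence[OF assms(1,3), of "\<lambda>t j. if t = h j then 1 else 0"]
    by (simp cong: psd_cong)
qed

text \<open>Congruence by a diagonal matrix. The positivity arguments below are arranged as sums of
  positive families conjugated in this way.\<close>

lemma psd_schur_rank_one:
  assumes "psd I G"
  shows "psd I (\<lambda>i j. u i * cnj (u j) * G i j)"
proof (rule psdI)
  fix d
  show "(\<Sum>i\<in>I. \<Sum>j\<in>I. (u i * cnj (u j) * G i j) * d j * cnj (d i)) \<in> \<real>\<^sub>\<ge>\<^sub>0"
    using psdD[OF assms, of "\<lambda>i. cnj (u i) * d i"] by (simp add: mult_ac)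
qed

lemma gram_sum:
  fixes v :: "'i \<Rightarrow> 'a::chilbert_space"
  shows "(\<Sum>i\<in>I. \<Sum>j\<in>I. cinner (v j) (v i) * d j * cnj (d i))
    = complex_of_real ((norm (\<Sum>i\<in>I. d i *\<^sub>C v i))\<^sup>2)"
  unfolding cinner_self[symmetric]
  by (simp add: cinner_sum_left cinner_sum_right cinner_scaleC_left cinner_scaleC_right
      sum_distrib_left mult_ac)

lemma of_real_nonneg [simp, intro]: "0 \<le> r \<Longrightarrow> complex_of_real r \<in> \<real>\<^sub>\<ge>\<^sub>0"
  by simp

lemma psd_gram: "psd I (\<lambda>i j. cinner (v j) (v i :: 'a::chilbert_space))"
  by (rule psdI) (simp only: gram_sum, simp)

lemma ones_sum:
  "(\<Sum>i\<in>I. \<Sum>j\<in>I. 1 * d j * cnj (d i)) = complex_of_real ((cmod (\<Sum>i\<in>I. d i))\<^sup>2)"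
  unfolding complex_norm_square by (simp add: sum_product, rule sum.swap)

lemma psd_ones: "psd I (\<lambda>i j. 1)"
  by (rule psdI) (simp only: ones_sum, simp)

lemma psd_limit:
  assumes "F \<noteq> bot" and "\<forall>\<^sub>F t in F. psd I (G t)"
    and lim: "\<And>i j. i \<in> I \<Longrightarrow> j \<in> I \<Longrightarrow> ((\<lambda>t. G t i j) \<longlongrightarrow> H i j) F"
  shows "psd I H"
proof (rule psdI)
  fix d
  have "((\<lambda>t. \<Sum>i\<in>I. \<Sum>j\<in>I. G t i j * d j * cnj (d i))
      \<longlongrightarrow> (\<Sum>i\<in>I. \<Sum>j\<in>I. H i j * d j * cnj (d i))) F"
    by (intro tendsto_sum tendsto_mult tendsto_const lim)
  moreover have "\<forall>\<^sub>F t in F. (\<Sum>i\<in>I. \<Sum>j\<in>I. G t i j * d j * cnj (d i)) \<in> \<real>\<^sub>\<ge>\<^sub>0"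
    using assms(2) by eventually_elim (rule psdD)
  ultimately show "(\<Sum>i\<in>I. \<Sum>j\<in>I. H i j * d j * cnj (d i)) \<in> \<real>\<^sub>\<ge>\<^sub>0"
    by (intro Lim_in_closed_set[OF closed_nonneg_Reals_complex _ assms(1)])
qed

text \<open>The geometric series expands the kernel into the rank-one terms
  \<open>u i ^ n * cnj (u j ^ n)\<close>, and positivity survives the limit.\<close>

lemma psd_szego:
  assumes "\<And>i. i \<in> I \<Longrightarrow> cmod (u i) < 1"
  shows "psd I (\<lambda>i j. 1 / (1 - u i * cnj (u j)))"
proof (rule psd_limit[of sequentially])
  show "\<forall>\<^sub>F N in sequentially. psd I (\<lambda>i j. \<Sum>n<N. (u i * cnj (u j)) ^ n)"
  proof (rule always_eventually, rule allI, rule psd_sum)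
    fix n
    show "psd I (\<lambda>i j. (u i * cnj (u j)) ^ n)"
      using psd_schur_rank_one[OF psd_ones, of I "\<lambda>i. u i ^ n"] by (simp add: power_mult_distrib)
  qed
  fix i j assume "i \<in> I" "j \<in> I"
  then have "cmod (u i) * cmod (u j) < 1 * 1"
    using assms by (intro mult_strict_mono') auto
  then have "norm (u i * cnj (u j)) < 1"
    by (simp add: norm_mult)
  from geometric_sums[OF this]
  show "(\<lambda>N. \<Sum>n<N. (u i * cnj (u j)) ^ n) \<longlonglongrightarrow> 1 / (1 - u i * cnj (u j))"
    by (simp add: sums_def)
qed simp

section \<open>Scalar norm bounds through finite families of points\<close>

lemma sum_Times_interleave:
  "(\<Sum>s\<in>S \<times> I. \<Sum>s'\<in>S \<times> I. F (fst s) (fst s') (snd s) (snd s'))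
    = (\<Sum>p\<in>S. \<Sum>q\<in>S. \<Sum>a\<in>I. \<Sum>b\<in>I. F p q a b)"
proof -
  have "(\<Sum>s\<in>S \<times> I. \<Sum>s'\<in>S \<times> I. F (fst s) (fst s') (snd s) (snd s'))
    = (\<Sum>p\<in>S. \<Sum>a\<in>I. \<Sum>q\<in>S. \<Sum>b\<in>I. F p q a b)"
    by (simp add: sum.cartesian_product' split_def)
  also have "\<dots> = (\<Sum>p\<in>S. \<Sum>q\<in>S. \<Sum>a\<in>I. \<Sum>b\<in>I. F p q a b)"
    by (intro sum.cong refl sum.swap)
  finally show ?thesis .
qed

lemma positive_kernel_iff_psd:
  "positive_kernel X I k \<longleftrightarrow> (\<forall>(m::nat) x. (\<forall>p<m. x p \<in> X) \<longrightarrow>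
    psd ({..<m} \<times> I) (\<lambda>s s'. k (x (fst s)) (x (fst s')) (snd s) (snd s')))"
proof -
  have "(\<forall>h. (\<Sum>p<m. \<Sum>q<m. \<Sum>a\<in>I. \<Sum>b\<in>I. k (x p) (x q) a b * h q b * cnj (h p a)) \<in> \<real>\<^sub>\<ge>\<^sub>0)
    \<longleftrightarrow> psd ({..<m} \<times> I) (\<lambda>s s'. k (x (fst s)) (x (fst s')) (snd s) (snd s'))"
    (is "(\<forall>h. ?S h \<in> _) \<longleftrightarrow> psd ?T ?K") for m and x :: "nat \<Rightarrow> 'a"
  proof -
    have eq: "(\<Sum>s\<in>?T. \<Sum>s'\<in>?T. ?K s s' * d s' * cnj (d s)) = ?S (curry d)" for d
      using sum_Times_interleave[where F = "\<lambda>p q a b. k (x p) (x q) a b * d (q, b) * cnj (d (p, a))"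
        and I = I and S = "{..<m}"]
      by simp
    show ?thesis
    proof
      assume S: "\<forall>h. ?S h \<in> \<real>\<^sub>\<ge>\<^sub>0"
      show "psd ?T ?K"
        by (rule psdI, subst eq, rule S[rule_format])
    next
      assume psd: "psd ?T ?K"
      show "\<forall>h. ?S h \<in> \<real>\<^sub>\<ge>\<^sub>0"
      proof
        fix h :: "nat \<Rightarrow> 'b \<Rightarrow> complex"
        show "?S h \<in> \<real>\<^sub>\<ge>\<^sub>0"
          using psdD[OF psd, of "case_prod h"] by (simp only: eq curry_case_prod)
      qed
    qed
  qed
  note this[symmetric]
  then show ?thesis
    unfolding positive_kernel_def by (simp only:) blast
qed

lemma positive_kernelI:
  fixes X :: "'x set" and I :: "'i set"
  assumes "\<And>(T :: (nat \<times> 'i) set) x a. finite T \<Longrightarrow> x ` T \<subseteq> X \<Longrightarrow> a ` T \<subseteq> I \<Longrightarrow>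
    psd T (\<lambda>s s'. k (x s) (x s') (a s) (a s'))"
    and "finite I"
  shows "positive_kernel X I k"
  unfolding positive_kernel_iff_psd
proof (intro allI impI)
  fix m and x :: "nat \<Rightarrow> 'x" assume "\<forall>p<m. x p \<in> X"
  then show "psd ({..<m} \<times> I) (\<lambda>s s'. k (x (fst s)) (x (fst s')) (snd s) (snd s'))"
    using assms(2) by (intro assms(1)) auto
qed

text \<open>The points \<open>x s\<close> may repeat and \<open>a s\<close> selects one matrix index
  for each of them, so a test family may follow any labelling instead of the full grid in
  \<open>positive_kernel\<close>.\<close>

lemma positive_kernelD:
  assumes "positive_kernel X I k" "finite I" "finite T" "x ` T \<subseteq> X" "a ` T \<subseteq> I"
  shows "psd T (\<lambda>s s'. k (x s) (x s') (a s) (a s'))"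
proof -
  obtain e where e: "bij_betw e {..<card T} T"
    using bij_betw_from_nat_into_finite[OF assms(3)] by blast
  define e' where "e' = inv_into {..<card T} e"
  have e': "e (e' s) = s" "e' s < card T" if "s \<in> T" for s
    using that e bij_betw_inv_into_right[OF e that] bij_betw_inv_into[OF e]
    by (auto simp: e'_def bij_betw_def)
  have "e p \<in> T" if "p < card T" for p
    using e that by (auto simp: bij_betw_def)
  then have "psd ({..<card T} \<times> I)
      (\<lambda>s s'. k ((x \<circ> e) (fst s)) ((x \<circ> e) (fst s')) (snd s) (snd s'))"
    using assms(4) assms(1)[unfolded positive_kernel_iff_psd, rule_format, of "card T" "x \<circ> e"]
    by (auto simp: image_subset_iff)
  from psd_pullback[OF this _ assms(3), of "\<lambda>s. (e' s, a s)"]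
  have "psd T (\<lambda>s s'. k (x (e (e' s))) (x (e (e' s'))) (a s) (a s'))"
    using assms(2,5) e' by (auto simp: image_subset_iff)
  then show ?thesis
    using e' by (simp cong: psd_cong)
qed

text \<open>
  In this finite-family form of the scalar norm bound the points \<open>y i\<close> may repeat, so that
  distinct indices over one point amount to matrix-valued kernels.
\<close>

definition agler_bound :: "(complex ^ 3 \<Rightarrow> complex) \<Rightarrow> real \<Rightarrow> bool"
  where "agler_bound f c \<longleftrightarrow> 0 \<le> c \<and>
    (\<forall>(I :: nat set) y G. finite I \<longrightarrow> y ` I \<subseteq> tridisk \<longrightarrow> psd I G \<longrightarrow>
      (\<forall>l. psd I (\<lambda>i j. (1 - y i $ l * cnj (y j $ l)) * G i j)) \<longrightarrow>
      psd I (\<lambda>i j. (complex_of_real (c\<^sup>2) - f (y i) * cnj (f (y j))) * G i j))"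

lemma agler_bound_nonneg: "agler_bound f c \<Longrightarrow> 0 \<le> c"
  by (simp add: agler_bound_def)

text \<open>A formula cannot quantify over index types, so \<open>agler_bound\<close> speaks of sets
  of natural numbers; an enumeration of \<open>I\<close> carries the bound over to every
  type.\<close>

lemma agler_boundD:
  fixes I :: "'i set"
  assumes f: "agler_bound f c" and "finite I" "y ` I \<subseteq> tridisk" and G: "psd I G"
    and adm: "\<And>l. psd I (\<lambda>i j. (1 - y i $ l * cnj (y j $ l)) * G i j)"
  shows "psd I (\<lambda>i j. (complex_of_real (c\<^sup>2) - f (y i) * cnj (f (y j))) * G i j)"
proof -
  obtain e where e: "bij_betw e {..<card I} I"
    using bij_betw_from_nat_into_finite[OF assms(2)] by blast
  define e' where "e' = inv_into {..<card I} e"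
  have e': "e (e' s) = s" "e' s < card I" if "s \<in> I" for s
    using that e bij_betw_inv_into_right[OF e that] bij_betw_inv_into[OF e]
    by (auto simp: e'_def bij_betw_def)
  have eI: "e ` {..<card I} \<subseteq> I"
    using e by (auto simp: bij_betw_def)
  have "psd {..<card I} (\<lambda>p q. (complex_of_real (c\<^sup>2) - f ((y \<circ> e) p) * cnj (f ((y \<circ> e) q))) * G (e p) (e q))"
  proof -
    have "finite {..<card I}" "(y \<circ> e) ` {..<card I} \<subseteq> tridisk"
      using eI assms(3) by (auto simp: image_subset_iff)
    moreover have "psd {..<card I} (\<lambda>p q. G (e p) (e q))"
      by (rule psd_pullback[OF G assms(2) _ eI]) simp
    moreover have "psd {..<card I} (\<lambda>p q. (1 - (y \<circ> e) p $ l * cnj ((y \<circ> e) q $ l)) * G (e p) (e q))" for l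
      using psd_pullback[OF adm assms(2) _ eI, of l] by simp
    ultimately show ?thesis
      using f unfolding agler_bound_def by blast
  qed
  from psd_pullback[OF this _ assms(2), of e']
  have "psd I (\<lambda>i j. (complex_of_real (c\<^sup>2) - f (y (e (e' i))) * cnj (f (y (e (e' j))))) * G (e (e' i)) (e (e' j)))"
    using e' by (auto simp: image_subset_iff)
  then show ?thesis
    using e' by (simp cong: psd_cong)
qed

lemma agler_boundI:
  assumes "0 \<le> c"
    and "\<And>(I :: nat set) y G. finite I \<Longrightarrow> y ` I \<subseteq> tridisk \<Longrightarrow> psd I G \<Longrightarrow>
      (\<And>l. psd I (\<lambda>i j. (1 - y i $ l * cnj (y j $ l)) * G i j)) \<Longrightarrow>
      psd I (\<lambda>i j. (complex_of_real (c\<^sup>2) - f (y i) * cnj (f (y j))) * G i j)"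
  shows "agler_bound f c"
  using assms unfolding agler_bound_def by blast

lemma admissible_kernels_coords:
  "k \<in> admissible_kernels X coords n \<longleftrightarrow> positive_kernel X {..<n} k \<and>
    (\<forall>l. positive_kernel X {..<n} (\<lambda>z w a b. (1 - z $ l * cnj (w $ l)) * k z w a b))"
  by (auto simp: admissible_kernels_def coords_def)

text \<open>
  A finite family becomes a scalar admissible kernel supported on its points; the vector \<open>d\<close> to be
  tested is built into the kernel, so that coinciding points cause no loss.
\<close>

lemma Hinf_bound_imp_agler_bound:
  assumes "Hinf_bound tridisk coords 1 (\<lambda>z i j. f z) c"
  shows "agler_bound f c"
proof (rule agler_boundI)
  show "0 \<le> c"
    using assms by (simp add: Hinf_bound_def)
  fix I :: "nat set" and y G
  assume fin: "finite I" and y: "y ` I \<subseteq> tridisk" and G: "psd I G"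
    and adm: "\<And>l. psd I (\<lambda>i j. (1 - y i $ l * cnj (y j $ l)) * G i j)"
  show "psd I (\<lambda>i j. (complex_of_real (c\<^sup>2) - f (y i) * cnj (f (y j))) * G i j)"
  proof (rule psdI)
    fix d
    \<comment> \<open>\<open>A j z\<close> places the weight \<open>d j\<close> over the point
      \<open>y j\<close>. Thus \<open>k z w\<close> collects all terms of the quadratic form whose
      indices lie over \<open>z\<close> and \<open>w\<close>, and testing it with the constant
      vector 1 returns the whole form.\<close>
    define A where "A = (\<lambda>j z. if y j = z then d j else (0::complex))"
    define k where "k = (\<lambda>z w (a::nat) (b::nat). \<Sum>i\<in>I. \<Sum>j\<in>I. G i j * A j w * cnj (A i z))"
    have "k \<in> admissible_kernels tridisk coords 1"
      unfolding admissible_kernels_coords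
    proof (intro conjI allI)
      show "positive_kernel tridisk {..<1::nat} k"
      proof (rule positive_kernelI)
        fix T :: "(nat \<times> nat) set" and x :: "nat \<times> nat \<Rightarrow> complex ^ 3" and a :: "nat \<times> nat \<Rightarrow> nat"
        assume "finite T"
        show "psd T (\<lambda>s s'. k (x s) (x s') (a s) (a s'))"
          using psd_congruence[OF G \<open>finite T\<close>, of "\<lambda>j s. A j (x s)"] by (simp add: k_def)
      qed simp
      fix l
      show "positive_kernel tridisk {..<1::nat} (\<lambda>z w a b. (1 - z $ l * cnj (w $ l)) * k z w a b)"
      proof (rule positive_kernelI)
        fix T :: "(nat \<times> nat) set" and x :: "nat \<times> nat \<Rightarrow> complex ^ 3" and a :: "nat \<times> nat \<Rightarrow> nat"
        assume "finite T"
        have "(1 - x s $ l * cnj (x s' $ l)) * k (x s) (x s') (a s) (a s')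
          = (\<Sum>i\<in>I. \<Sum>j\<in>I. (1 - y i $ l * cnj (y j $ l)) * G i j * A j (x s') * cnj (A i (x s)))"
          for s s'
          unfolding k_def sum_distrib_left by (intro sum.cong refl) (auto simp: A_def)
        then show "psd T (\<lambda>s s'. (1 - x s $ l * cnj (x s' $ l)) * k (x s) (x s') (a s) (a s'))"
          using psd_congruence[OF adm \<open>finite T\<close>, of l "\<lambda>j s. A j (x s)"] by simp
      qed simp
    qed
    with assms have "positive_kernel tridisk ({..<1::nat} \<times> {..<1::nat})
        (\<lambda>z w (a, a') (b, b').
          ((if a = b then complex_of_real (c\<^sup>2) else 0) - (\<Sum>l<(1::nat). f z * cnj (f w)))
            * k z w a' b')"
      unfolding Hinf_bound_def by blast
    from positive_kernelD[OF this, of "y ` I" id "\<lambda>_. (0, 0)"]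
    have "psd (y ` I) (\<lambda>z w. (complex_of_real (c\<^sup>2) - f z * cnj (f w)) * k z w 0 0)"
      using fin y by (simp add: lessThan_Suc image_subset_iff)
    from psdD[OF this, of "\<lambda>_. 1"]
    have "(\<Sum>z\<in>y ` I. \<Sum>w\<in>y ` I. (complex_of_real (c\<^sup>2) - f z * cnj (f w)) * k z w 0 0) \<in> \<real>\<^sub>\<ge>\<^sub>0"
      by simp
    also have "(\<Sum>z\<in>y ` I. \<Sum>w\<in>y ` I. (complex_of_real (c\<^sup>2) - f z * cnj (f w)) * k z w 0 0)
      = (\<Sum>z\<in>y ` I. \<Sum>w\<in>y ` I. \<Sum>i\<in>I. \<Sum>j\<in>I.
          if y i = z \<and> y j = w then (complex_of_real (c\<^sup>2) - f (y i) * cnj (f (y j))) * G i j * d j * cnj (d i) else 0)"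
      unfolding k_def sum_distrib_left by (intro sum.cong refl) (auto simp: A_def)
    also have "\<dots> = (\<Sum>i\<in>I. \<Sum>j\<in>I. \<Sum>z\<in>y ` I. \<Sum>w\<in>y ` I.
          if y i = z \<and> y j = w then (complex_of_real (c\<^sup>2) - f (y i) * cnj (f (y j))) * G i j * d j * cnj (d i) else 0)"
      (is "?L = ?R")
    proof -
      have "?L = (\<Sum>z\<in>y ` I. \<Sum>i\<in>I. \<Sum>j\<in>I. \<Sum>w\<in>y ` I.
          if y i = z \<and> y j = w then (complex_of_real (c\<^sup>2) - f (y i) * cnj (f (y j))) * G i j * d j * cnj (d i) else 0)"
        by (intro sum.cong refl, subst sum.swap, intro sum.cong refl, rule sum.swap)
      also have "\<dots> = ?R"
        by (subst sum.swap, intro sum.cong refl, rule sum.swap)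
      finally show ?thesis .
    qed
    also have "\<dots> = (\<Sum>i\<in>I. \<Sum>j\<in>I. (complex_of_real (c\<^sup>2) - f (y i) * cnj (f (y j))) * G i j * d j * cnj (d i))"
    proof (intro sum.cong refl)
      fix i j assume ij: "i \<in> I" "j \<in> I"
      define v where "v = (complex_of_real (c\<^sup>2) - f (y i) * cnj (f (y j))) * G i j * d j * cnj (d i)"
      have "(\<Sum>z\<in>y ` I. \<Sum>w\<in>y ` I. if y i = z \<and> y j = w then v else 0)
        = (\<Sum>z\<in>y ` I. if y i = z then (\<Sum>w\<in>y ` I. if y j = w then v else 0) else 0)"
        by (intro sum.cong refl) auto
      also have "\<dots> = v"
        using ij fin by simp
      finally show "(\<Sum>z\<in>y ` I. \<Sum>w\<in>y ` I. if y i = z \<and> y j = w then v else 0) = v" .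
    qed
    finally show "(\<Sum>i\<in>I. \<Sum>j\<in>I. (complex_of_real (c\<^sup>2) - f (y i) * cnj (f (y j))) * G i j * d j * cnj (d i)) \<in> \<real>\<^sub>\<ge>\<^sub>0" .
  qed
qed

lemma agler_bound_imp_Hinf_bound:
  assumes "agler_bound f c"
  shows "Hinf_bound tridisk coords 1 (\<lambda>z i j. f z) c"
  unfolding Hinf_bound_def
proof (intro conjI ballI)
  show "0 \<le> c"
    using assms by (rule agler_bound_nonneg)
  fix k assume k: "k \<in> admissible_kernels tridisk coords 1"
  show "positive_kernel tridisk ({..<1::nat} \<times> {..<1::nat})
        (\<lambda>z w (a, a') (b, b').
          ((if a = b then complex_of_real (c\<^sup>2) else 0) - (\<Sum>l<(1::nat). f z * cnj (f w)))
            * k z w a' b')"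
  proof (rule positive_kernelI, goal_cases)
    case (1 T x a)
    then have T: "finite T" "x ` T \<subseteq> tridisk" and a: "\<And>s. s \<in> T \<Longrightarrow> a s = (0, 0)"
      by (force simp: image_subset_iff)+
    have "psd T (\<lambda>s s'. (complex_of_real (c\<^sup>2) - f (x s) * cnj (f (x s'))) * k (x s) (x s') 0 0)"
    proof (rule agler_boundD[OF assms T])
      show "psd T (\<lambda>s s'. k (x s) (x s') 0 0)"
        using k T positive_kernelD[of tridisk "{..<1::nat}" k T x "\<lambda>_. 0"]
        by (simp add: admissible_kernels_coords image_subset_iff)
      show "psd T (\<lambda>s s'. (1 - x s $ l * cnj (x s' $ l)) * k (x s) (x s') 0 0)" for l
        using k T positive_kernelD[of tridisk "{..<1::nat}" "\<lambda>z w a b. (1 - z $ l * cnj (w $ l)) * k z w a b" T x "\<lambda>_. 0"]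
        by (simp add: admissible_kernels_coords image_subset_iff)
    qed
    then show ?case
      using a by (simp cong: psd_cong)
  qed simp
qed

lemma Hinf_scalar_iff: "f \<in> Hinf_scalar tridisk coords \<longleftrightarrow> (\<exists>c. agler_bound f c)"
  unfolding Hinf_scalar_def Hinf_def
  using Hinf_bound_imp_agler_bound agler_bound_imp_Hinf_bound by blast

lemma of_real_cmod_square: "(complex_of_real (cmod a))\<^sup>2 = a * cnj a"
  by (metis complex_norm_square of_real_power)

lemma agler_bound_const: "agler_bound (\<lambda>z. a) (cmod a)"
proof (rule agler_boundI)
  fix I :: "nat set" and y :: "nat \<Rightarrow> complex ^ 3" and G
  have "(complex_of_real ((cmod a)\<^sup>2) - a * cnj a) = 0"
    by (simp add: of_real_cmod_square)
  then show "psd I (\<lambda>i j. (complex_of_real ((cmod a)\<^sup>2) - a * cnj a) * G i j)"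
    by (simp add: psd_def)
qed simp

text \<open>\<open>2 (c\<^sup>2 + d\<^sup>2) - (f + g) (f + g)\<^sup>* = 2 (c\<^sup>2 - f f\<^sup>*) + 2 (d\<^sup>2 - g g\<^sup>*) + (f - g) (f - g)\<^sup>*\<close>.\<close>

lemma agler_bound_add:
  assumes "agler_bound f c" "agler_bound g d"
  shows "agler_bound (\<lambda>z. f z + g z) (sqrt (2 * (c\<^sup>2 + d\<^sup>2)))"
proof (rule agler_boundI)
  fix I :: "nat set" and y G
  assume *: "finite I" "y ` I \<subseteq> tridisk" "psd I G"
    "\<And>l. psd I (\<lambda>i j. (1 - y i $ l * cnj (y j $ l)) * G i j)"
  note psd_add[OF psd_add[OF psd_scale[OF agler_boundD[OF assms(1) *], of 2]
        psd_scale[OF agler_boundD[OF assms(2) *], of 2]]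
      psd_schur_rank_one[OF *(3), of "\<lambda>i. f (y i) - g (y i)"]]
  then show "psd I (\<lambda>i j. (complex_of_real ((sqrt (2 * (c\<^sup>2 + d\<^sup>2)))\<^sup>2)
      - (f (y i) + g (y i)) * cnj (f (y j) + g (y j))) * G i j)"
    by (simp add: algebra_simps)
qed simp

lemma agler_bound_coord_mult:
  assumes "agler_bound g c"
  shows "agler_bound (\<lambda>z. z $ l * g z) c"
proof (rule agler_boundI)
  show "0 \<le> c" using assms(1) by (rule agler_bound_nonneg)
  fix I :: "nat set" and y G
  assume *: "finite I" "y ` I \<subseteq> tridisk" "psd I G"
    "\<And>l. psd I (\<lambda>i j. (1 - y i $ l * cnj (y j $ l)) * G i j)"
  note psd_add[OF psd_scale[OF *(4), of "c\<^sup>2" l]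
      psd_schur_rank_one[OF agler_boundD[OF assms(1) *], of "\<lambda>i. y i $ l"]]
  then show "psd I (\<lambda>i j. (complex_of_real (c\<^sup>2) - (y i $ l * g (y i)) * cnj (y j $ l * g (y j))) * G i j)"
    by (simp add: algebra_simps)
qed

lemma agler_bound_coord: "agler_bound (\<lambda>z. z $ l) 1"
  using agler_bound_coord_mult[OF agler_bound_const[of 1], of l] by simp

section \<open>Changing one coordinate, and differentiability along it\<close>

definition update_coord :: "complex ^ 3 \<Rightarrow> 3 \<Rightarrow> complex \<Rightarrow> complex ^ 3"
  where "update_coord z l u = (\<chi> i. if i = l then u else z $ i)"

lemma update_coord_nth [simp]: "update_coord z l u $ i = (if i = l then u else z $ i)"
  by (simp add: update_coord_def)

lemma update_coord_same [simp]: "update_coord z l (z $ l) = z"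
  by (simp add: vec_eq_iff)

lemma update_coord_in_tridisk:
  "z \<in> tridisk \<Longrightarrow> cmod u < 1 \<Longrightarrow> update_coord z l u \<in> tridisk"
  by (simp add: tridisk_def)

text \<open>The same \<open>G\<close> stays admissible at the moved points: in coordinate
  \<open>l\<close> the factor becomes 1, which leaves positivity of \<open>G\<close>, and the other
  coordinates are unchanged.\<close>

lemma agler_bound_update_zero:
  assumes "agler_bound f c"
  shows "agler_bound (\<lambda>z. f (update_coord z l 0)) c"
proof (rule agler_boundI)
  show "0 \<le> c" using assms(1) by (rule agler_bound_nonneg)
  fix I :: "nat set" and y G
  assume *: "finite I" "y ` I \<subseteq> tridisk" "psd I G"
    "\<And>l. psd I (\<lambda>i j. (1 - y i $ l * cnj (y j $ l)) * G i j)"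
  have "psd I (\<lambda>i j. (1 - update_coord (y i) l 0 $ l' * cnj (update_coord (y j) l 0 $ l')) * G i j)" for l'
    using * by (cases "l' = l") simp_all
  moreover have "(\<lambda>i. update_coord (y i) l 0) ` I \<subseteq> tridisk"
    using *(2) by (auto simp: image_subset_iff intro!: update_coord_in_tridisk)
  ultimately show "psd I (\<lambda>i j. (complex_of_real (c\<^sup>2) - f (update_coord (y i) l 0)
      * cnj (f (update_coord (y j) l 0))) * G i j)"
    using *(1,3) by (intro agler_boundD[OF assms]) auto
qed

text \<open>
  Apply the bound to the points with \<open>l\<close>-th coordinate \<open>0\<close>, \<open>u\<close>, \<open>v\<close> and the Szego kernel \<open>K\<close>.
  Since \<open>K - 1 = u\<^sub>i u\<^sub>j\<^sup>* K\<close> is positive, \<open>c\<^sup>2 K - f f\<^sup>*\<close> is positive as well, and it is tested on the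
  functional which takes the difference of the two difference quotients.
\<close>

lemma agler_difference_quotient:
  assumes f: "agler_bound f c" and z: "z \<in> tridisk"
    and u: "u \<noteq> 0" "cmod u \<le> \<delta>" and v: "v \<noteq> 0" "cmod v \<le> \<delta>" and \<delta>: "\<delta> \<le> 1/2"
  shows "cmod ((f (update_coord z l u) - f (update_coord z l 0)) / u
      - (f (update_coord z l v) - f (update_coord z l 0)) / v) \<le> 3 * c * \<delta>"
proof -
  define w where "w = (\<lambda>i::nat. if i = 0 then 0 else if i = 1 then u else v)"
  \<comment> \<open>Conjugated coefficients of the functional
    \<open>(F 1 - F 0) / u - (F 2 - F 0) / v\<close>.\<close>
  define d where "d = (\<lambda>i::nat. cnj (if i = 0 then 1/v - 1/u else if i = 1 then 1/u else - (1/v)))"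
  define F where "F = (\<lambda>i. f (update_coord z l (w i)))"
  define K where "K = (\<lambda>i j. 1 / (1 - w i * cnj (w j)))"
  have c: "0 \<le> c" using f by (rule agler_bound_nonneg)
  have \<delta>0: "0 \<le> \<delta>"
    using u(2) norm_ge_zero order_trans by blast
  have w\<delta>: "cmod (w i) \<le> \<delta>" for i
    using u v \<delta>0 by (simp add: w_def)
  then have w1: "cmod (w i) < 1" for i
    using \<delta> by (smt (verit) w\<delta> field_sum_of_halves)
  have ww: "cmod (w i * cnj (w j)) \<le> \<delta>\<^sup>2" for i j
    using mult_mono[OF w\<delta>[of i] w\<delta>[of j]] \<delta>0 by (simp add: norm_mult power2_eq_square)
  have \<delta>2: "\<delta>\<^sup>2 \<le> 1/4"
    using power_mono[OF \<delta> \<delta>0, of 2] by (simp add: power2_eq_square)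
  have K: "psd {..<3} K"
    unfolding K_def using w1 by (intro psd_szego) auto
  have ne: "1 - w i * cnj (w j) \<noteq> 0" for i j
    using ww[of i j] \<delta>2 by auto
  have "psd {..<3} (\<lambda>i j. (complex_of_real (c\<^sup>2) - F i * cnj (F j)) * K i j)"
    unfolding F_def
  proof (rule agler_boundD[OF f _ _ K])
    show "(\<lambda>i. update_coord z l (w i)) ` {..<3} \<subseteq> tridisk"
      using w1 z by (auto intro!: update_coord_in_tridisk)
    show "psd {..<3} (\<lambda>i j. (1 - update_coord z l (w i) $ l' * cnj (update_coord z l (w j) $ l')) * K i j)" for l'
    proof (cases "l' = l")
      case True
      then have "(1 - update_coord z l (w i) $ l' * cnj (update_coord z l (w j) $ l')) * K i j = 1" for i j
        using ne[of i j] by (simp add: K_def)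
      then show ?thesis by (simp add: psd_ones)
    \<comment> \<open>The other coordinates are constant along the family, so the factor is the
      nonnegative number \<open>1 - (cmod (z $ l'))\<^sup>2\<close>.\<close>
    next
      case False
      have "cmod (z $ l') < 1"
        using z by (simp add: tridisk_def)
      then have "0 \<le> 1 - (cmod (z $ l'))\<^sup>2"
        by (simp add: abs_square_le_1)
      from psd_scale[OF K this] False show ?thesis
        by (simp add: of_real_cmod_square)
    qed
  qed simp
  moreover have "psd {..<3} (\<lambda>i j. F i * cnj (F j) * (w i * cnj (w j) * K i j))"
    by (intro psd_schur_rank_one K)
  ultimately have "psd {..<3} (\<lambda>i j. (complex_of_real (c\<^sup>2) - F i * cnj (F j)) * K i j
      + F i * cnj (F j) * (w i * cnj (w j) * K i j))"
    by (rule psd_add)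
  moreover have "(complex_of_real (c\<^sup>2) - F i * cnj (F j)) * K i j + F i * cnj (F j) * (w i * cnj (w j) * K i j)
      = complex_of_real (c\<^sup>2) * K i j - F i * cnj (F j)" for i j
  proof -
    have "(complex_of_real (c\<^sup>2) - F i * cnj (F j)) * K i j + F i * cnj (F j) * (w i * cnj (w j) * K i j)
      = complex_of_real (c\<^sup>2) * K i j - F i * cnj (F j) * ((1 - w i * cnj (w j)) * K i j)"
      by (simp add: algebra_simps)
    then show ?thesis
      using ne[of i j] by (simp add: K_def)
  qed
  ultimately have "psd {..<3} (\<lambda>i j. complex_of_real (c\<^sup>2) * K i j - F i * cnj (F j))"
    by simp
  from psdD[OF this, of d]
  have "(\<Sum>i<3. \<Sum>j<3. (complex_of_real (c\<^sup>2) * K i j - F i * cnj (F j)) * d j * cnj (d i)) \<in> \<real>\<^sub>\<ge>\<^sub>0" .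
  moreover have "(\<Sum>i<3. \<Sum>j<3. (complex_of_real (c\<^sup>2) * K i j - F i * cnj (F j)) * d j * cnj (d i))
    = complex_of_real (c\<^sup>2) * (\<Sum>i<3. \<Sum>j<3. K i j * d j * cnj (d i))
      - (\<Sum>i<3. cnj (d i) * F i) * cnj (\<Sum>i<3. cnj (d i) * F i)"
    by (simp add: eval_nat_numeral algebra_simps)
  moreover have "(\<Sum>i<3. cnj (d i) * F i) = (F 1 - F 0) / u - (F 2 - F 0) / v" (is "_ = ?q")
    by (simp add: eval_nat_numeral d_def algebra_simps diff_divide_distrib)
  moreover have "(\<Sum>i<3. \<Sum>j<3. K i j * d j * cnj (d i)) = K 1 1 + K 2 2 - K 1 2 - K 2 1"
  proof -
    \<comment> \<open>The coefficients of \<open>d\<close> sum to 0 and divide by \<open>u\<close>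
      and \<open>v\<close>; as \<open>K - 1 = w w\<^sup>* K\<close>, this division gives back
      \<open>K\<close>, and the form collapses to a mixed second difference of \<open>K\<close>,
      which is small near 0.\<close>
    have K_ij: "(K i j - 1) / (w i * cnj (w j)) = K i j" if "w i \<noteq> 0" "w j \<noteq> 0" for i j
      using ne[of i j] that by (simp add: K_def field_simps)
    have "K i 0 = 1" "K 0 i = 1" for i
      by (simp_all add: K_def w_def)
    then have "(\<Sum>i<3. \<Sum>j<3. K i j * d j * cnj (d i))
      = (K 1 1 - 1) / (w 1 * cnj (w 1)) + (K 2 2 - 1) / (w 2 * cnj (w 2))
        - (K 1 2 - 1) / (w 1 * cnj (w 2)) - (K 2 1 - 1) / (w 2 * cnj (w 1))"
      using u(1) v(1) by (simp add: eval_nat_numeral d_def w_def field_simps)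
    moreover have "w 1 \<noteq> 0" "w 2 \<noteq> 0"
      using u(1) v(1) by (simp_all add: w_def)
    ultimately show ?thesis
      by (simp only: K_ij simp_thms)
  qed
  ultimately have "complex_of_real (c\<^sup>2) * (K 1 1 + K 2 2 - K 1 2 - K 2 1) - ?q * cnj ?q \<in> \<real>\<^sub>\<ge>\<^sub>0"
    by simp
  then have "0 \<le> Re (complex_of_real (c\<^sup>2) * (K 1 1 + K 2 2 - K 1 2 - K 2 1) - ?q * cnj ?q)"
    by (simp add: complex_nonneg_Reals_iff)
  then have "(cmod ?q)\<^sup>2 \<le> c\<^sup>2 * Re (K 1 1 + K 2 2 - K 1 2 - K 2 1)"
    unfolding complex_norm_square[symmetric] by simp
  \<comment> \<open>Each of the four entries differs from 1 by at most
    \<open>2 * \<delta>\<^sup>2\<close>. The resulting 8 is enlarged to 9 to make the bound a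
    perfect square.\<close>
  also have "\<dots> \<le> c\<^sup>2 * (9 * \<delta>\<^sup>2)"
  proof (intro mult_left_mono)
    have K1: "cmod (K i j - 1) \<le> 2 * \<delta>\<^sup>2" for i j
    proof -
      have "K i j - 1 = w i * cnj (w j) / (1 - w i * cnj (w j))"
        using ne[of i j] by (simp add: K_def field_simps)
      moreover have "1/2 \<le> cmod (1 - w i * cnj (w j))"
        using norm_triangle_ineq2[of 1 "w i * cnj (w j)"] ww[of i j] \<delta>2 by simp
      ultimately have "cmod (K i j - 1) \<le> \<delta>\<^sup>2 / (1/2)"
        using ww[of i j] by (simp only: norm_divide) (intro frac_le, auto)
      then show ?thesis by simp
    qed
    have "K 1 1 + K 2 2 - K 1 2 - K 2 1 = (K 1 1 - 1) + (K 2 2 - 1) - (K 1 2 - 1) - (K 2 1 - 1)"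
      by simp
    also have "cmod \<dots> \<le> cmod (K 1 1 - 1) + cmod (K 2 2 - 1) + cmod (K 1 2 - 1) + cmod (K 2 1 - 1)"
      by (intro order_trans[OF norm_triangle_ineq4] add_mono norm_triangle_ineq order_refl)
    also have "\<dots> \<le> 8 * \<delta>\<^sup>2"
      using K1[of 1 1] K1[of 2 2] K1[of 1 2] K1[of 2 1] by linarith
    finally have "Re (K 1 1 + K 2 2 - K 1 2 - K 2 1) \<le> 8 * \<delta>\<^sup>2"
      using complex_Re_le_cmod order_trans by blast
    then show "Re (K 1 1 + K 2 2 - K 1 2 - K 2 1) \<le> 9 * \<delta>\<^sup>2"
      using zero_le_power2[of \<delta>] by linarith
  qed simp
  also have "\<dots> = (3 * c * \<delta>)\<^sup>2"
    by (simp add: power_mult_distrib)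
  finally have "cmod ?q \<le> 3 * c * \<delta>"
    using c \<delta>0 by (auto intro: power2_le_imp_le)
  then show ?thesis
    by (simp add: F_def w_def)
qed

text \<open>Difference quotients at radius \<delta> differ by at most
  \<open>3 * c * \<delta>\<close>, so they satisfy the Cauchy criterion at 0 and completeness
  supplies the derivative.\<close>

lemma agler_coord_differentiable:
  assumes f: "agler_bound f c" and z: "z \<in> tridisk"
  shows "(\<lambda>u. f (update_coord z l u)) field_differentiable (at 0)"
proof -
  define q where "q = (\<lambda>u. (f (update_coord z l u) - f (update_coord z l 0)) / u)"
  have q: "cmod (q u - q v) \<le> 3 * c * \<delta>"
    if "u \<noteq> 0" "cmod u \<le> \<delta>" "v \<noteq> 0" "cmod v \<le> \<delta>" "\<delta> \<le> 1/2" for u v \<delta>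
    unfolding q_def using agler_difference_quotient[OF f z that] .
  have c: "0 \<le> c" using f by (rule agler_bound_nonneg)
  \<comment> \<open>The sequence \<open>1 / (n + 2)\<close> starts at 1/2, the largest radius for
    which the estimate of difference quotients is available.\<close>
  define s where "s = (\<lambda>n. complex_of_real (inverse (real (Suc (Suc n)))))"
  have s: "s n \<noteq> 0" "cmod (s n) = inverse (real (Suc (Suc n)))" for n
    by (simp_all add: s_def norm_inverse del: of_nat_Suc)
  have s_le: "cmod (s m) \<le> inverse (real (Suc (Suc n)))" if "n \<le> m" for m n
    unfolding s(2) using that by (intro le_imp_inverse_le) auto
  have s_half: "inverse (real (Suc (Suc n))) \<le> 1/2" for n
    using le_imp_inverse_le[of 2 "real (Suc (Suc n))"] by simp
  have lim0: "(\<lambda>n. 3 * c * inverse (real (Suc (Suc n)))) \<longlonglongrightarrow> 0"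
    using LIMSEQ_Suc[OF LIMSEQ_inverse_real_of_nat] by (auto intro: tendsto_mult_right_zero)
  have "Cauchy (\<lambda>n. q (s n))"
  proof (rule CauchyI)
    fix e :: real assume "0 < e"
    then obtain N where N: "3 * c * inverse (real (Suc (Suc N))) < e"
      using order_tendstoD(2)[OF lim0] by (auto simp: eventually_sequentially)
    have "norm (q (s m) - q (s n)) < e" if "N \<le> m" "N \<le> n" for m n
      using q[OF s(1) s_le[OF that(1)] s(1) s_le[OF that(2)] s_half] N by linarith
    then show "\<exists>M. \<forall>m\<ge>M. \<forall>n\<ge>M. norm (q (s m) - q (s n)) < e" by blast
  qed
  then obtain L where L: "(\<lambda>n. q (s n)) \<longlonglongrightarrow> L"
    using Cauchy_convergent convergent_def by blast
  have qL: "cmod (q u - L) \<le> 3 * c * cmod u" if "u \<noteq> 0" "cmod u \<le> 1/2" for u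
  proof -
    have lim: "(\<lambda>n. cmod (q u - q (s n))) \<longlonglongrightarrow> cmod (q u - L)"
      by (intro tendsto_intros L)
    have "(\<lambda>n. inverse (real (Suc (Suc n)))) \<longlonglongrightarrow> 0"
      using LIMSEQ_Suc[OF LIMSEQ_inverse_real_of_nat] .
    from order_tendstoD(2)[OF this, of "cmod u"] that(1)
    have "\<forall>\<^sub>F n in sequentially. inverse (real (Suc (Suc n))) < cmod u"
      by simp
    then obtain N where N: "inverse (real (Suc (Suc N))) < cmod u"
      unfolding eventually_sequentially by blast
    have "\<forall>n\<ge>N. cmod (q u - q (s n)) \<le> 3 * c * cmod u"
    proof (intro allI impI)
      fix n assume "N \<le> n"
      then have "cmod (s n) \<le> cmod u"
        using s_le[of N n] N by linarith
      then show "cmod (q u - q (s n)) \<le> 3 * c * cmod u"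
        using q[OF that(1) order_refl s(1) _ that(2)] by blast
    qed
    with lim show ?thesis
      by (rule Lim_bounded)
  qed
  have "((\<lambda>u. q u - L) \<longlongrightarrow> 0) (at 0)"
  proof (rule Lim_null_comparison)
    show "\<forall>\<^sub>F u in at 0. norm (q u - L) \<le> 3 * c * cmod u"
      unfolding eventually_at using qL by (intro exI[of _ "1/2"]) (auto simp: dist_norm)
    show "((\<lambda>u. 3 * c * cmod u) \<longlongrightarrow> 0) (at (0::complex))"
      by (intro tendsto_mult_right_zero tendsto_norm_zero tendsto_ident_at)
  qed
  then have "((\<lambda>u. f (update_coord z l u)) has_field_derivative L) (at 0)"
    by (simp add: DERIV_def q_def LIM_zero_iff)
  then show ?thesis
    using field_differentiable_def by blast
qed

section \<open>Division by a coordinate function\<close>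

lemma two_point_compression:
  fixes b b' :: complex
  assumes "b \<noteq> 0" "b' \<noteq> 0"
  shows "(C - p * q) * (1 + b * b') * G * (d / (2 * b')) * (e / (2 * b))
    + (C - p * q') * (1 - b * b') * G * (- d / (2 * b')) * (e / (2 * b))
    + ((C - p' * q) * (1 - b * b') * G * (d / (2 * b')) * (- e / (2 * b))
    + (C - p' * q') * (1 + b * b') * G * (- d / (2 * b')) * (- e / (2 * b)))
    = (C - (p - p') * (q - q') / (4 * b * b') - (p + p') * (q + q') / 4) * G * d * e"
proof -
  define k where "k = G * d * e / (4 * b * b')"
  define w1 where "w1 = (C - p * q) * (1 + b * b')"
  define w2 where "w2 = (C - p * q') * (1 - b * b')"
  define w3 where "w3 = (C - p' * q) * (1 - b * b')"
  define w4 where "w4 = (C - p' * q') * (1 + b * b')"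
  have k: "w * G * (d / (2 * b')) * (e / (2 * b)) = w * k"
      "w * G * (- d / (2 * b')) * (e / (2 * b)) = - (w * k)"
      "w * G * (d / (2 * b')) * (- e / (2 * b)) = - (w * k)"
      "w * G * (- d / (2 * b')) * (- e / (2 * b)) = w * k" for w
    by (simp_all add: k_def mult_ac)
  have w: "w1 - w2 - w3 + w4
    = (C - (p - p') * (q - q') / (4 * b * b') - (p + p') * (q + q') / 4) * (4 * b * b')"
    using assms by (simp add: w1_def w2_def w3_def w4_def field_simps)
  have "w1 * G * (d / (2 * b')) * (e / (2 * b)) + w2 * G * (- d / (2 * b')) * (e / (2 * b))
    + (w3 * G * (d / (2 * b')) * (- e / (2 * b)) + w4 * G * (- d / (2 * b')) * (- e / (2 * b)))
    = (w1 - w2 - w3 + w4) * k"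
    by (simp only: k) (simp add: left_diff_distrib distrib_right)
  also have "\<dots> = (C - (p - p') * (q - q') / (4 * b * b') - (p + p') * (q + q') / 4) * (4 * b * b' * k)"
    unfolding w by (simp only: mult.assoc)
  also have "4 * b * b' * k = G * d * e"
    using assms by (simp add: k_def)
  finally show ?thesis
    by (simp only: w1_def w2_def w3_def w4_def mult.assoc)
qed

text \<open>A disk automorphism changes \<open>1 - y * cnj y'\<close> only by a rank-one factor
  without zeros. Admissibility may therefore be checked after applying the automorphism.\<close>

lemma mobius_kernel_identity:
  fixes a :: real and y y' :: complex
  assumes "\<bar>a\<bar> < 1" "cmod y < 1" "cmod y' < 1"
  defines "\<rho> \<equiv> \<lambda>y. 1 - complex_of_real a * y"
    and "\<beta> \<equiv> \<lambda>y. (y - complex_of_real a) / (1 - complex_of_real a * y)"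
  shows "\<rho> y \<noteq> 0"
    and "(1 - y * cnj y') * (1 - complex_of_real (a\<^sup>2)) = \<rho> y * cnj (\<rho> y') * (1 - \<beta> y * cnj (\<beta> y'))"
proof -
  have *: "\<rho> y \<noteq> 0" if "cmod y < 1" for y
  proof
    assume "\<rho> y = 0"
    then have "complex_of_real a * y = 1" by (simp add: \<rho>_def)
    then have "\<bar>a\<bar> * cmod y = 1"
      by (metis norm_mult norm_of_real norm_one)
    moreover have "\<bar>a\<bar> * cmod y \<le> \<bar>a\<bar> * 1"
      using that by (intro mult_left_mono) auto
    ultimately show False using assms(1) by simp
  qed
  show "\<rho> y \<noteq> 0" using * assms(2) .
  have "\<rho> y * \<beta> y = y - complex_of_real a" if "cmod y < 1" for y
    using *[OF that] by (simp add: \<rho>_def \<beta>_def)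
  note \<rho>\<beta> = this[OF assms(2)] this[OF assms(3)]
  have "\<rho> y * cnj (\<rho> y') * (1 - \<beta> y * cnj (\<beta> y'))
    = \<rho> y * cnj (\<rho> y') - (\<rho> y * \<beta> y) * cnj (\<rho> y' * \<beta> y')"
    by (simp add: algebra_simps)
  also have "\<dots> = \<rho> y * cnj (\<rho> y') - (y - complex_of_real a) * cnj (y' - complex_of_real a)"
    by (simp only: \<rho>\<beta>)
  finally have "\<rho> y * cnj (\<rho> y') * (1 - \<beta> y * cnj (\<beta> y'))
    = \<rho> y * cnj (\<rho> y') - (y - complex_of_real a) * cnj (y' - complex_of_real a)" .
  then show "(1 - y * cnj y') * (1 - complex_of_real (a\<^sup>2)) = \<rho> y * cnj (\<rho> y') * (1 - \<beta> y * cnj (\<beta> y'))"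
    by (simp add: \<rho>_def algebra_simps power2_eq_square)
qed

text \<open>
  In operator terms let \<open>S\<close> be multiplication by the \<open>l\<close>-th coordinate on the space with kernel \<open>G\<close>
  and take \<open>a = 0\<close>.  Then \<open>\<onehalf> (S, 1; S\<^sup>2, S) = \<onehalf> (1; S) (S, 1)\<close> is a contraction commuting with the
  other coordinates, whose \<open>n\<close>-th power is \<open>S\<^sup>n\<^sup>-\<^sup>1\<close> times itself; hence the upper right corner of
  \<open>f\<close> at it is \<open>(f - f(0)) / 2 S\<close>.  Its adjoint has the eigenvectors \<open>(\<plusminus> b\<^sub>p\<^sup>* k\<^sub>p, k\<^sub>p)\<close>, over the point \<open>y p\<close>
  for the sign \<open>+\<close> and over the point with coordinate \<open>a\<close> for \<open>-\<close>.  These span only if no \<open>b\<^sub>p\<close>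
  vanishes, which a generic Moebius parameter \<open>a\<close> ensures.
\<close>

lemma agler_mobius_quotient:
  fixes I :: "nat set" and y :: "nat \<Rightarrow> complex ^ 3" and a :: real
  assumes f: "agler_bound f c" and fin: "finite I" and y: "y ` I \<subseteq> tridisk" and G: "psd I G"
    and adm: "\<And>l. psd I (\<lambda>i j. (1 - y i $ l * cnj (y j $ l)) * G i j)"
    and a: "0 < a" "a < 1" "\<And>p. p \<in> I \<Longrightarrow> complex_of_real a \<noteq> y p $ l"
  defines "\<gamma> \<equiv> \<lambda>p. (f (y p) - f (update_coord (y p) l (complex_of_real a)))
    / ((y p $ l - complex_of_real a) / (1 - complex_of_real a * (y p $ l)))"
  shows "psd I (\<lambda>p q. (complex_of_real ((2 * c)\<^sup>2) - \<gamma> p * cnj (\<gamma> q)) * G p q)"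
proof -
  define A where "A = complex_of_real a"
  define r where "r = (\<lambda>z. 1 - A * z)"
  define b where "b = (\<lambda>p. (y p $ l - A) / r (y p $ l))"
  define pt where "pt = (\<lambda>p \<sigma>. if \<sigma> then y p else update_coord (y p) l A)"
  define sg where "sg = (\<lambda>\<sigma>. if \<sigma> then 1 else - 1 :: complex)"
  \<comment> \<open>The Gram matrix of the eigenvectors
    \<open>(\<plusminus> b\<^sub>p\<^sup>* k\<^sub>p, k\<^sub>p)\<close>, where \<open>G\<close> is
    the Gram matrix of the \<open>k\<^sub>p\<close>.\<close>
  define H where "H = (\<lambda>p q \<sigma> \<tau>. (1 + sg \<sigma> * b p * cnj (sg \<tau> * b q)) * G p q)"
  define T where "T = I \<times> (UNIV :: bool set)"
  have finT: "finite T" using fin by (simp add: T_def)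
  have yl: "cmod (y p $ l) < 1" if "p \<in> I" for p
    using y that by (auto simp: tridisk_def image_subset_iff)
  have cA: "cmod A < 1" "cnj A = A"
    using a by (simp_all add: A_def)
  have A2: "1 - A * A \<noteq> 0"
  proof -
    have "a * a < 1 * 1" using a by (intro mult_strict_mono) auto
    then have "1 - a * a \<noteq> 0" by simp
    then have "complex_of_real (1 - a * a) \<noteq> 0" by (metis of_real_eq_0_iff)
    then show ?thesis by (simp add: A_def)
  qed
  have r0: "r (y p $ l) \<noteq> 0" if "p \<in> I" for p
    using mobius_kernel_identity(1)[of a "y p $ l" 0] yl[OF that] a by (simp add: r_def A_def)
  have b0: "b p \<noteq> 0" if "p \<in> I" for p
    using r0[OF that] a(3)[OF that] by (auto simp: b_def A_def)
  have mob: "(1 - y p $ l * cnj (y q $ l)) * (1 - A * A)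
      = r (y p $ l) * cnj (r (y q $ l)) * (1 - b p * cnj (b q))" if "p \<in> I" "q \<in> I" for p q
    using mobius_kernel_identity(2)[of a "y p $ l" "y q $ l"] yl[OF that(1)] yl[OF that(2)] a
    by (simp add: r_def A_def b_def power2_eq_square)
  have lift: "psd T (\<lambda>s s'. K (fst s) (fst s'))" if "psd I K" for K
    using psd_pullback[OF that fin finT, of fst] by (auto simp: T_def)
  have H: "psd T (\<lambda>s s'. H (fst s) (fst s') (snd s) (snd s'))"
    using psd_add[OF lift[OF G] psd_schur_rank_one[OF lift[OF G], of "\<lambda>s. sg (snd s) * b (fst s)"]]
    by (simp add: H_def distrib_right)
  have adm_H: "psd T (\<lambda>s s'. (1 - pt (fst s) (snd s) $ l' * cnj (pt (fst s') (snd s') $ l'))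
      * H (fst s) (fst s') (snd s) (snd s'))" for l'
  proof (cases "l' = l")
    case False
    then have "pt p \<sigma> $ l' = y p $ l'" for p \<sigma>
      by (simp add: pt_def)
    moreover note psd_add[OF lift[OF adm] psd_schur_rank_one[OF lift[OF adm], of "\<lambda>s. sg (snd s) * b (fst s)"], of l' l']
    ultimately show ?thesis
      by (simp add: H_def distrib_right distrib_left mult_ac)
  next
    case True
    \<comment> \<open>Admissibility of \<open>G\<close> in coordinate \<open>l\<close>, rewritten
      for the Moebius images \<open>b p\<close> of the coordinates.\<close>
    define \<kappa> where "\<kappa> = (\<lambda>p q. (1 - b p * cnj (b q)) * G p q)"
    have \<kappa>: "psd I \<kappa>"
    proof -
      have "psd I (\<lambda>p q. complex_of_real (1 - a\<^sup>2) * ((1 / r (y p $ l)) * cnj (1 / r (y q $ l))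
          * ((1 - y p $ l * cnj (y q $ l)) * G p q)))"
        using a by (intro psd_scale psd_schur_rank_one adm) (simp add: power_le_one)
      moreover have "complex_of_real (1 - a\<^sup>2) * ((1 / r (y p $ l)) * cnj (1 / r (y q $ l))
          * ((1 - y p $ l * cnj (y q $ l)) * G p q)) = \<kappa> p q" if "p \<in> I" "q \<in> I" for p q
      proof -
        have "complex_of_real (1 - a\<^sup>2) * ((1 / r (y p $ l)) * cnj (1 / r (y q $ l))
            * ((1 - y p $ l * cnj (y q $ l)) * G p q))
          = ((1 - y p $ l * cnj (y q $ l)) * (1 - A * A)) / (r (y p $ l) * cnj (r (y q $ l))) * G p q"
          by (simp add: A_def power2_eq_square)
        also have "\<dots> = \<kappa> p q"
          unfolding mob[OF that] \<kappa>_def using r0[OF that(1)] r0[OF that(2)] by simp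
        finally show ?thesis .
      qed
      ultimately show ?thesis by (simp cong: psd_cong)
    qed
    define pos where "pos = (\<lambda>\<sigma>. if \<sigma> then 1 else 0 :: complex)"
    define M where "M = (\<lambda>p q \<sigma> \<tau>. \<kappa> p q + (pos \<sigma> * b p) * cnj (pos \<tau> * b q) * \<kappa> p q
      + ((1 - pos \<sigma>) * b p) * cnj ((1 - pos \<tau>) * b q) * (complex_of_real 2 * G p q))"
    have "psd T (\<lambda>s s'. M (fst s) (fst s') (snd s) (snd s'))"
      unfolding M_def
      by (intro psd_add psd_schur_rank_one[where u = "\<lambda>s. pos (snd s) * b (fst s)"]
          psd_schur_rank_one[where u = "\<lambda>s. (1 - pos (snd s)) * b (fst s)"] psd_scale lift \<kappa> G) simp
    then have M_psd: "psd T (\<lambda>s s'. complex_of_real (1 / (1 - a\<^sup>2)) * (r (pt (fst s) (snd s) $ l) * cnj (r (pt (fst s') (snd s') $ l))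
        * M (fst s) (fst s') (snd s) (snd s')))"
      using a by (intro psd_scale psd_schur_rank_one) (simp_all add: power_le_one)
    have M_eq: "complex_of_real (1 / (1 - a\<^sup>2)) * (r (pt p \<sigma> $ l) * cnj (r (pt q \<tau> $ l)) * M p q \<sigma> \<tau>)
      = (1 - pt p \<sigma> $ l' * cnj (pt q \<tau> $ l')) * H p q \<sigma> \<tau>" if "p \<in> I" "q \<in> I" for p q \<sigma> \<tau>
    proof -
      define m where "m = (\<lambda>p \<sigma>. pos \<sigma> * b p)"
      have mob': "(1 - pt p \<sigma> $ l * cnj (pt q \<tau> $ l)) * (1 - A * A)
        = r (pt p \<sigma> $ l) * cnj (r (pt q \<tau> $ l)) * (1 - m p \<sigma> * cnj (m q \<tau>))"
        using mob[OF that] cA(2)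
        by (cases \<sigma>; cases \<tau>) (simp_all add: pt_def m_def pos_def r_def algebra_simps)
      have M: "M p q \<sigma> \<tau> = (1 - m p \<sigma> * cnj (m q \<tau>)) * H p q \<sigma> \<tau>"
        by (cases \<sigma>; cases \<tau>) (simp_all add: M_def H_def m_def pos_def sg_def \<kappa>_def algebra_simps)
      have "complex_of_real (1 / (1 - a\<^sup>2)) * (r (pt p \<sigma> $ l) * cnj (r (pt q \<tau> $ l)) * M p q \<sigma> \<tau>)
        = (r (pt p \<sigma> $ l) * cnj (r (pt q \<tau> $ l)) * (1 - m p \<sigma> * cnj (m q \<tau>))) * H p q \<sigma> \<tau> / (1 - A * A)"
        unfolding M by (simp add: A_def power2_eq_square)
      also have "\<dots> = (1 - pt p \<sigma> $ l * cnj (pt q \<tau> $ l)) * H p q \<sigma> \<tau>"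
        unfolding mob'[symmetric] using A2 by simp
      finally show ?thesis by (simp add: True)
    qed
    from M_psd show ?thesis
      by (rule psd_cong[THEN iffD1, rotated]) (intro M_eq, auto simp: T_def)
  qed
  have ptT: "(\<lambda>s. pt (fst s) (snd s)) ` T \<subseteq> tridisk"
    using y cA by (auto simp: T_def pt_def intro!: update_coord_in_tridisk)
  note bound = agler_boundD[OF f finT ptT H adm_H]
  define f1 where "f1 = (\<lambda>p. f (y p))"
  define f2 where "f2 = (\<lambda>p. f (update_coord (y p) l A))"
  have "psd I (\<lambda>p q. (complex_of_real (c\<^sup>2) - (f1 p - f2 p) * cnj (f1 q - f2 q) / (4 * b p * cnj (b q))
      - (f1 p + f2 p) * cnj (f1 q + f2 q) / 4) * G p q)"
  proof (rule psdI)
    fix d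
    \<comment> \<open>These weights combine the two eigenvectors over \<open>p\<close> into
      \<open>(d p k\<^sub>p, 0)\<close>; here \<open>b p\<close> must not vanish.\<close>
    define D where "D = (\<lambda>p \<sigma>. sg \<sigma> * d p / (2 * cnj (b p)))"
    have "(\<Sum>s\<in>T. \<Sum>s'\<in>T. (complex_of_real (c\<^sup>2) - f (pt (fst s) (snd s)) * cnj (f (pt (fst s') (snd s'))))
        * H (fst s) (fst s') (snd s) (snd s') * D (fst s') (snd s') * cnj (D (fst s) (snd s))) \<in> \<real>\<^sub>\<ge>\<^sub>0"
      by (rule psdD[OF bound])
    also have "(\<Sum>s\<in>T. \<Sum>s'\<in>T. (complex_of_real (c\<^sup>2) - f (pt (fst s) (snd s)) * cnj (f (pt (fst s') (snd s'))))
        * H (fst s) (fst s') (snd s) (snd s') * D (fst s') (snd s') * cnj (D (fst s) (snd s)))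
      = (\<Sum>p\<in>I. \<Sum>q\<in>I. \<Sum>\<sigma>\<in>UNIV. \<Sum>\<tau>\<in>UNIV. (complex_of_real (c\<^sup>2) - f (pt p \<sigma>) * cnj (f (pt q \<tau>)))
        * H p q \<sigma> \<tau> * D q \<tau> * cnj (D p \<sigma>))"
      unfolding T_def by (rule sum_Times_interleave)
    also have "\<dots> = (\<Sum>p\<in>I. \<Sum>q\<in>I. (complex_of_real (c\<^sup>2) - (f1 p - f2 p) * cnj (f1 q - f2 q) / (4 * b p * cnj (b q))
      - (f1 p + f2 p) * cnj (f1 q + f2 q) / 4) * G p q * d q * cnj (d p))"
    proof (intro sum.cong refl)
      fix p q assume "p \<in> I" "q \<in> I"
      then have "b p \<noteq> 0" "cnj (b q) \<noteq> 0"
        using b0 by auto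
      from two_point_compression[OF this, of "complex_of_real (c\<^sup>2)" "f1 p" "cnj (f1 q)" "G p q" "d q" "cnj (d p)" "cnj (f2 q)" "f2 p"]
      show "(\<Sum>\<sigma>\<in>UNIV. \<Sum>\<tau>\<in>UNIV. (complex_of_real (c\<^sup>2) - f (pt p \<sigma>) * cnj (f (pt q \<tau>)))
          * H p q \<sigma> \<tau> * D q \<tau> * cnj (D p \<sigma>))
        = (complex_of_real (c\<^sup>2) - (f1 p - f2 p) * cnj (f1 q - f2 q) / (4 * b p * cnj (b q))
          - (f1 p + f2 p) * cnj (f1 q + f2 q) / 4) * G p q * d q * cnj (d p)"
        by (simp add: UNIV_bool H_def D_def sg_def pt_def f1_def f2_def add_ac mult.assoc)
    qed
    finally show "(\<Sum>p\<in>I. \<Sum>q\<in>I. (complex_of_real (c\<^sup>2) - (f1 p - f2 p) * cnj (f1 q - f2 q) / (4 * b p * cnj (b q))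
      - (f1 p + f2 p) * cnj (f1 q + f2 q) / 4) * G p q * d q * cnj (d p)) \<in> \<real>\<^sub>\<ge>\<^sub>0" .
  qed
  \<comment> \<open>Adding the positive term of the mean values back leaves only the half quotient.
    Scaling by 4 turns it into the full quotient and \<open>c\<^sup>2\<close> into
    \<open>(2 * c)\<^sup>2\<close>, the origin of the constant in
    \<open>agler_division\<close>.\<close>
  from psd_scale[OF psd_add[OF this psd_schur_rank_one[OF G, of "\<lambda>p. (f1 p + f2 p) / 2"]], of 4]
  have "psd I (\<lambda>p q. complex_of_real 4 * ((complex_of_real (c\<^sup>2) - (f1 p - f2 p) * cnj (f1 q - f2 q) / (4 * b p * cnj (b q))
      - (f1 p + f2 p) * cnj (f1 q + f2 q) / 4) * G p q
      + (f1 p + f2 p) / 2 * cnj ((f1 q + f2 q) / 2) * G p q))"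
    by simp
  moreover have "complex_of_real 4 * ((complex_of_real (c\<^sup>2) - (f1 p - f2 p) * cnj (f1 q - f2 q) / (4 * b p * cnj (b q))
      - (f1 p + f2 p) * cnj (f1 q + f2 q) / 4) * G p q
      + (f1 p + f2 p) / 2 * cnj ((f1 q + f2 q) / 2) * G p q)
    = (complex_of_real ((2 * c)\<^sup>2) - \<gamma> p * cnj (\<gamma> q)) * G p q" for p q
  proof -
    have "\<gamma> p = (f1 p - f2 p) / b p" for p
      by (simp add: \<gamma>_def f1_def f2_def b_def r_def A_def)
    then have "(f1 p - f2 p) * cnj (f1 q - f2 q) / (4 * b p * cnj (b q)) = \<gamma> p * cnj (\<gamma> q) / 4"
      by (simp add: mult.assoc)
    moreover have "(f1 p + f2 p) / 2 * cnj ((f1 q + f2 q) / 2) = (f1 p + f2 p) * cnj (f1 q + f2 q) / 4"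
      by simp
    ultimately show ?thesis
      by (simp only:) (simp add: algebra_simps)
  qed
  ultimately show ?thesis by simp
qed

lemma filterlim_of_real_at_right_0: "filterlim complex_of_real (at 0) (at_right 0)"
  unfolding filterlim_at by (auto simp: eventually_at_filter intro!: tendsto_eq_intros)

text \<open>Only finitely many Moebius parameters are excluded by a finite family, so
  \<open>a\<close> may tend to 0 from the right with the bound \<open>2 * c\<close> fixed. At points
  with \<open>z $ l = 0\<close> the quotients converge to the derivative, which dictates the value
  of \<open>g\<close> there.\<close>

lemma agler_division:
  fixes l :: 3
  assumes f: "agler_bound f c"
  defines "g \<equiv> \<lambda>z. if z $ l = 0 then deriv (\<lambda>u. f (update_coord z l u)) 0
    else (f z - f (update_coord z l 0)) / z $ l"
  shows "agler_bound g (2 * c)"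
proof (rule agler_boundI)
  show "0 \<le> 2 * c" using agler_bound_nonneg[OF f] by simp
  fix I :: "nat set" and y G
  assume *: "finite I" "y ` I \<subseteq> tridisk" "psd I G"
    "\<And>l. psd I (\<lambda>i j. (1 - y i $ l * cnj (y j $ l)) * G i j)"
  define \<gamma> where "\<gamma> = (\<lambda>a p. (f (y p) - f (update_coord (y p) l (complex_of_real a)))
    / ((y p $ l - complex_of_real a) / (1 - complex_of_real a * (y p $ l))))"
  have lim_A: "(complex_of_real \<longlongrightarrow> 0) (at_right 0)"
    using filterlim_of_real_at_right_0 by (simp add: filterlim_at)
  show "psd I (\<lambda>i j. (complex_of_real ((2 * c)\<^sup>2) - g (y i) * cnj (g (y j))) * G i j)"
  proof (rule psd_limit)
    show "at_right (0::real) \<noteq> bot" by simp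
    have "\<forall>\<^sub>F a in at_right 0. \<forall>p\<in>I. complex_of_real a \<noteq> y p $ l"
    proof (rule eventually_ball_finite[OF *(1)], rule ballI)
      fix p
      show "\<forall>\<^sub>F a in at_right 0. complex_of_real a \<noteq> y p $ l"
      proof (cases "y p $ l = 0")
        case True
        then show ?thesis by (auto simp: eventually_at_filter)
      next
        case False
        then show ?thesis using tendsto_imp_eventually_ne[OF lim_A] by metis
      qed
    qed
    moreover have "\<forall>\<^sub>F a in at_right 0. 0 < a \<and> a < (1::real)"
      using eventually_at_right_real[of 0 "1::real"] by simp
    ultimately show "\<forall>\<^sub>F a in at_right 0. psd I (\<lambda>i j. (complex_of_real ((2 * c)\<^sup>2) - \<gamma> a i * cnj (\<gamma> a j)) * G i j)"
    proof eventually_elim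
      case (elim a)
      then show ?case
        unfolding \<gamma>_def by (intro agler_mobius_quotient[OF f * ]) auto
    qed
  next
    fix i j assume "i \<in> I" "j \<in> I"
    have "((\<lambda>a. \<gamma> a p) \<longlongrightarrow> g (y p)) (at_right 0)" if "p \<in> I" for p
    proof -
      define h where "h = (\<lambda>u. f (update_coord (y p) l u))"
      have hu: "f (update_coord (y p) l u) = h u" for u
        by (simp add: h_def)
      have "y p \<in> tridisk" using *(2) that by auto
      then have "h field_differentiable (at 0)"
        unfolding h_def by (rule agler_coord_differentiable[OF f])
      then have h: "(h has_field_derivative deriv h 0) (at 0)"
        using DERIV_deriv_iff_field_differentiable by blast
      show ?thesis
      proof (cases "y p $ l = 0")
        case True
        have "((\<lambda>u. (h u - h 0) / u) \<longlongrightarrow> deriv h 0) (at 0)"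
          using h by (simp add: DERIV_def)
        from filterlim_compose[OF this filterlim_of_real_at_right_0]
        have "((\<lambda>a. (h (complex_of_real a) - h 0) / complex_of_real a) \<longlongrightarrow> g (y p)) (at_right 0)"
          by (simp add: g_def h_def True)
        moreover have "f (y p) = h 0"
          using True update_coord_same[of "y p" l] by (simp add: h_def)
        then have "\<gamma> a p = (h (complex_of_real a) - h 0) / complex_of_real a" for a
          by (simp add: \<gamma>_def True hu minus_divide_left)
        ultimately show ?thesis by simp
      next
        case False
        have "isCont h 0" using h by (rule DERIV_isCont)
        then have "(h \<longlongrightarrow> h 0) (at 0)" by (simp add: isCont_def)
        from filterlim_compose[OF this filterlim_of_real_at_right_0]
        have "((\<lambda>a. h (complex_of_real a)) \<longlongrightarrow> h 0) (at_right 0)" .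
        then have "((\<lambda>a. \<gamma> a p) \<longlongrightarrow> (f (y p) - h 0) / ((y p $ l - 0) / (1 - 0 * (y p $ l)))) (at_right 0)"
          unfolding \<gamma>_def hu using False by (intro tendsto_intros lim_A) auto
        then show ?thesis using False by (simp add: g_def h_def)
      qed
    qed
    from this[OF \<open>i \<in> I\<close>] this[OF \<open>j \<in> I\<close>]
    show "((\<lambda>a. (complex_of_real ((2 * c)\<^sup>2) - \<gamma> a i * cnj (\<gamma> a j)) * G i j)
      \<longlongrightarrow> (complex_of_real ((2 * c)\<^sup>2) - g (y i) * cnj (g (y j))) * G i j) (at_right 0)"
      by (intro tendsto_intros)
  qed
qed

section \<open>Representations and the nilpotent tuple\<close>

lemma Hinf_scalarI: "agler_bound f c \<Longrightarrow> f \<in> Hinf_scalar tridisk coords"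
  by (auto simp: Hinf_scalar_iff)

lemma Hinf_scalar_const: "(\<lambda>z. a) \<in> Hinf_scalar tridisk coords"
  by (rule Hinf_scalarI[OF agler_bound_const])

lemma Hinf_scalar_coord: "(\<lambda>z. z $ l) \<in> Hinf_scalar tridisk coords"
  by (rule Hinf_scalarI[OF agler_bound_coord])

lemma Hinf_scalar_add:
  "f \<in> Hinf_scalar tridisk coords \<Longrightarrow> g \<in> Hinf_scalar tridisk coords \<Longrightarrow>
    (\<lambda>z. f z + g z) \<in> Hinf_scalar tridisk coords"
  by (auto simp: Hinf_scalar_iff intro: agler_bound_add)

lemma Hinf_scalar_coord_mult:
  "g \<in> Hinf_scalar tridisk coords \<Longrightarrow> (\<lambda>z. z $ l * g z) \<in> Hinf_scalar tridisk coords"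
  by (auto simp: Hinf_scalar_iff intro: agler_bound_coord_mult)

definition coord_deriv :: "3 \<Rightarrow> (complex ^ 3 \<Rightarrow> complex) \<Rightarrow> complex"
  where "coord_deriv l f = deriv (\<lambda>u. f (update_coord 0 l u)) 0"

lemma zero_in_tridisk: "0 \<in> tridisk"
  by (simp add: tridisk_def)

text \<open>\<open>deriv\<close> is total; on the algebra it is the actual derivative, which makes
  \<open>coord_deriv\<close> linear and subject to the product rule.\<close>

lemma coord_has_derivative:
  assumes "f \<in> Hinf_scalar tridisk coords"
  shows "((\<lambda>u. f (update_coord 0 l u)) has_field_derivative coord_deriv l f) (at 0)"
proof -
  obtain c where "agler_bound f c" using assms by (auto simp: Hinf_scalar_iff)
  then have "(\<lambda>u. f (update_coord 0 l u)) field_differentiable (at 0)"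
    using agler_coord_differentiable zero_in_tridisk by blast
  then show ?thesis
    unfolding coord_deriv_def using DERIV_deriv_iff_field_differentiable by blast
qed

lemma update_coord_zero [simp]: "update_coord 0 l 0 = 0"
  by (simp add: vec_eq_iff)

lemma coord_deriv_cong:
  assumes "\<And>z. z \<in> tridisk \<Longrightarrow> f z = g z"
  shows "coord_deriv l f = coord_deriv l g"
  unfolding coord_deriv_def
proof (rule deriv_cong_ev)
  have "\<forall>\<^sub>F u in nhds 0. u \<in> ball (0::complex) 1"
    by (rule eventually_nhds_in_open) auto
  then show "\<forall>\<^sub>F u in nhds 0. f (update_coord 0 l u) = g (update_coord 0 l u)"
    by eventually_elim (auto intro!: assms update_coord_in_tridisk zero_in_tridisk)
qed simp

lemma coord_deriv_coord: "coord_deriv l (\<lambda>z. z $ k) = (if k = l then 1 else 0)"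
  unfolding coord_deriv_def by auto

lemma Hinf_scalar_divide_coord:
  assumes "f \<in> Hinf_scalar tridisk coords"
  obtains g where "g \<in> Hinf_scalar tridisk coords"
    and "\<And>z. f z = f (update_coord z l 0) + z $ l * g z"
    and "g 0 = coord_deriv l f"
    and "(\<lambda>z. f (update_coord z l 0)) \<in> Hinf_scalar tridisk coords"
proof -
  obtain c where c: "agler_bound f c" using assms by (auto simp: Hinf_scalar_iff)
  let ?g = "\<lambda>z. if z $ l = 0 then deriv (\<lambda>u. f (update_coord z l u)) 0
    else (f z - f (update_coord z l 0)) / z $ l"
  show thesis
  proof (rule that)
    show "?g \<in> Hinf_scalar tridisk coords"
      by (rule Hinf_scalarI[OF agler_division[OF c]])
    show "f z = f (update_coord z l 0) + z $ l * ?g z" for z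
      using update_coord_same[of z l] by (cases "z $ l = 0") auto
    show "?g 0 = coord_deriv l f"
      by (simp add: coord_deriv_def)
    show "(\<lambda>z. f (update_coord z l 0)) \<in> Hinf_scalar tridisk coords"
      by (rule Hinf_scalarI[OF agler_bound_update_zero[OF c]])
  qed
qed

text \<open>The coordinates are set to 0 one after another, each change being divided by its
  coordinate. Zeroing the other coordinates does not affect the restriction of \<open>f\<close> to
  an axis, so each quotient still takes the value of the original partial derivative at 0.\<close>

lemma Hinf_scalar_gleason:
  assumes "f \<in> Hinf_scalar tridisk coords"
  obtains g :: "3 \<Rightarrow> complex ^ 3 \<Rightarrow> complex"
  where "\<And>l. g l \<in> Hinf_scalar tridisk coords"
    and "\<And>l. g l 0 = coord_deriv l f"
    and "\<And>z. f z = f 0 + (z $ 1 * g 1 z + (z $ 2 * g 2 z + z $ 3 * g 3 z))"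
proof -
  obtain g1 where g1: "g1 \<in> Hinf_scalar tridisk coords"
    "\<And>z. f z = f (update_coord z 1 0) + z $ 1 * g1 z" "g1 0 = coord_deriv 1 f"
    "(\<lambda>z. f (update_coord z 1 0)) \<in> Hinf_scalar tridisk coords"
    using Hinf_scalar_divide_coord[OF assms, of 1] by blast
  obtain g2 where g2: "g2 \<in> Hinf_scalar tridisk coords"
    "\<And>z. f (update_coord z 1 0) = f (update_coord (update_coord z 2 0) 1 0) + z $ 2 * g2 z"
    "g2 0 = coord_deriv 2 (\<lambda>z. f (update_coord z 1 0))"
    "(\<lambda>z. f (update_coord (update_coord z 2 0) 1 0)) \<in> Hinf_scalar tridisk coords"
    using Hinf_scalar_divide_coord[OF g1(4), of 2] by blast
  obtain g3 where g3: "g3 \<in> Hinf_scalar tridisk coords"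
    "\<And>z. f (update_coord (update_coord z 2 0) 1 0)
      = f (update_coord (update_coord (update_coord z 3 0) 2 0) 1 0) + z $ 3 * g3 z"
    "g3 0 = coord_deriv 3 (\<lambda>z. f (update_coord (update_coord z 2 0) 1 0))"
    using Hinf_scalar_divide_coord[OF g2(4), of 3] by blast
  have upd: "update_coord (update_coord (update_coord z 3 0) 2 0) 1 0 = 0"
    "update_coord (update_coord 0 2 u) 1 0 = update_coord 0 2 u"
    "update_coord (update_coord (update_coord 0 3 u) 2 0) 1 0 = update_coord 0 3 u" for z u
    by (simp_all add: vec_eq_iff forall_3)
  define g where "g = (\<lambda>l::3. if l = 1 then g1 else if l = 2 then g2 else g3)"
  show thesis
  proof (rule that)
    show "g l \<in> Hinf_scalar tridisk coords" for l
      using g1(1) g2(1) g3(1) by (simp add: g_def)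
    show "g l 0 = coord_deriv l f" for l
      using g1(3) g2(3) g3(3) exhaust_3[of l] by (auto simp: g_def coord_deriv_def upd)
    show "f z = f 0 + (z $ 1 * g 1 z + (z $ 2 * g 2 z + z $ 3 * g 3 z))" for z
      using g1(2)[of z] g2(2)[of z] g3(2)[of z] by (simp add: g_def upd)
  qed
qed

section \<open>Representations of the algebra and their coordinate operators\<close>

lemma clinear_mapD:
  assumes "clinear_map A"
  shows "A (x + y) = A x + A y" "A (c *\<^sub>C x) = c *\<^sub>C A x" "A 0 = 0" "A (- x) = - A x"
    "A (x - y) = A x - A y"
proof -
  show add: "A (x + y) = A x + A y" and scale: "A (c *\<^sub>C x) = c *\<^sub>C A x" for x y c
    using assms by (auto simp: clinear_map_def)
  show "A 0 = 0" using scale[of 0 0] by simp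
  show minus: "A (- x) = - A x" for x using scale[of "-1" x] by simp
  show "A (x - y) = A x - A y" using add[of x "- y"] minus[of y] by simp
qed

lemma alg_representationD:
  assumes "alg_representation X \<Psi> \<rho>" "f \<in> Hinf_scalar X \<Psi>"
  shows "clinear_map (\<rho> f)"
    and "\<rho> (\<lambda>z. a * f z) v = a *\<^sub>C \<rho> f v"
    and "g \<in> Hinf_scalar X \<Psi> \<Longrightarrow> \<rho> (\<lambda>z. f z + g z) v = \<rho> f v + \<rho> g v"
    and "g \<in> Hinf_scalar X \<Psi> \<Longrightarrow> \<rho> (\<lambda>z. f z * g z) v = \<rho> f (\<rho> g v)"
proof -
  note rep = assms(1)[unfolded alg_representation_def]
  have bounded: "\<forall>f\<in>Hinf_scalar X \<Psi>. bounded_op (\<rho> f)"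
    using rep by (elim conjE)
  have add: "\<forall>f\<in>Hinf_scalar X \<Psi>. \<forall>g\<in>Hinf_scalar X \<Psi>. \<rho> (\<lambda>z. f z + g z) = (\<lambda>x. \<rho> f x + \<rho> g x)"
    using rep by (elim conjE)
  have scale: "\<forall>c. \<forall>f\<in>Hinf_scalar X \<Psi>. \<rho> (\<lambda>z. c * f z) = (\<lambda>x. c *\<^sub>C \<rho> f x)"
    using rep by (elim conjE)
  have mult: "\<forall>f\<in>Hinf_scalar X \<Psi>. \<forall>g\<in>Hinf_scalar X \<Psi>. \<rho> (\<lambda>z. f z * g z) = \<rho> f \<circ> \<rho> g"
    using rep by (elim conjE)
  show "clinear_map (\<rho> f)"
    using bspec[OF bounded assms(2)] by (simp add: bounded_op_def)
  show "\<rho> (\<lambda>z. a * f z) v = a *\<^sub>C \<rho> f v"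
    using scale[rule_format, OF assms(2), of a] by (simp only:)
  show "\<rho> (\<lambda>z. f z + g z) v = \<rho> f v + \<rho> g v" if "g \<in> Hinf_scalar X \<Psi>"
    using add[rule_format, OF assms(2) that] by (simp only:)
  show "\<rho> (\<lambda>z. f z * g z) v = \<rho> f (\<rho> g v)" if "g \<in> Hinf_scalar X \<Psi>"
    using mult[rule_format, OF assms(2) that] by (simp only: comp_apply)
qed

text \<open>Both orders of the factors are recorded: with the coordinate applied first the formula
  acts on vectors, with the coordinate applied last it can be moved to adjoints. Since \<rho> is not
  assumed unital, the constant term carries \<open>\<rho> (\<lambda>z. 1)\<close>.\<close>

lemma alg_representation_gleason:
  assumes \<rho>: "alg_representation tridisk coords \<rho>"
    and g: "\<And>l. g l \<in> Hinf_scalar tridisk coords"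
    and f: "f \<in> Hinf_scalar tridisk coords"
    and f_eq: "\<And>z. f z = f 0 + (z $ 1 * g 1 z + (z $ 2 * g 2 z + z $ 3 * g 3 z))"
  shows "\<rho> f v = f 0 *\<^sub>C \<rho> (\<lambda>z. 1) v + (\<Sum>l\<in>UNIV. \<rho> (g l) (\<rho> (\<lambda>z. z $ l) v))"
    and "\<rho> f v = f 0 *\<^sub>C \<rho> (\<lambda>z. 1) v + (\<Sum>l\<in>UNIV. \<rho> (\<lambda>z. z $ l) (\<rho> (g l) v))"
proof -
  note H = Hinf_scalar_const Hinf_scalar_coord Hinf_scalar_add Hinf_scalar_coord_mult g
  note add = alg_representationD(3)[OF \<rho>]
  note mult = alg_representationD(4)[OF \<rho>]
  have "f = (\<lambda>z. f 0 * 1 + (z $ 1 * g 1 z + (z $ 2 * g 2 z + z $ 3 * g 3 z)))"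
    by (rule ext, subst f_eq, simp)
  then have "\<rho> f v = \<rho> (\<lambda>z. f 0 * 1 + (z $ 1 * g 1 z + (z $ 2 * g 2 z + z $ 3 * g 3 z))) v"
    by simp
  also have "\<dots> = \<rho> (\<lambda>z. f 0 * 1) v + (\<rho> (\<lambda>z. z $ 1 * g 1 z) v
      + (\<rho> (\<lambda>z. z $ 2 * g 2 z) v + \<rho> (\<lambda>z. z $ 3 * g 3 z) v))"
    using add[of "\<lambda>z. f 0 * 1" "\<lambda>z. z $ 1 * g 1 z + (z $ 2 * g 2 z + z $ 3 * g 3 z)"]
      add[of "\<lambda>z. z $ 1 * g 1 z" "\<lambda>z. z $ 2 * g 2 z + z $ 3 * g 3 z"]
      add[of "\<lambda>z. z $ 2 * g 2 z" "\<lambda>z. z $ 3 * g 3 z"]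
    by (simp add: H)
  also have "\<rho> (\<lambda>z. f 0 * 1) v = f 0 *\<^sub>C \<rho> (\<lambda>z. 1) v"
    by (rule alg_representationD(2)[OF \<rho>]) (rule H)
  finally have *: "\<rho> f v = f 0 *\<^sub>C \<rho> (\<lambda>z. 1) v + (\<Sum>l\<in>UNIV. \<rho> (\<lambda>z. z $ l * g l z) v)"
    by (simp add: sum_3 add.assoc)
  show "\<rho> f v = f 0 *\<^sub>C \<rho> (\<lambda>z. 1) v + (\<Sum>l\<in>UNIV. \<rho> (\<lambda>z. z $ l) (\<rho> (g l) v))"
    using * mult[OF H(2) g] by simp
  have "\<rho> (\<lambda>z. z $ l * g l z) v = \<rho> (g l) (\<rho> (\<lambda>z. z $ l) v)" for l
    using mult[OF g H(2), of l l] by (simp add: mult.commute)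
  then show "\<rho> f v = f 0 *\<^sub>C \<rho> (\<lambda>z. 1) v + (\<Sum>l\<in>UNIV. \<rho> (g l) (\<rho> (\<lambda>z. z $ l) v))"
    using * by simp
qed

lemma completely_contractive_scalar:
  assumes "completely_contractive tridisk coords \<rho>" "agler_bound f c"
  shows "norm (\<rho> f v) \<le> c * norm v"
proof -
  have "(\<lambda>z. f z) \<in> Hinf_scalar tridisk coords"
    using Hinf_scalarI[OF assms(2)] .
  then have "sqrt (\<Sum>i<(1::nat). (norm (\<Sum>j<(1::nat). \<rho> (\<lambda>z. f z) v))\<^sup>2)
    \<le> Hinf_norm tridisk coords 1 (\<lambda>z i j. f z) * sqrt (\<Sum>j<(1::nat). (norm v)\<^sup>2)"
    using assms(1)[unfolded completely_contractive_def, rule_format, of 1 "\<lambda>z i j. f z" "\<lambda>_. v"] by simp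
  then have "norm (\<rho> f v) \<le> Hinf_norm tridisk coords 1 (\<lambda>z i j. f z) * norm v"
    by simp
  also have "\<dots> \<le> c * norm v"
  proof (rule mult_right_mono)
    have "bdd_below {c. Hinf_bound tridisk coords 1 (\<lambda>z i j. f z) c}"
      by (rule bdd_belowI[of _ 0]) (simp add: Hinf_bound_def)
    then show "Hinf_norm tridisk coords 1 (\<lambda>z i j. f z) \<le> c"
      unfolding Hinf_norm_def using agler_bound_imp_Hinf_bound[OF assms(2)] by (intro cInf_lower) auto
  qed simp
  finally show ?thesis .
qed

section \<open>The nilpotent tuple and its functional calculus\<close>

definition nilpotent_tuple :: "(3 \<Rightarrow> 'k::chilbert_space \<Rightarrow> 'k) \<Rightarrow> 3 \<Rightarrow> 'k \<times> 'k \<Rightarrow> 'k \<times> 'k"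
  where "nilpotent_tuple W l = (\<lambda>(x, y). (W l y, 0))"

lemma isometric_opD:
  assumes "isometric_op A"
  shows "clinear_map A" "cinner (A x) (A y) = cinner x y" "norm (A x) = norm x"
proof -
  show "clinear_map A" and c: "cinner (A x) (A y) = cinner x y" for x y
    using assms by (auto simp: isometric_op_def)
  have "(norm (A x))\<^sup>2 = (norm x)\<^sup>2"
    using c[of x x] by (simp add: Re_cinner_self[symmetric])
  then show "norm (A x) = norm x"
    by (simp add: power2_eq_iff_nonneg)
qed

text \<open>Products of two entries of the tuple vanish, mixed ones included, so only the constant
  and the three linear Taylor terms survive.\<close>

lemma eval_nilpotent_tuple:
  assumes W0: "\<And>l. W l 0 = 0"
  shows "eval_tuple (nilpotent_tuple W) f x
    = f 0 *\<^sub>C x + (\<Sum>l\<in>UNIV. coord_deriv l f *\<^sub>C nilpotent_tuple W l x)"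
proof -
  let ?T = "nilpotent_tuple W"
  have Z: "(?T l ^^ n) 0 = 0" for l n
    by (induction n) (simp_all add: nilpotent_tuple_def zero_prod_def W0)
  have one: "?T l y = 0" if "snd y = 0" for l y
    using that by (cases y) (simp add: nilpotent_tuple_def zero_prod_def W0)
  have A: "(?T l ^^ n) y = 0" if "n > 0" "snd y = 0" for l n y
    using that by (cases n) (simp_all add: funpow_swap1 one Z)
  have B: "snd ((?T l ^^ n) y) = 0" if "n > 0" for l n y
    using that by (cases n) (simp_all add: nilpotent_tuple_def split_def)
  have C: "(?T l ^^ n) y = 0" if "n > 1" for l n y
  proof (cases n)
    case (Suc m)
    then have "(?T l ^^ n) y = (?T l ^^ m) (?T l y)"
      by (simp add: funpow_swap1)
    then show ?thesis
      using A[of m "?T l y" l] B[of 1 l y] that Suc by simp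
  qed (use that in simp)
  define S :: "(nat \<times> nat \<times> nat) set" where "S = {(0, 0, 0), (1, 0, 0), (0, 1, 0), (0, 0, 1)}"
  have sub: "{\<alpha>. monomial_op ?T \<alpha> \<noteq> (\<lambda>_. 0)} \<subseteq> S"
  proof clarify
    fix p q r assume nz: "monomial_op ?T (p, q, r) \<noteq> (\<lambda>_. 0)"
    have "p \<le> 1" "q \<le> 1" "r \<le> 1"
      using nz by (auto simp: fun_eq_iff C Z intro: leI)
    moreover obtain x where x: "(?T 1 ^^ p) ((?T 2 ^^ q) ((?T 3 ^^ r) x)) \<noteq> 0"
      using nz by (auto simp: fun_eq_iff)
    have "\<not> (p > 0 \<and> q > 0)" "\<not> (q > 0 \<and> r > 0)"
      using x A[OF _ B] Z by metis+
    moreover have "\<not> (p > 0 \<and> r > 0)"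
    proof
      assume pr: "p > 0 \<and> r > 0"
      then have "snd ((?T 2 ^^ q) ((?T 3 ^^ r) x)) = 0"
        using B[of r 3 x] B[of q 2] by (cases q) auto
      then show False
        using x A pr by blast
    qed
    ultimately show "(p, q, r) \<in> S"
      by (auto simp: S_def le_Suc_eq)
  qed
  \<comment> \<open>\<open>S\<close> may be strictly larger than the set of nonzero monomials, for
    example on the zero space; the extra terms contribute 0.\<close>
  have "eval_tuple ?T f x = (\<Sum>\<alpha>\<in>S. taylor_coeff f \<alpha> *\<^sub>C monomial_op ?T \<alpha> x)"
    unfolding eval_tuple_def
    by (rule sum.mono_neutral_left[OF _ sub]) (auto simp: S_def)
  also have "\<dots> = f 0 *\<^sub>C x + (\<Sum>l\<in>UNIV. coord_deriv l f *\<^sub>C ?T l x)"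
  proof -
    have "vector [0, 0, 0] = (0 :: complex ^ 3)"
      "vector [u, 0, 0] = update_coord 0 1 u" "vector [0, u, 0] = update_coord 0 2 u"
      "vector [0, 0, u] = update_coord 0 3 u" for u
      by (simp_all add: vec_eq_iff forall_3)
    then show ?thesis
      by (simp add: S_def sum_3 coord_deriv_def add.assoc)
  qed
  finally show ?thesis .
qed

lemma nilpotent_tuple_linear:
  assumes "\<And>l. clinear_map (W l)"
  shows "clinear_map (nilpotent_tuple W l)"
  using clinear_mapD[OF assms]
  by (auto simp: clinear_map_def nilpotent_tuple_def scaleC_prod_def)

lemma nilpotent_tuple_square:
  assumes "\<And>l. W l 0 = 0"
  shows "nilpotent_tuple W l (nilpotent_tuple W l' x) = 0"
  using assms by (simp add: nilpotent_tuple_def split_def zero_prod_def)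

text \<open>The operator depends on \<open>f\<close> only through its first-order jet at 0, and
  multiplicativity is the Leibniz rule: second-order terms are lost in the jet just as products of
  two \<open>T l\<close> vanish.\<close>

lemma eval_nilpotent_representation:
  assumes W: "\<And>l. isometric_op (W l)"
  shows "alg_representation tridisk coords (eval_tuple (nilpotent_tuple W))"
    (is "alg_representation _ _ ?\<pi>")
proof -
  let ?T = "nilpotent_tuple W"
  have Wlin: "clinear_map (W l)" for l
    using W by (rule isometric_opD)
  note \<pi> = eval_nilpotent_tuple[of W, OF clinear_mapD(3)[OF Wlin]]
  have lin: "clinear_map (?T l)" for l
    by (rule nilpotent_tuple_linear[OF Wlin])
  note lin = clinear_mapD[OF lin]
  have nT: "norm (?T l x) \<le> norm x" for l x
    using isometric_opD(3)[OF W, of l "snd x"] norm_snd_le[of "snd x" "fst x"]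
    by (simp add: nilpotent_tuple_def split_def norm_Pair)
  note D = coord_has_derivative
  show ?thesis
    unfolding alg_representation_def
  proof (intro conjI ballI allI impI)
    fix f assume f: "f \<in> Hinf_scalar tridisk coords"
    show "bounded_op (?\<pi> f)"
      unfolding bounded_op_def
    proof (intro conjI exI allI)
      show "clinear_map (?\<pi> f)"
        unfolding clinear_map_def \<pi>
        by (simp add: lin scaleC_add_right scaleC_scaleC sum.distrib scaleC_sum_right mult_ac)
      fix x
      have "norm (?\<pi> f x) \<le> norm (f 0 *\<^sub>C x) + (\<Sum>l\<in>UNIV. norm (coord_deriv l f *\<^sub>C ?T l x))"
        unfolding \<pi> by (intro order_trans[OF norm_triangle_ineq] add_left_mono norm_sum)
      also have "\<dots> \<le> cmod (f 0) * norm x + (\<Sum>l\<in>UNIV. cmod (coord_deriv l f) * norm x)"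
        unfolding norm_scaleC by (intro add_left_mono sum_mono mult_left_mono nT) auto
      also have "\<dots> = (cmod (f 0) + (\<Sum>l\<in>UNIV. cmod (coord_deriv l f))) * norm x"
        by (simp add: distrib_right sum_distrib_right)
      finally show "norm (?\<pi> f x) \<le> (cmod (f 0) + (\<Sum>l\<in>UNIV. cmod (coord_deriv l f))) * norm x" .
    qed
    fix c
    have "coord_deriv l (\<lambda>z. c * f z) = c * coord_deriv l f" for l
      unfolding coord_deriv_def[of l "\<lambda>z. c * f z"] using D[OF f, of l]
      by (intro DERIV_imp_deriv DERIV_cmult)
    then show "?\<pi> (\<lambda>z. c * f z) = (\<lambda>x. c *\<^sub>C ?\<pi> f x)"
      by (simp add: fun_eq_iff \<pi> scaleC_add_right scaleC_scaleC scaleC_sum_right)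
  next
    fix f g assume f: "f \<in> Hinf_scalar tridisk coords" and g: "g \<in> Hinf_scalar tridisk coords"
    show "?\<pi> f = ?\<pi> g" if "\<forall>z\<in>tridisk. f z = g z"
      using that coord_deriv_cong[of f g] zero_in_tridisk by (simp add: fun_eq_iff \<pi>)
    have "coord_deriv l (\<lambda>z. f z + g z) = coord_deriv l f + coord_deriv l g" for l
      unfolding coord_deriv_def[of l "\<lambda>z. f z + g z"] using D[OF f, of l] D[OF g, of l]
      by (intro DERIV_imp_deriv DERIV_add)
    then show "?\<pi> (\<lambda>z. f z + g z) = (\<lambda>x. ?\<pi> f x + ?\<pi> g x)"
      by (simp add: fun_eq_iff \<pi> scaleC_add_left sum.distrib)
    have "coord_deriv l (\<lambda>z. f z * g z) = coord_deriv l f * g 0 + coord_deriv l g * f 0" for l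
      unfolding coord_deriv_def[of l "\<lambda>z. f z * g z"]
      using DERIV_mult[OF D[OF f, of l] D[OF g, of l]] by (intro DERIV_imp_deriv) simp
    then have "?\<pi> (\<lambda>z. f z * g z) x = (f 0 * g 0) *\<^sub>C x
        + ((\<Sum>l\<in>UNIV. (f 0 * coord_deriv l g) *\<^sub>C ?T l x) + (\<Sum>l\<in>UNIV. (coord_deriv l f * g 0) *\<^sub>C ?T l x))" for x
      by (simp add: \<pi> scaleC_add_left sum.distrib mult.commute[of _ "f 0"] add.commute)
    moreover have "?\<pi> f (?\<pi> g x) = (f 0 * g 0) *\<^sub>C x
        + ((\<Sum>l\<in>UNIV. (f 0 * coord_deriv l g) *\<^sub>C ?T l x) + (\<Sum>l\<in>UNIV. (coord_deriv l f * g 0) *\<^sub>C ?T l x))" for x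
    proof -
      have "?T l (\<Sum>k\<in>UNIV. coord_deriv k g *\<^sub>C ?T k x) = 0" for l
        by (simp add: sum_3 lin nilpotent_tuple_square clinear_mapD(3)[OF Wlin])
      then have "?T l (?\<pi> g x) = g 0 *\<^sub>C ?T l x" for l
        by (simp add: \<pi>[of g] lin)
      then show ?thesis
        unfolding \<pi>[of f] by (simp add: \<pi>[of g] scaleC_add_right scaleC_scaleC scaleC_sum_right add.assoc)
    qed
    ultimately show "?\<pi> (\<lambda>z. f z * g z) = ?\<pi> f \<circ> ?\<pi> g"
      by (simp add: fun_eq_iff)
  qed
qed

section \<open>Dilations and reducing subspaces\<close>

text \<open>The codomain is general because two kinds of remainder must vanish: the vectors
  \<open>S l (J (x, 0))\<close>, and the scalars \<open>cinner (S l v) (J (0, y))\<close> that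
  represent the adjoint.\<close>

lemma anticommuting_symbol_zero:
  fixes W :: "3 \<Rightarrow> 'k::chilbert_space \<Rightarrow> 'k" and N :: "3 \<Rightarrow> 'k \<Rightarrow> 'c::real_vector"
  assumes comm: "\<And>i j y. N i (W j y) = N j (W i y)"
    and minus: "\<And>y. N 1 (- y) = - N 1 y"
    and W: "\<And>y. W 1 y = y" "\<And>y. W 2 (W 3 y) = - W 3 (W 2 y)" "surj (W 2)" "surj (W 3)"
  shows "N l y = 0"
proof -
  have "N 1 (W 2 (W 3 y)) = 0" for y
  proof -
    have "N 1 (W 2 (W 3 y)) = N 2 (W 3 y)"
      using comm[of 1 2 "W 3 y"] W(1) by simp
    also have "\<dots> = N 3 (W 2 y)"
      by (rule comm)
    also have "\<dots> = N 1 (W 3 (W 2 y))"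
      using comm[of 3 1 "W 2 y"] W(1) by simp
    also have "\<dots> = - N 1 (W 2 (W 3 y))"
      using minus[of "W 3 (W 2 y)"] W(2) by simp
    finally have "2 *\<^sub>R N 1 (W 2 (W 3 y)) = 0"
      unfolding scaleR_2 by (metis add.right_inverse)
    then show ?thesis by simp
  qed
  moreover have "\<exists>x. y = W 2 (W 3 x)" for y
    using W(3,4) by (metis surjD)
  ultimately have "N 1 y = 0" for y
    by metis
  then show ?thesis
    using comm[of l 1 y] W(1) by simp
qed

text \<open>By Pythagoras \<open>w\<close> is longer than its projection \<open>t\<close> unless the
  orthogonal part \<open>w - t\<close> is 0.\<close>

lemma compression_attained:
  fixes J :: "'a::chilbert_space \<Rightarrow> 'b::chilbert_space"
  assumes "w - t \<in> ocomp (range J)" "t \<in> range J" "norm w \<le> norm t"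
  shows "w = t"
proof -
  have "cinner (w - t) t = 0"
    using assms(1,2) by (auto simp: ocomp_def)
  then have "cinner t (w - t) = 0"
    using cinner_commute[of t "w - t"] by simp
  then have "(norm w)\<^sup>2 = (norm t)\<^sup>2 + (norm (w - t))\<^sup>2"
    using norm_add_square[of t "w - t"] by simp
  moreover have "(norm w)\<^sup>2 \<le> (norm t)\<^sup>2"
    using assms(3) by (simp add: power_mono)
  ultimately have "(norm (w - t))\<^sup>2 \<le> 0" by simp
  then show ?thesis by simp
qed

lemma unitary_opD:
  assumes "unitary_op A"
  shows "isometric_op A" "surj A" "inj A" "A (inv A x) = x" "inv A (A x) = x"
proof -
  show iso: "isometric_op A" and surj: "surj A"
    using assms by (auto simp: unitary_op_def)
  show inj: "inj A"
  proof (rule injI)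
    fix x y assume "A x = A y"
    then have "norm (A (x - y)) = 0"
      using clinear_mapD(5)[OF isometric_opD(1)[OF iso], of x y] by simp
    then show "x = y"
      using isometric_opD(3)[OF iso, of "x - y"] by simp
  qed
  show "A (inv A x) = x" using surj by (rule surj_f_inv_f)
  show "inv A (A x) = x" using inj by (rule inv_f_f)
qed

lemma unitary_inverse:
  assumes "unitary_op A"
  shows "cinner (A x) y = cinner x (inv A y)" "norm (inv A y) = norm y" "clinear_map (inv A)"
proof -
  note U = unitary_opD[OF assms]
  note iso = isometric_opD[OF U(1)]
  show "cinner (A x) y = cinner x (inv A y)"
    using iso(2)[of x "inv A y"] U(4) by simp
  show "norm (inv A y) = norm y"
    using iso(3)[of "inv A y"] U(4) by simp
  show "clinear_map (inv A)"
    unfolding clinear_map_def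
  proof (intro conjI allI)
    fix x y c
    show "inv A (x + y) = inv A x + inv A y"
      using clinear_mapD(1)[OF iso(1), of "inv A x" "inv A y"] U(4,5) by metis
    show "inv A (c *\<^sub>C x) = c *\<^sub>C inv A x"
      using clinear_mapD(2)[OF iso(1), of c "inv A x"] U(4,5) by metis
  qed
qed

lemma nilpotent_tuple_dilations_trivial:
  fixes W :: "3 \<Rightarrow> 'k::chilbert_space \<Rightarrow> 'k"
  assumes W: "\<And>l. unitary_op (W l)" and W1: "\<And>y. W 1 y = y"
    and anti: "\<And>y. W 2 (W 3 y) = - W 3 (W 2 y)"
  shows "dilations_trivial TYPE('b::chilbert_space) tridisk coords (eval_tuple (nilpotent_tuple W))"
  unfolding dilations_trivial_def
proof (intro allI impI, elim conjE)
  fix \<rho> :: "(complex ^ 3 \<Rightarrow> complex) \<Rightarrow> 'b \<Rightarrow> 'b" and J :: "'k \<times> 'k \<Rightarrow> 'b"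
  assume \<rho>: "alg_representation tridisk coords \<rho>"
    and cc: "completely_contractive tridisk coords \<rho>"
    and dil: "dilates tridisk coords J \<rho> (eval_tuple (nilpotent_tuple W))"
  note iso = isometric_opD[OF unitary_opD(1)[OF W]]
  note Wlin = clinear_mapD[OF iso(1)]
  define \<pi> where "\<pi> = eval_tuple (nilpotent_tuple W)"
  have \<pi>: "\<pi> f x = f 0 *\<^sub>C x + (\<Sum>l\<in>UNIV. coord_deriv l f *\<^sub>C nilpotent_tuple W l x)" for f x
    unfolding \<pi>_def by (rule eval_nilpotent_tuple) (rule Wlin(3))
  have T: "nilpotent_tuple W l (0, y) = (W l y, 0)" for l y
    by (simp add: nilpotent_tuple_def)
  have \<pi>_coord: "\<pi> (\<lambda>z. z $ l) x = nilpotent_tuple W l x" for l x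
    using exhaust_3[of l] by (auto simp: \<pi> coord_deriv_coord sum_3)
  have \<pi>_one: "\<pi> (\<lambda>z. 1) x = x" for x
    by (simp add: \<pi> coord_deriv_def)
  have J: "isometric_op J"
    using dil by (simp add: dilates_def)
  have comp: "\<rho> f (J x) - J (\<pi> f x) \<in> ocomp (range J)" if "f \<in> Hinf_scalar tridisk coords" for f x
    using dil[unfolded dilates_def, THEN conjunct2, THEN conjunct2] that by (cases x) (simp add: \<pi>_def)
  note Jnorm = isometric_opD(3)[OF J]
  note Jlin = clinear_mapD[OF isometric_opD(1)[OF J]]
  \<comment> \<open>\<rho> is not assumed unital, so \<rho>(1) is treated as a further contraction
    whose compression is the identity.\<close>
  define E where "E = \<rho> (\<lambda>z. 1)"
  define S where "S = (\<lambda>l. \<rho> (\<lambda>z. z $ l))"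
  have \<rho>_lin: "clinear_map (\<rho> f)" if "f \<in> Hinf_scalar tridisk coords" for f
    using \<rho> that by (rule alg_representationD(1))
  have Slin: "clinear_map (S l)" for l
    unfolding S_def by (rule \<rho>_lin) (rule Hinf_scalar_coord)
  have Elin: "clinear_map E"
    unfolding E_def by (rule \<rho>_lin) (rule Hinf_scalar_const)
  have S_contr: "norm (S l v) \<le> norm v" for l v
    using completely_contractive_scalar[OF cc agler_bound_coord[of l], of v] by (simp add: S_def)
  have E_contr: "norm (E v) \<le> norm v" for v
    using completely_contractive_scalar[OF cc agler_bound_const[of 1], of v] by (simp add: E_def)
  have S_comm: "S i (S j v) = S j (S i v)" for i j v
  proof -
    have "\<rho> (\<lambda>z. z $ i * z $ j) v = S i (S j v)" for i j
      unfolding S_def by (rule alg_representationD(4)[OF \<rho>]) (rule Hinf_scalar_coord)+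
    from this[of i j] this[of j i] show ?thesis
      by (simp add: mult.commute)
  qed
  have EJ: "E (J x) = J x" for x
    using compression_attained[of "E (J x)" "J x" J] comp[OF Hinf_scalar_const[of 1], of x] E_contr[of "J x"]
    by (simp add: E_def \<pi>_one)
  \<comment> \<open>The compression already preserves the norm of \<open>(0, y)\<close>, so the
    contraction \<open>S l\<close> has no room for a component orthogonal to
    \<open>range J\<close>.\<close>
  have SJ1: "S l (J (0, y)) = J (W l y, 0)" for l y
  proof (rule compression_attained)
    show "S l (J (0, y)) - J (W l y, 0) \<in> ocomp (range J)"
      using comp[OF Hinf_scalar_coord[of l], of "(0, y)"] by (simp add: S_def \<pi>_coord T)
    show "norm (S l (J (0, y))) \<le> norm (J (W l y, 0))"
      using S_contr[of l "J (0, y)"] by (simp add: Jnorm norm_Pair iso(3))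
  qed simp
  have SJ0: "S l (J (x, 0)) = 0" for l x
  proof (rule anticommuting_symbol_zero[where W = W and N = "\<lambda>l x. S l (J (x, 0))"])
    show "S i (J (W j y, 0)) = S j (J (W i y, 0))" for i j y
      using S_comm[of i j "J (0, y)"] by (simp add: SJ1)
    show "S 1 (J (- y, 0)) = - S 1 (J (y, 0))" for y
      using Jlin(4)[of "(y, 0)"] clinear_mapD(4)[OF Slin] by simp
  qed (use W1 anti unitary_opD(2)[OF W] in auto)
  define W' where "W' = (\<lambda>l. inv (W l))"
  have W': "W l (W' l y) = y" "W' l (W l y) = y" for l y
    unfolding W'_def using unitary_opD(4,5)[OF W] by auto
  have W'_norm: "norm (W' l x) = norm x" for l x
    unfolding W'_def by (rule unitary_inverse(2)[OF W])
  \<comment> \<open>\<open>S l\<close> attains its norm at \<open>J (0, W' l x)\<close>, with image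
    \<open>J (x, 0)\<close>. Hence its adjoint, present only through inner products, sends
    \<open>J (x, 0)\<close> back to \<open>J (0, W' l x)\<close>.\<close>
  have SJ0': "cinner (S l v) (J (x, 0)) = cinner v (J (0, W' l x))" for l v x
    using contraction_attains_cinner[OF Slin S_contr, of l "J (0, W' l x)" v]
    by (simp add: SJ1 Jnorm norm_Pair W' W'_norm)
  \<comment> \<open>The adjoint kills \<open>J (0, y)\<close> by the same cancellation, now for the
    inverse tuple, which anticommutes in the same way.\<close>
  have SJ1': "cinner (S l v) (J (0, y)) = 0" for l v y
  proof (rule anticommuting_symbol_zero[where W = W' and N = "\<lambda>l y. cinner (S l v) (J (0, y))"])
    show "cinner (S i v) (J (0, W' j y)) = cinner (S j v) (J (0, W' i y))" for i j y
      using SJ0'[of j "S i v" y] SJ0'[of i "S j v" y] S_comm[of i j v] by simp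
    show "cinner (S 1 v) (J (0, - y)) = - cinner (S 1 v) (J (0, y))" for y
      using Jlin(4)[of "(0, y)"] by simp
    show "W' 1 y = y" for y
      using W'(2)[of 1 y] W1 by simp
    show "W' 2 (W' 3 y) = - W' 3 (W' 2 y)" for y
    proof -
      define x where "x = W' 2 (W' 3 y)"
      have "y = W 3 (W 2 x)"
        by (simp add: x_def W')
      also have "\<dots> = W 2 (W 3 (- x))"
        using anti[of "- x"] by (simp add: Wlin(4))
      finally have "W' 3 (W' 2 y) = - x"
        by (simp add: W')
      then show ?thesis by (simp add: x_def)
    qed
    show "surj (W' 2)" "surj (W' 3)"
      using W'(2) by (metis surjI)+
  qed
  have EJ': "cinner (E v) (J x) = cinner v (J x)" for v x
    using contraction_attains_cinner[OF Elin E_contr, of "J x" v] by (simp add: EJ)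
  have split: "J (x, y) = J (x, 0) + J (0, y)" for x y
    using Jlin(1)[of "(x, 0)" "(0, y)"] by simp
  have SJ': "cinner (S l v) (J (x, y)) = cinner v (J (0, W' l x))" for l v x y
    by (simp add: split[of x y] cinner_add_right SJ0' SJ1')
  show "direct_summand tridisk coords J \<rho> (eval_tuple (nilpotent_tuple W))"
    unfolding direct_summand_def \<pi>_def[symmetric]
  proof (intro ballI)
    have dec1: "\<exists>g. (\<forall>l. g l \<in> Hinf_scalar tridisk coords \<and> g l 0 = coord_deriv l f)
        \<and> (\<forall>v. \<rho> f v = f 0 *\<^sub>C E v + (\<Sum>l\<in>UNIV. \<rho> (g l) (S l v)))
        \<and> (\<forall>v. \<rho> f v = f 0 *\<^sub>C E v + (\<Sum>l\<in>UNIV. S l (\<rho> (g l) v)))"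
      if f: "f \<in> Hinf_scalar tridisk coords" for f
    proof -
      obtain g where g: "\<And>l. g l \<in> Hinf_scalar tridisk coords" "\<And>l. g l 0 = coord_deriv l f"
        "\<And>z. f z = f 0 + (z $ 1 * g 1 z + (z $ 2 * g 2 z + z $ 3 * g 3 z))"
        using Hinf_scalar_gleason[OF f] by metis
      show ?thesis
        unfolding E_def S_def using g(1,2) alg_representation_gleason[OF \<rho> g(1) f g(3)] by blast
    qed
    have \<rho>J0: "\<rho> f (J (x, 0)) = f 0 *\<^sub>C J (x, 0)" if f: "f \<in> Hinf_scalar tridisk coords" for f x
    proof -
      obtain g where g: "\<And>l. g l \<in> Hinf_scalar tridisk coords"
        "\<And>v. \<rho> f v = f 0 *\<^sub>C E v + (\<Sum>l\<in>UNIV. \<rho> (g l) (S l v))"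
        using dec1[OF f] by blast
      show ?thesis
        by (simp add: g(2) EJ SJ0 clinear_mapD(3)[OF \<rho>_lin[OF g(1)]])
    qed
    have \<rho>J1': "cinner (\<rho> f v) (J (0, y)) = f 0 * cinner v (J (0, y))"
      if f: "f \<in> Hinf_scalar tridisk coords" for f v y
    proof -
      obtain g where "\<And>v. \<rho> f v = f 0 *\<^sub>C E v + (\<Sum>l\<in>UNIV. S l (\<rho> (g l) v))"
        using dec1[OF f] by blast
      then show ?thesis
        by (simp add: cinner_add_left cinner_scaleC_left cinner_sum_left EJ' SJ1')
    qed
    fix f assume f: "f \<in> Hinf_scalar tridisk coords"
    obtain g where g: "\<And>l. g l \<in> Hinf_scalar tridisk coords" "\<And>l. g l 0 = coord_deriv l f"
        "\<And>v. \<rho> f v = f 0 *\<^sub>C E v + (\<Sum>l\<in>UNIV. \<rho> (g l) (S l v))"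
        "\<And>v. \<rho> f v = f 0 *\<^sub>C E v + (\<Sum>l\<in>UNIV. S l (\<rho> (g l) v))"
        using dec1[OF f] by blast
    \<comment> \<open>\<open>S l\<close> moves \<open>J v\<close> to vectors
      \<open>J (x, 0)\<close>, on which \<open>\<rho> (g l)\<close> is the scalar
      \<open>g l 0\<close>, that is, the first derivative of \<open>f\<close>.\<close>
    have \<rho>J: "\<rho> f (J v) = J (\<pi> f v)" for v
    proof (cases v)
      case (Pair x y)
      have Jsum: "J (\<Sum>l\<in>UNIV. h l) = (\<Sum>l\<in>UNIV. J (h l))" for h :: "3 \<Rightarrow> 'k \<times> 'k"
        by (simp add: sum_3 Jlin(1))
      have TJ: "J (nilpotent_tuple W l v) = J (W l y, 0)" for l
        by (simp add: Pair nilpotent_tuple_def)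
      have SJ: "S l (J v) = J (W l y, 0)" for l
        by (simp add: Pair split[of x y] clinear_mapD(1)[OF Slin] SJ0 SJ1)
      show ?thesis
        by (simp add: g(3) EJ SJ \<rho>J0[OF g(1)] g(2) \<pi> Jlin(1,2) Jsum TJ)
    qed
    \<comment> \<open>Taking inner products with \<open>J w\<close> moves \<open>S l\<close> to a
      vector \<open>J (0, y)\<close>, against which \<open>\<rho> (g l)\<close> acts as a scalar; so
      only inner products of \<open>v\<close> with \<open>range J\<close> remain, and these are
      0.\<close>
    moreover have "invariant (ocomp (range J)) (\<rho> f)"
      unfolding invariant_def
    proof
      fix v assume "v \<in> ocomp (range J)"
      then have v: "cinner v (J w) = 0" for w
        unfolding ocomp_def by blast
      have "cinner (\<rho> f v) (J w) = 0" for w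
      proof (cases w)
        case (Pair x y)
        show ?thesis
          by (simp add: g(4) cinner_add_left cinner_scaleC_left cinner_sum_left EJ' v Pair SJ' \<rho>J1'[OF g(1)])
      qed
      then show "\<rho> f v \<in> ocomp (range J)"
        by (auto simp: ocomp_def)
    qed
    ultimately show "reduces (range J) (\<rho> f) \<and> (\<forall>x. \<rho> f (J x) = J (\<pi> f x))"
      by (auto simp: reduces_def invariant_def)
  qed
qed

section \<open>Reducing subspaces of the tuple\<close>

text \<open>A sequence in \<open>M\<close> minimising the distance to \<open>x\<close> converges to
  a nearest point \<open>y\<close>. Then \<open>x - y\<close> is orthogonal to \<open>M\<close>, and
  hence to both \<open>y\<close> and \<open>x\<close>.\<close>

lemma closed_csubspace_double_ocomp:
  assumes M: "closed_csubspace M" and x: "x \<in> ocomp (ocomp M)"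
  shows "x \<in> M"
proof -
  have M0: "0 \<in> M" and Madd: "\<And>x y. x \<in> M \<Longrightarrow> y \<in> M \<Longrightarrow> x + y \<in> M"
    and Mscale: "\<And>c x. x \<in> M \<Longrightarrow> c *\<^sub>C x \<in> M" and "closed M"
    using M by (auto simp: closed_csubspace_def)
  define \<delta> where "\<delta> = infdist x M"
  have \<delta>0: "0 \<le> \<delta>" by (simp add: \<delta>_def infdist_nonneg)
  have \<delta>_le: "\<delta>\<^sup>2 \<le> (norm (x - y))\<^sup>2" if "y \<in> M" for y
    using infdist_le[OF that, of x] \<delta>0 by (simp add: \<delta>_def dist_norm power_mono)
  have "\<exists>y\<in>M. norm (x - y) < \<delta> + inverse (real (Suc n))" for n
  proof -
    have "(INF y\<in>M. dist x y) < \<delta> + inverse (real (Suc n))"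
      using M0 by (auto simp: \<delta>_def infdist_def simp del: of_nat_Suc)
    then have "\<exists>y\<in>M. dist x y < \<delta> + inverse (real (Suc n))"
      using M0 by (subst (asm) cINF_less_iff) (auto intro: bdd_belowI2[of _ 0])
    then show ?thesis by (simp add: dist_norm)
  qed
  then obtain s where s: "\<And>n. s n \<in> M" "\<And>n. norm (x - s n) < \<delta> + inverse (real (Suc n))"
    by metis
  have s_dist: "norm (x - s n) \<ge> \<delta>" for n
    using infdist_le[OF s(1), of x] by (simp add: \<delta>_def dist_norm)
  have lim: "(\<lambda>n. norm (x - s n)) \<longlonglongrightarrow> \<delta>"
  proof (rule tendsto_sandwich)
    show "\<forall>\<^sub>F n in sequentially. \<delta> \<le> norm (x - s n)"
      using s_dist by (intro always_eventually allI)
    show "\<forall>\<^sub>F n in sequentially. norm (x - s n) \<le> \<delta> + inverse (real (Suc n))"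
      using s(2) by (intro always_eventually allI less_imp_le)
    show "(\<lambda>n. \<delta> + inverse (real (Suc n))) \<longlonglongrightarrow> \<delta>"
      using tendsto_add[OF tendsto_const LIMSEQ_inverse_real_of_nat, of \<delta>] by simp
  qed simp
  then have lim2: "(\<lambda>n. (norm (x - s n))\<^sup>2) \<longlonglongrightarrow> \<delta>\<^sup>2"
    by (rule tendsto_power)
  have par: "(norm (s m - s n))\<^sup>2 \<le> 2 * ((norm (x - s m))\<^sup>2 - \<delta>\<^sup>2) + 2 * ((norm (x - s n))\<^sup>2 - \<delta>\<^sup>2)" for m n
  proof -
    \<comment> \<open>The midpoint is no closer to \<open>x\<close> than \<delta>, so the
      parallelogram law bounds \<open>norm (s m - s n)\<close> by the two excesses over
      \<delta>.\<close>
    have "(1/2) *\<^sub>C (s m + s n) \<in> M"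
      using Madd Mscale s(1) by blast
    from \<delta>_le[OF this]
    have "4 * \<delta>\<^sup>2 \<le> (2 * norm (x - (1/2) *\<^sub>C (s m + s n)))\<^sup>2"
      by (simp add: power_mult_distrib)
    also have "2 * norm (x - (1/2) *\<^sub>C (s m + s n)) = norm (2 *\<^sub>C (x - (1/2) *\<^sub>C (s m + s n)))"
      by (simp add: norm_scaleC)
    also have "2 *\<^sub>C (x - (1/2) *\<^sub>C (s m + s n)) = (x - s m) + (x - s n)"
      using scaleC_add_left[of 1 1 x] by (simp add: scaleC_diff_right scaleC_scaleC)
    finally show ?thesis
      using parallelogram[of "x - s m" "x - s n"] by (simp add: norm_minus_commute)
  qed
  have "Cauchy s"
  proof (rule CauchyI)
    fix e :: real assume e: "0 < e"
    then have "\<forall>\<^sub>F n in sequentially. (norm (x - s n))\<^sup>2 < \<delta>\<^sup>2 + e\<^sup>2 / 4"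
      using order_tendstoD(2)[OF lim2] by simp
    then obtain N where N: "\<And>n. n \<ge> N \<Longrightarrow> (norm (x - s n))\<^sup>2 < \<delta>\<^sup>2 + e\<^sup>2 / 4"
      unfolding eventually_sequentially by blast
    have "norm (s m - s n) < e" if "m \<ge> N" "n \<ge> N" for m n
    proof -
      have "(norm (s m - s n))\<^sup>2 < e\<^sup>2"
        using par[of m n] N[OF that(1)] N[OF that(2)] by argo
      then show ?thesis
        using e by (auto intro: power2_less_imp_less)
    qed
    then show "\<exists>N. \<forall>m\<ge>N. \<forall>n\<ge>N. norm (s m - s n) < e" by blast
  qed
  then obtain y where y: "s \<longlonglongrightarrow> y"
    using Cauchy_convergent convergent_def by blast
  have "y \<in> M"
    using closed_sequentially[OF \<open>closed M\<close>] s(1) y by blast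
  have "norm (x - y) = \<delta>"
    using LIMSEQ_unique[OF tendsto_norm[OF tendsto_diff[OF tendsto_const y]] lim] .
  have Re0: "Re (cinner (x - y) m) = 0" if "m \<in> M" for m
  proof -
    have "0 \<le> 2 * t * - Re (cinner (x - y) m) + t\<^sup>2 * (norm m)\<^sup>2" for t
    proof -
      have "y + complex_of_real t *\<^sub>C m \<in> M"
        using Madd Mscale \<open>y \<in> M\<close> that by blast
      from \<delta>_le[OF this]
      have "(norm (x - y))\<^sup>2 \<le> (norm ((x - y) - complex_of_real t *\<^sub>C m))\<^sup>2"
        using \<open>norm (x - y) = \<delta>\<close> by (simp add: diff_diff_eq)
      then show ?thesis
        by (simp add: norm_diff_square cinner_scaleC_right norm_scaleC power_mult_distrib)
    qed
    from quadratic_nonneg_imp_zero[OF this] show ?thesis by simp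
  qed
  have "cinner (x - y) m = 0" if "m \<in> M" for m
    using Re0[OF that] Re0[OF Mscale[OF that, of \<i>]]
    by (simp add: cinner_scaleC_right complex_eq_iff)
  then have "x - y \<in> ocomp M"
    by (simp add: ocomp_def)
  then have "cinner x (x - y) = 0" "cinner y (x - y) = 0"
    using x \<open>y \<in> M\<close> cinner_commute[of y "x - y"] by (auto simp: ocomp_def)
  then have "cinner (x - y) (x - y) = 0"
    by (simp add: cinner_diff_left)
  then show ?thesis
    using \<open>y \<in> M\<close> by (simp add: cinner_self)
qed

lemma cinner_Pair: "cinner (a, b) (c, d) = cinner a c + cinner b d"
  by (simp add: cinner_prod_def)

lemma scaleC_Pair: "c *\<^sub>C (a, b) = (c *\<^sub>C a, c *\<^sub>C b)"
  by (simp add: scaleC_prod_def)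

text \<open>\<open>T 1\<close> sends \<open>(x, y)\<close> to \<open>(y, 0)\<close> and its adjoint
  sends it to \<open>(0, x)\<close>. A reducing subspace is therefore a square
  \<open>N \<times> N\<close>, and the remaining coordinates say that \<open>N\<close> reduces
  \<open>U\<close> and \<open>V\<close>.\<close>

lemma irreducible_nilpotent_tuple_iff:
  fixes W :: "3 \<Rightarrow> 'k::chilbert_space \<Rightarrow> 'k"
  assumes W: "\<And>l. unitary_op (W l)" and W1: "\<And>y. W 1 y = y"
  shows "irreducible_ops (eval_tuple (nilpotent_tuple W) ` Hinf_scalar tridisk coords)
    \<longleftrightarrow> irreducible_ops {W 2, W 3}"
proof -
  note Wlin = clinear_mapD[OF isometric_opD(1)[OF unitary_opD(1)[OF W]]]
  define \<pi> where "\<pi> = eval_tuple (nilpotent_tuple W)"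
  have \<pi>: "\<pi> f x = f 0 *\<^sub>C x + (\<Sum>l\<in>UNIV. coord_deriv l f *\<^sub>C nilpotent_tuple W l x)" for f x
    unfolding \<pi>_def by (rule eval_nilpotent_tuple) (rule Wlin(3))
  have \<pi>_coord: "\<pi> (\<lambda>z. z $ l) = nilpotent_tuple W l" for l
    using exhaust_3[of l] by (auto simp: fun_eq_iff \<pi> coord_deriv_coord sum_3)
  have ocomp_sub: "0 \<in> ocomp M" "a \<in> ocomp M \<Longrightarrow> b \<in> ocomp M \<Longrightarrow> a + b \<in> ocomp M"
    "a \<in> ocomp M \<Longrightarrow> c *\<^sub>C a \<in> ocomp M" for M :: "'a::chilbert_space set" and a b c
    by (auto simp: ocomp_def cinner_add_left cinner_scaleC_left)
  have nz: "(\<exists>x::'k \<times> 'k. x \<noteq> 0) \<longleftrightarrow> (\<exists>x::'k. x \<noteq> 0)"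
    by (auto simp: zero_prod_def)
  have inv3: "(\<forall>l. invariant N (W l)) \<longleftrightarrow> invariant N (W 2) \<and> invariant N (W 3)" for N
    by (auto simp: forall_3 invariant_def W1)
  have "(\<forall>M. closed_csubspace M \<and> (\<forall>A\<in>\<pi> ` Hinf_scalar tridisk coords. reduces M A) \<longrightarrow> M = {0} \<or> M = UNIV)
    \<longleftrightarrow> (\<forall>N. closed_csubspace N \<and> (\<forall>A\<in>{W 2, W 3}. reduces N A) \<longrightarrow> N = {0} \<or> N = UNIV)"
    (is "?L \<longleftrightarrow> ?R")
  proof
    assume L: ?L
    show ?R
    proof (intro allI impI, elim conjE)
      fix N assume N: "closed_csubspace N" and "\<forall>A\<in>{W 2, W 3}. reduces N A"
      then have inv: "invariant N (W l)" "invariant (ocomp N) (W l)" for l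
        using inv3 by (auto simp: reduces_def)
      have N0: "0 \<in> N" using N by (simp add: closed_csubspace_def)
      have cN: "closed_csubspace (N \<times> N)"
        using N unfolding closed_csubspace_def by (auto simp: zero_prod_def scaleC_Pair closed_Times)
      have oc: "ocomp (N \<times> N) = ocomp N \<times> ocomp N"
      proof
        show "ocomp (N \<times> N) \<subseteq> ocomp N \<times> ocomp N"
        proof clarify
          fix a b assume ab: "(a, b) \<in> ocomp (N \<times> N)"
          have "cinner a y = 0" "cinner b y = 0" if "y \<in> N" for y
            using ab that N0 by (force simp: ocomp_def cinner_Pair)+
          then show "a \<in> ocomp N \<and> b \<in> ocomp N" by (simp add: ocomp_def)
        qed
      qed (auto simp: ocomp_def cinner_Pair)
      have inv_pi: "invariant (P \<times> P) (\<pi> f)"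
        if P: "0 \<in> P" "\<And>a b. a \<in> P \<Longrightarrow> b \<in> P \<Longrightarrow> a + b \<in> P" "\<And>c a. a \<in> P \<Longrightarrow> c *\<^sub>C a \<in> P"
          and inv: "\<And>l. invariant P (W l)" for P f
      proof -
        have "W l y \<in> P" if "y \<in> P" for l y
          using inv that by (auto simp: invariant_def)
        then show ?thesis
          using P by (auto simp: invariant_def \<pi> sum_3 nilpotent_tuple_def scaleC_Pair)
      qed
      have "invariant (N \<times> N) (\<pi> f)" for f
        using N by (intro inv_pi inv) (auto simp: closed_csubspace_def)
      moreover have "invariant (ocomp N \<times> ocomp N) (\<pi> f)" for f
        by (intro inv_pi inv ocomp_sub)
      ultimately have "reduces (N \<times> N) (\<pi> f)" for f
        by (simp add: reduces_def oc)
      with L cN have "N \<times> N = {0} \<or> N \<times> N = UNIV" by blast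
      then show "N = {0} \<or> N = UNIV"
      proof
        assume "N \<times> N = {0}"
        then have "x = 0" if "x \<in> N" for x
          using that by (auto simp: zero_prod_def)
        then show ?thesis using N0 by blast
      next
        assume "N \<times> N = UNIV"
        then show ?thesis by auto
      qed
    qed
  next
    assume R: ?R
    show ?L
    proof (intro allI impI, elim conjE)
      fix M assume M: "closed_csubspace M" and "\<forall>A\<in>\<pi> ` Hinf_scalar tridisk coords. reduces M A"
      then have "reduces M (nilpotent_tuple W l)" for l
        using Hinf_scalar_coord[of l] \<pi>_coord by (metis image_eqI)
      then have inv: "v \<in> M \<Longrightarrow> nilpotent_tuple W l v \<in> M"
        "v \<in> ocomp M \<Longrightarrow> nilpotent_tuple W l v \<in> ocomp M" for l v
        by (auto simp: reduces_def invariant_def)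
      have Madd: "\<And>a b. a \<in> M \<Longrightarrow> b \<in> M \<Longrightarrow> a + b \<in> M" and M0: "0 \<in> M"
        and Mscale: "\<And>c a. a \<in> M \<Longrightarrow> c *\<^sub>C a \<in> M" and "closed M"
        using M by (auto simp: closed_csubspace_def)
      have up: "(y, 0) \<in> M" if "(x, y) \<in> M" for x y
        using inv(1)[OF that, of 1] by (simp add: nilpotent_tuple_def W1)
      \<comment> \<open>The adjoint of \<open>T 1\<close> is replaced by invariance of
        \<open>ocomp M\<close> under \<open>T 1\<close>, followed by passage to the double
        orthogonal complement.\<close>
      have down: "(0, x) \<in> M" if xy: "(x, y) \<in> M" for x y
      proof (rule closed_csubspace_double_ocomp[OF M])
        have "cinner (0, x) w = 0" if w: "w \<in> ocomp M" for w
        proof (cases w)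
          case (Pair u v)
          have "(v, 0) \<in> ocomp M"
            using inv(2)[OF w, of 1] by (simp add: Pair nilpotent_tuple_def W1)
          then have "cinner (v, 0) (x, y) = 0"
            using xy by (auto simp: ocomp_def)
          then show ?thesis
            using cinner_commute[of x v] by (simp add: Pair cinner_Pair)
        qed
        then show "(0, x) \<in> ocomp (ocomp M)"
          by (simp add: ocomp_def)
      qed
      define N where "N = {x. (x, 0) \<in> M}"
      have N: "x \<in> N \<longleftrightarrow> (x, 0) \<in> M" "x \<in> N \<longleftrightarrow> (0, x) \<in> M" for x
        using up down by (auto simp: N_def)
      have M_eq: "M = N \<times> N"
      proof
        show "M \<subseteq> N \<times> N"
          using up down N by auto
        show "N \<times> N \<subseteq> M"
        proof clarify
          fix x y assume "x \<in> N" "y \<in> N"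
          then have "(x, 0) + (0, y) \<in> M"
            using N Madd by blast
          then show "(x, y) \<in> M" by simp
        qed
      qed
      have cN: "closed_csubspace N"
        unfolding closed_csubspace_def
      proof (intro conjI ballI allI)
        have "N = (\<lambda>x. (x, 0)) -` M" by (auto simp: N_def)
        moreover have "continuous_on UNIV (\<lambda>x::'k. (x, 0::'k))"
          by (intro continuous_intros)
        ultimately show "closed N"
          using \<open>closed M\<close> by (metis closed_vimage)
        show "0 \<in> N" using M0 by (simp add: N_def zero_prod_def)
        show "x + y \<in> N" if "x \<in> N" "y \<in> N" for x y
          using Madd[of "(x, 0)" "(y, 0)"] that by (simp add: N_def)
        show "c *\<^sub>C x \<in> N" if "x \<in> N" for c x
          using Mscale[of "(x, 0)" c] that by (simp add: N_def scaleC_Pair)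
      qed
      have "reduces N (W l)" for l
        unfolding reduces_def invariant_def
      proof (intro conjI ballI)
        show "W l x \<in> N" if "x \<in> N" for x
          using inv(1)[of "(0, x)" l] that N by (simp add: nilpotent_tuple_def)
        fix x assume "x \<in> ocomp N"
        then have "(0, x) \<in> ocomp M"
          by (auto simp: ocomp_def M_eq cinner_Pair)
        then have "(W l x, 0) \<in> ocomp M"
          using inv(2)[of "(0, x)" l] by (simp add: nilpotent_tuple_def)
        then show "W l x \<in> ocomp N"
          using cN by (auto simp: ocomp_def M_eq cinner_Pair closed_csubspace_def)
      qed
      with R cN have "N = {0} \<or> N = UNIV" by blast
      then show "M = {0} \<or> M = UNIV"
        by (auto simp: M_eq zero_prod_def)
    qed
  qed
  then show ?thesis
    unfolding irreducible_ops_def nz \<pi>_def[symmetric] by (simp only:)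
qed

section \<open>Complete contractivity\<close>

lemma agler_bound_mono:
  assumes "agler_bound f c" "c \<le> d"
  shows "agler_bound f d"
proof (rule agler_boundI)
  have c: "0 \<le> c" using assms(1) by (rule agler_bound_nonneg)
  then show "0 \<le> d" using assms(2) by simp
  fix I :: "nat set" and y G
  assume *: "finite I" "y ` I \<subseteq> tridisk" "psd I G"
    "\<And>l. psd I (\<lambda>i j. (1 - y i $ l * cnj (y j $ l)) * G i j)"
  have "0 \<le> d\<^sup>2 - c\<^sup>2"
    using power_mono[OF assms(2) c, of 2] by simp
  from psd_add[OF agler_boundD[OF assms(1) *] psd_scale[OF *(3) this]]
  show "psd I (\<lambda>i j. (complex_of_real (d\<^sup>2) - f (y i) * cnj (f (y j))) * G i j)"
    by (simp add: algebra_simps)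
qed

text \<open>Lagrange's identity. It displays the defect in the Cauchy-Schwarz inequality as a sum of
  products of differences, which become rank-one positive terms when \<open>w\<close> is the
  conjugate of \<open>v\<close>.\<close>

lemma sum_pairwise_differences:
  fixes v w :: "'i \<Rightarrow> complex"
  shows "(\<Sum>a\<in>A. \<Sum>b\<in>A. (v a - v b) * (w a - w b)) / 2
    = of_nat (card A) * (\<Sum>a\<in>A. v a * w a) - (\<Sum>a\<in>A. v a) * (\<Sum>b\<in>A. w b)"
proof -
  have "(\<Sum>a\<in>A. \<Sum>b\<in>A. (v a - v b) * (w a - w b))
    = (\<Sum>a\<in>A. \<Sum>b\<in>A. v a * w a) + (\<Sum>a\<in>A. \<Sum>b\<in>A. v b * w b)
      - (\<Sum>a\<in>A. \<Sum>b\<in>A. v a * w b) - (\<Sum>a\<in>A. \<Sum>b\<in>A. v b * w a)"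
  proof -
    have "(v a - v b) * (w a - w b) = v a * w a + v b * w b - v a * w b - v b * w a" for a b
      by (simp add: algebra_simps)
    then show ?thesis
      by (simp only: sum.distrib sum_subtractf)
  qed
  moreover have "(\<Sum>a\<in>A. \<Sum>b\<in>A. v b * w a) = (\<Sum>a\<in>A. \<Sum>b\<in>A. v a * w b)"
    by (rule sum.swap)
  moreover have "(\<Sum>a\<in>A. \<Sum>b\<in>A. v a * w a) = of_nat (card A) * (\<Sum>a\<in>A. v a * w a)"
    by (simp add: sum_distrib_left)
  moreover have "(\<Sum>a\<in>A. \<Sum>b\<in>A. v b * w b) = of_nat (card A) * (\<Sum>a\<in>A. v a * w a)"
    by simp
  moreover have "(\<Sum>a\<in>A. \<Sum>b\<in>A. v a * w b) = (\<Sum>a\<in>A. v a) * (\<Sum>b\<in>A. w b)"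
    by (rule sum_product[symmetric])
  ultimately show ?thesis
    by (simp only:) simp
qed

text \<open>\<open>Hinf_norm\<close> is an infimum and is informative only if some bound exists.
  With \<open>c\<close> bounding all entries, a column is bounded by \<open>n * c\<^sup>2\<close>,
  and the \<open>n\<close> columns add up to \<open>(n * c)\<^sup>2\<close>.\<close>

lemma Hinf_matrix_bounded:
  assumes \<phi>: "\<And>i j. i < n \<Longrightarrow> j < n \<Longrightarrow> (\<lambda>z. \<phi> z i j) \<in> Hinf_scalar tridisk coords"
  shows "\<exists>C. Hinf_bound tridisk coords n \<phi> C"
proof -
  obtain c0 where c0: "\<And>i j. i < n \<Longrightarrow> j < n \<Longrightarrow> agler_bound (\<lambda>z. \<phi> z i j) (c0 i j)"
    using \<phi> unfolding Hinf_scalar_iff by metis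
  define c where "c = (\<Sum>i<n. \<Sum>j<n. \<bar>c0 i j\<bar>)"
  have c_nonneg: "0 \<le> c" by (simp add: c_def sum_nonneg)
  have c: "agler_bound (\<lambda>z. \<phi> z i j) c" if "i < n" "j < n" for i j
  proof (rule agler_bound_mono[OF c0[OF that]])
    have "c0 i j \<le> (\<Sum>j<n. \<bar>c0 i j\<bar>)"
      using that member_le_sum[of j "{..<n}" "\<lambda>j. \<bar>c0 i j\<bar>"] by simp
    also have "\<dots> \<le> c"
      unfolding c_def using that member_le_sum[of i "{..<n}" "\<lambda>i. \<Sum>j<n. \<bar>c0 i j\<bar>"]
      by (simp add: sum_nonneg)
    finally show "c0 i j \<le> c" .
  qed
  have "Hinf_bound tridisk coords n \<phi> (real n * c)"
    unfolding Hinf_bound_def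
  proof (intro conjI ballI)
    show "0 \<le> real n * c" using c_nonneg by simp
    fix k assume k: "k \<in> admissible_kernels tridisk coords n"
    show "positive_kernel tridisk ({..<n} \<times> {..<n})
        (\<lambda>z w (a, a') (b, b').
          ((if a = b then complex_of_real ((real n * c)\<^sup>2) else 0) - (\<Sum>l<n. \<phi> z a l * cnj (\<phi> w b l)))
            * k z w a' b')"
    proof (rule positive_kernelI, goal_cases)
      case (1 T x ab)
      define K where "K = (\<lambda>s s'. k (x s) (x s') (snd (ab s)) (snd (ab s')))"
      define P where "P = (\<lambda>a s. if fst (ab s) = a then 1 else 0 :: complex)"
      have snd_ab: "(\<lambda>s. snd (ab s)) ` T \<subseteq> {..<n}" and fst_ab: "\<And>s. s \<in> T \<Longrightarrow> fst (ab s) < n"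
        using 1(3) by (auto simp: image_subset_iff mem_Times_iff)
      have K: "psd T K"
        using k positive_kernelD[OF _ _ 1(1,2) snd_ab, of k] by (simp add: K_def admissible_kernels_coords)
      have K_adm: "psd T (\<lambda>s s'. (1 - x s $ l * cnj (x s' $ l)) * K s s')" for l
        using k positive_kernelD[OF _ _ 1(1,2) snd_ab, of "\<lambda>z w a b. (1 - z $ l * cnj (w $ l)) * k z w a b"]
        by (simp add: K_def admissible_kernels_coords)
      have sum_P: "(\<Sum>a<n. P a s * g a) = g (fst (ab s))" if "s \<in> T" for s g
      proof -
        have "(\<Sum>a<n. P a s * g a) = (\<Sum>a<n. if fst (ab s) = a then g a else 0)"
          by (intro sum.cong refl) (simp add: P_def)
        also have "\<dots> = g (fst (ab s))" using fst_ab[OF that] by simp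
        finally show ?thesis .
      qed
      have column: "psd T (\<lambda>s s'. ((if fst (ab s) = fst (ab s') then complex_of_real (real n * c\<^sup>2) else 0)
          - \<phi> (x s) (fst (ab s)) l * cnj (\<phi> (x s') (fst (ab s')) l)) * K s s')" if l: "l < n" for l
      proof -
        define v where "v = (\<lambda>a s. P a s * \<phi> (x s) a l)"
        \<comment> \<open>The first sum contains the bounds of the single entries of the column; the
          second, by Lagrange's identity, trades their separate squares for the square of the whole
          column.\<close>
        have "psd T (\<lambda>s s'. complex_of_real (real n) * (\<Sum>a<n. P a s * cnj (P a s')
            * ((complex_of_real (c\<^sup>2) - \<phi> (x s) a l * cnj (\<phi> (x s') a l)) * K s s'))
          + complex_of_real (1/2) * (\<Sum>a<n. \<Sum>b<n. (v a s - v b s) * cnj (v a s' - v b s') * K s s'))"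
          by (intro psd_add psd_scale psd_sum psd_schur_rank_one agler_boundD[OF c[OF _ l] 1(1,2) K K_adm] K) auto
        then show ?thesis
        proof (rule psd_cong[THEN iffD1, rotated])
          fix s s' assume s: "s \<in> T" "s' \<in> T"
          have P_real: "cnj (P a s') = P a s'" for a by (simp add: P_def)
          have "(\<Sum>a<n. P a s * P a s') = (if fst (ab s) = fst (ab s') then 1 else 0)"
            using sum_P[OF s(1), of "\<lambda>a. P a s'"] by (auto simp: P_def)
          then have P_sum: "(\<Sum>a<n. P a s * P a s' * C) = (if fst (ab s) = fst (ab s') then C else 0)" for C
            by (simp add: sum_distrib_right[symmetric])
          have v_sum: "(\<Sum>a<n. v a s) = \<phi> (x s) (fst (ab s)) l" "(\<Sum>a<n. cnj (v a s')) = cnj (\<phi> (x s') (fst (ab s')) l)"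
            using sum_P[OF s(1), of "\<lambda>a. \<phi> (x s) a l"] sum_P[OF s(2), of "\<lambda>a. cnj (\<phi> (x s') a l)"]
            by (simp_all add: v_def P_real)
          have "(\<Sum>a<n. \<Sum>b<n. (v a s - v b s) * cnj (v a s' - v b s') * K s s')
              = (\<Sum>a<n. \<Sum>b<n. (v a s - v b s) * (cnj (v a s') - cnj (v b s'))) * K s s'"
            by (simp add: sum_distrib_right)
          then have half: "complex_of_real (1/2) * (\<Sum>a<n. \<Sum>b<n. (v a s - v b s) * cnj (v a s' - v b s') * K s s')
            = (of_nat n * (\<Sum>a<n. v a s * cnj (v a s')) - \<phi> (x s) (fst (ab s)) l * cnj (\<phi> (x s') (fst (ab s')) l)) * K s s'"
            using sum_pairwise_differences[of "\<lambda>a. v a s" "\<lambda>a. cnj (v a s')" "{..<n}"] v_sum by simp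
          have col: "(\<Sum>a<n. P a s * cnj (P a s') * ((complex_of_real (c\<^sup>2) - \<phi> (x s) a l * cnj (\<phi> (x s') a l)) * K s s'))
            = (\<Sum>a<n. P a s * P a s' * complex_of_real (c\<^sup>2)) * K s s' - (\<Sum>a<n. v a s * cnj (v a s')) * K s s'"
          proof -
            have "P a s * cnj (P a s') * ((complex_of_real (c\<^sup>2) - \<phi> (x s) a l * cnj (\<phi> (x s') a l)) * K s s')
              = P a s * P a s' * complex_of_real (c\<^sup>2) * K s s' - v a s * cnj (v a s') * K s s'" for a
              by (simp add: v_def P_real algebra_simps)
            then show ?thesis
              by (simp only: sum_subtractf sum_distrib_right)
          qed
          show "complex_of_real (real n) * (\<Sum>a<n. P a s * cnj (P a s')
              * ((complex_of_real (c\<^sup>2) - \<phi> (x s) a l * cnj (\<phi> (x s') a l)) * K s s'))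
            + complex_of_real (1/2) * (\<Sum>a<n. \<Sum>b<n. (v a s - v b s) * cnj (v a s' - v b s') * K s s')
            = ((if fst (ab s) = fst (ab s') then complex_of_real (real n * c\<^sup>2) else 0)
              - \<phi> (x s) (fst (ab s)) l * cnj (\<phi> (x s') (fst (ab s')) l)) * K s s'"
            unfolding half col P_sum by (simp add: algebra_simps)
        qed
      qed
      have "psd T (\<lambda>s s'. \<Sum>l<n. ((if fst (ab s) = fst (ab s') then complex_of_real (real n * c\<^sup>2) else 0)
          - \<phi> (x s) (fst (ab s)) l * cnj (\<phi> (x s') (fst (ab s')) l)) * K s s')"
        using column by (intro psd_sum) auto
      moreover have "(\<Sum>l<n. ((if e then complex_of_real (real n * c\<^sup>2) else 0) - F l) * K s s')
        = ((if e then complex_of_real ((real n * c)\<^sup>2) else 0) - (\<Sum>l<n. F l)) * K s s'" for e F s s'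
      proof -
        have "complex_of_nat n * (if e then complex_of_real (real n * c\<^sup>2) else 0)
          = (if e then complex_of_real ((real n * c)\<^sup>2) else 0)"
          by (simp add: power2_eq_square)
        then show ?thesis
          by (simp only: sum_distrib_right[symmetric] sum_subtractf sum_constant card_lessThan)
      qed
      ultimately show ?case
        by (simp only: K_def split_def)
    qed simp
  qed
  then show ?thesis by blast
qed

section \<open>Admissible kernels from joint eigenvectors of contractions\<close>

lemma eigenvector_kernel_admissible:
  fixes \<kappa> :: "complex ^ 3 \<Rightarrow> nat \<Rightarrow> 'a::chilbert_space"
  assumes lin: "\<And>l. clinear_map (R l)" and contr: "\<And>l v. norm (R l v) \<le> norm v"
    and eigen: "\<And>l z a. R l (\<kappa> z a) = cnj (z $ l) *\<^sub>C \<kappa> z a"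
  shows "(\<lambda>z w a b. cinner (\<kappa> w b) (\<kappa> z a)) \<in> admissible_kernels X coords n"
  unfolding admissible_kernels_coords
proof (intro conjI allI)
  show "positive_kernel X {..<n} (\<lambda>z w a b. cinner (\<kappa> w b) (\<kappa> z a))"
    by (rule positive_kernelI) (rule psd_gram[of _ "\<lambda>s. \<kappa> (_ s) (_ s)"], simp)
  fix l
  show "positive_kernel X {..<n} (\<lambda>z w a b. (1 - z $ l * cnj (w $ l)) * cinner (\<kappa> w b) (\<kappa> z a))"
  proof (rule positive_kernelI, goal_cases)
    case (1 T x a)
    show ?case
    proof (rule psdI)
      fix d :: "nat \<times> nat \<Rightarrow> complex"
      define v where "v = (\<lambda>s. \<kappa> (x s) (a s))"
      have Rsum: "R l (\<Sum>s\<in>A. d s *\<^sub>C v s) = (\<Sum>s\<in>A. d s *\<^sub>C R l (v s))" for A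
        by (induction A rule: infinite_finite_induct) (auto simp: clinear_mapD[OF lin])
      have "(\<Sum>i\<in>T. \<Sum>j\<in>T. (1 - x i $ l * cnj (x j $ l)) * cinner (\<kappa> (x j) (a j)) (\<kappa> (x i) (a i)) * d j * cnj (d i))
        = (\<Sum>i\<in>T. \<Sum>j\<in>T. cinner (v j) (v i) * d j * cnj (d i))
          - (\<Sum>i\<in>T. \<Sum>j\<in>T. cinner (R l (v j)) (R l (v i)) * d j * cnj (d i))"
        unfolding sum_subtractf[symmetric]
        by (intro sum.cong refl) (simp add: v_def eigen cinner_scaleC_left cinner_scaleC_right algebra_simps)
      also have "\<dots> = complex_of_real ((norm (\<Sum>s\<in>T. d s *\<^sub>C v s))\<^sup>2 - (norm (R l (\<Sum>s\<in>T. d s *\<^sub>C v s)))\<^sup>2)"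
        unfolding gram_sum Rsum by simp
      also have "\<dots> \<in> \<real>\<^sub>\<ge>\<^sub>0"
        using contr[of l "\<Sum>s\<in>T. d s *\<^sub>C v s"] by (intro of_real_nonneg) (simp add: power_mono)
      finally show "(\<Sum>i\<in>T. \<Sum>j\<in>T. (1 - x i $ l * cnj (x j $ l)) * cinner (\<kappa> (x j) (a j)) (\<kappa> (x i) (a i)) * d j * cnj (d i)) \<in> \<real>\<^sub>\<ge>\<^sub>0" .
    qed
  qed simp
qed

text \<open>The bound is tested only at index pairs \<open>(b, b)\<close>. Since the kernel vectors
  depend on \<open>b\<close>, the second index then supplies a separate vector for each entry of an
  \<open>n\<close>-tuple, and the inequality is the norm bound for the adjoint of \<phi> on that
  tuple.\<close>

lemma Hinf_bound_gram:
  fixes \<kappa> :: "complex ^ 3 \<Rightarrow> nat \<Rightarrow> 'a::chilbert_space"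
  assumes bound: "Hinf_bound tridisk coords n \<phi> c"
    and adm: "(\<lambda>z w a b. cinner (\<kappa> w b) (\<kappa> z a)) \<in> admissible_kernels tridisk coords n"
    and J: "finite J" "p ` J \<subseteq> tridisk"
  shows "(\<Sum>l<n. (norm (\<Sum>j\<in>J. \<Sum>b<n. (cnj (\<phi> (p j) b l) * r j) *\<^sub>C \<kappa> (p j) b))\<^sup>2)
    \<le> c\<^sup>2 * (\<Sum>b<n. (norm (\<Sum>j\<in>J. r j *\<^sub>C \<kappa> (p j) b))\<^sup>2)"
proof -
  define T where "T = J \<times> {..<n}"
  define v where "v = (\<lambda>s. \<kappa> (p (fst s)) (snd s))"
  have "positive_kernel tridisk ({..<n} \<times> {..<n})
        (\<lambda>z w (a, a') (b, b').
          ((if a = b then complex_of_real (c\<^sup>2) else 0) - (\<Sum>l<n. \<phi> z a l * cnj (\<phi> w b l)))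
            * cinner (\<kappa> w b') (\<kappa> z a'))"
    using bspec[OF conjunct2[OF bound[unfolded Hinf_bound_def]] adm] .
  from positive_kernelD[OF this, of T "\<lambda>s. p (fst s)" "\<lambda>s. (snd s, snd s)"]
  have "psd T (\<lambda>s s'. ((if snd s = snd s' then complex_of_real (c\<^sup>2) else 0)
      - (\<Sum>l<n. \<phi> (p (fst s)) (snd s) l * cnj (\<phi> (p (fst s')) (snd s') l))) * cinner (v s') (v s))"
    using J by (auto simp: T_def v_def image_subset_iff)
  from psdD[OF this, of "\<lambda>s. r (fst s)"]
  have "(\<Sum>s\<in>T. \<Sum>s'\<in>T. ((if snd s = snd s' then complex_of_real (c\<^sup>2) else 0)
      - (\<Sum>l<n. \<phi> (p (fst s)) (snd s) l * cnj (\<phi> (p (fst s')) (snd s') l))) * cinner (v s') (v s)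
      * r (fst s') * cnj (r (fst s))) \<in> \<real>\<^sub>\<ge>\<^sub>0" (is "?S \<in> _") .
  moreover have "?S = (\<Sum>e<n. complex_of_real (c\<^sup>2) * (\<Sum>s\<in>T. \<Sum>s'\<in>T. cinner (v s') (v s)
        * (if snd s' = e then r (fst s') else 0) * cnj (if snd s = e then r (fst s) else 0)))
      - (\<Sum>l<n. \<Sum>s\<in>T. \<Sum>s'\<in>T. cinner (v s') (v s) * (cnj (\<phi> (p (fst s')) (snd s') l) * r (fst s'))
        * cnj (cnj (\<phi> (p (fst s)) (snd s) l) * r (fst s)))" (is "_ = ?A - ?B")
  proof -
    have swap: "(\<Sum>e<n. \<Sum>s\<in>T. \<Sum>s'\<in>T. F e s s') = (\<Sum>s\<in>T. \<Sum>s'\<in>T. \<Sum>e<n. F e s s')"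
      for F :: "nat \<Rightarrow> _ \<Rightarrow> _ \<Rightarrow> complex"
      by (subst sum.swap, intro sum.cong refl, rule sum.swap)
    have "?A = (\<Sum>s\<in>T. \<Sum>s'\<in>T. \<Sum>e<n. complex_of_real (c\<^sup>2) * (cinner (v s') (v s)
        * (if snd s' = e then r (fst s') else 0) * cnj (if snd s = e then r (fst s) else 0)))"
      unfolding sum_distrib_left by (rule swap)
    also have "\<dots> = (\<Sum>s\<in>T. \<Sum>s'\<in>T. (if snd s = snd s' then complex_of_real (c\<^sup>2) else 0)
        * cinner (v s') (v s) * r (fst s') * cnj (r (fst s)))"
    proof (intro sum.cong refl)
      fix s s' assume s: "s \<in> T" "s' \<in> T"
      have "(\<Sum>e<n. complex_of_real (c\<^sup>2) * (cinner (v s') (v s)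
        * (if snd s' = e then r (fst s') else 0) * cnj (if snd s = e then r (fst s) else 0)))
        = (\<Sum>e<n. if e = snd s then (if snd s = snd s' then complex_of_real (c\<^sup>2) else 0)
        * cinner (v s') (v s) * r (fst s') * cnj (r (fst s)) else 0)"
        by (intro sum.cong refl) auto
      then show "(\<Sum>e<n. complex_of_real (c\<^sup>2) * (cinner (v s') (v s)
        * (if snd s' = e then r (fst s') else 0) * cnj (if snd s = e then r (fst s) else 0)))
        = (if snd s = snd s' then complex_of_real (c\<^sup>2) else 0)
        * cinner (v s') (v s) * r (fst s') * cnj (r (fst s))"
        using s by (auto simp: T_def)
    qed
    finally have A: "?A = (\<Sum>s\<in>T. \<Sum>s'\<in>T. (if snd s = snd s' then complex_of_real (c\<^sup>2) else 0)
        * cinner (v s') (v s) * r (fst s') * cnj (r (fst s)))" .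
    show ?thesis
      unfolding A swap sum_subtractf[symmetric]
      by (intro sum.cong refl, simp only: left_diff_distrib sum_distrib_right) (simp add: mult_ac)
  qed
  moreover have "?B = complex_of_real (\<Sum>l<n. (norm (\<Sum>j\<in>J. \<Sum>b<n. (cnj (\<phi> (p j) b l) * r j) *\<^sub>C \<kappa> (p j) b))\<^sup>2)"
    unfolding gram_sum by (simp add: T_def v_def sum.cartesian_product split_def)
  moreover have "?A = complex_of_real (c\<^sup>2 * (\<Sum>b<n. (norm (\<Sum>j\<in>J. r j *\<^sub>C \<kappa> (p j) b))\<^sup>2))"
  proof -
    have "(\<Sum>s\<in>T. (if snd s = e then r (fst s) else 0) *\<^sub>C v s) = (\<Sum>j\<in>J. r j *\<^sub>C \<kappa> (p j) e)" if "e < n" for e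
    proof -
      have "(\<Sum>s\<in>T. (if snd s = e then r (fst s) else 0) *\<^sub>C v s)
        = (\<Sum>j\<in>J. \<Sum>b<n. if b = e then r j *\<^sub>C \<kappa> (p j) b else 0)"
        unfolding T_def sum.cartesian_product by (intro sum.cong refl) (auto simp: v_def)
      then show ?thesis using that by simp
    qed
    then show ?thesis
      unfolding gram_sum by (simp add: sum_distrib_left)
  qed
  ultimately have "complex_of_real (c\<^sup>2 * (\<Sum>b<n. (norm (\<Sum>j\<in>J. r j *\<^sub>C \<kappa> (p j) b))\<^sup>2)
      - (\<Sum>l<n. (norm (\<Sum>j\<in>J. \<Sum>b<n. (cnj (\<phi> (p j) b l) * r j) *\<^sub>C \<kappa> (p j) b))\<^sup>2)) \<in> \<real>\<^sub>\<ge>\<^sub>0"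
    by (simp only: of_real_diff)
  then show ?thesis by (simp only: nonneg_Reals_of_real_iff diff_ge_0_iff_ge)
qed

section \<open>Auxiliary vectors at the axis points\<close>

lemma tendsto_scaleC_left:
  assumes "(f \<longlongrightarrow> a) F"
  shows "((\<lambda>t. f t *\<^sub>C (x::'a::chilbert_space)) \<longlongrightarrow> a *\<^sub>C x) F"
proof -
  have "bounded_linear (\<lambda>c. c *\<^sub>C x)"
    by (rule bounded_linear_intro[of _ "norm x"])
      (simp_all add: scaleC_add_left scaleR_scaleC scaleC_scaleC norm_scaleC scaleR_conv_of_real)
  from bounded_linear.tendsto[OF this assms] show ?thesis .
qed

lemma norm_Pair_square: "(norm (a, b))\<^sup>2 = (norm a)\<^sup>2 + (norm b)\<^sup>2"
  by (simp add: norm_Pair)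

text \<open>
  The vectors \<open>axis_embed \<alpha> j x\<close> carry the first-order part of the kernel at the three axis points.  The
  functionals \<open>axis_part \<alpha> i\<close> are dual to them, and have norm less than \<open>1\<close> for \<open>0 < \<alpha> < 1\<close>, while the
  sum of the three vectors has norm \<open>\<parallel>x\<parallel> / \<alpha>\<close>, which tends to \<open>\<parallel>x\<parallel>\<close>.
\<close>

definition axis_embed :: "real \<Rightarrow> 3 \<Rightarrow> 'k::chilbert_space \<Rightarrow> 'k \<times> 'k \<times> 'k \<times> 'k"
  where "axis_embed \<alpha> j x = (complex_of_real (1 / (3 * \<alpha>)) *\<^sub>C x,
    complex_of_real (((if j = 1 then 1 else 0) - 1/3) / (1 - \<alpha>)) *\<^sub>C x,
    complex_of_real (((if j = 2 then 1 else 0) - 1/3) / (1 - \<alpha>)) *\<^sub>C x,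
    complex_of_real (((if j = 3 then 1 else 0) - 1/3) / (1 - \<alpha>)) *\<^sub>C x)"

definition axis_part :: "real \<Rightarrow> 3 \<Rightarrow> 'k::chilbert_space \<times> 'k \<times> 'k \<times> 'k \<Rightarrow> 'k"
  where "axis_part \<alpha> j = (\<lambda>(m, d1, d2, d3). complex_of_real \<alpha> *\<^sub>C m
    + complex_of_real (1 - \<alpha>) *\<^sub>C (if j = 1 then d1 else if j = 2 then d2 else d3))"

text \<open>The weights cancel: the mean component contributes 1/3, and the difference component
  contributes \<open>e - 1/3\<close> with \<open>e\<close> equal to 1 or 0.\<close>

lemma axis_part_embed:
  assumes "0 < \<alpha>" "\<alpha> < 1"
  shows "axis_part \<alpha> i (axis_embed \<alpha> j x) = (if i = j then x else 0)"
proof -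
  define A B C D where "A = complex_of_real \<alpha>" and "B = complex_of_real (1 - \<alpha>)"
    and "C = (\<lambda>e. complex_of_real ((e - 1/3) / (1 - \<alpha>)))" and "D = complex_of_real (1 / (3 * \<alpha>))"
  note defs = A_def B_def C_def D_def
  have "A * D + B * C e = complex_of_real e" for e
    using assms unfolding defs of_real_mult[symmetric] of_real_add[symmetric] of_real_eq_iff
    by (simp add: field_simps)
  from this[of 0] this[of 1] have key: "A * D + B * C 0 = 0" "A * D + B * C 1 = 1"
    by simp_all
  have "axis_part \<alpha> i (axis_embed \<alpha> j x) = (A * D + B * C (if i = j then 1 else 0)) *\<^sub>C x"
    using exhaust_3[of i] unfolding axis_part_def axis_embed_def A_def[symmetric] B_def[symmetric] D_def[symmetric]
      fun_cong[OF C_def, symmetric]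
    by (auto simp: scaleC_scaleC scaleC_add_left)
  then show ?thesis
    using key by simp
qed

lemma axis_part_linear: "clinear_map (axis_part \<alpha> j)"
  by (auto simp: clinear_map_def axis_part_def scaleC_prod_def scaleC_add_right scaleC_scaleC mult_ac)

lemma axis_embed_linear: "clinear_map (axis_embed \<alpha> j)"
  by (auto simp: clinear_map_def axis_embed_def scaleC_prod_def scaleC_add_right scaleC_scaleC mult_ac)

lemma axis_embed_sum:
  assumes "0 < \<alpha>" "\<alpha> < 1"
  shows "(\<Sum>j\<in>UNIV. axis_embed \<alpha> j x) = (complex_of_real (1 / \<alpha>) *\<^sub>C x, 0)"
proof -
  define C D where "C = (\<lambda>e. complex_of_real ((e - 1/3) / (1 - \<alpha>)))" and "D = complex_of_real (1 / (3 * \<alpha>))"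
  have "D + D + D = complex_of_real (1 / \<alpha>)"
    unfolding D_def of_real_add[symmetric] of_real_eq_iff using assms by (simp add: field_simps)
  moreover have "C 1 + C 0 + C 0 = 0" "C 0 + C 1 + C 0 = 0" "C 0 + C 0 + C 1 = 0"
    unfolding C_def of_real_add[symmetric] add_divide_distrib[symmetric] by simp_all
  ultimately show ?thesis
    unfolding axis_embed_def D_def[symmetric] fun_cong[OF C_def, symmetric] sum_3
    by (simp only: add_Pair scaleC_add_left[symmetric]) (simp add: zero_prod_def)
qed

lemma norm_axis_embed:
  "(norm (axis_embed \<alpha> j x))\<^sup>2 = (1 / (9 * \<alpha>\<^sup>2) + 2 / (3 * (1 - \<alpha>)\<^sup>2)) * (norm x)\<^sup>2"
proof -
  have "(norm (axis_embed \<alpha> j x))\<^sup>2 = ((1 / (3 * \<alpha>))\<^sup>2 + (((if j = 1 then 1 else 0) - 1/3) / (1 - \<alpha>))\<^sup>2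
    + (((if j = 2 then 1 else 0) - 1/3) / (1 - \<alpha>))\<^sup>2 + (((if j = 3 then 1 else 0) - 1/3) / (1 - \<alpha>))\<^sup>2) * (norm x)\<^sup>2"
    unfolding axis_embed_def norm_Pair_square norm_scaleC norm_of_real power_mult_distrib power2_abs
    by (simp only: distrib_right add.assoc)
  \<comment> \<open>One difference component equals 2/3 and two equal -1/3, up to the common factor;
    their squares sum to 2/3.\<close>
  also have "(1 / (3 * \<alpha>))\<^sup>2 + (((if j = 1 then 1 else 0) - 1/3) / (1 - \<alpha>))\<^sup>2
    + (((if j = 2 then 1 else 0) - 1/3) / (1 - \<alpha>))\<^sup>2 + (((if j = 3 then 1 else 0) - 1/3) / (1 - \<alpha>))\<^sup>2
    = 1 / (9 * \<alpha>\<^sup>2) + 2 / (3 * (1 - \<alpha>)\<^sup>2)"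
    using exhaust_3[of j] by (auto simp: power_divide power_mult_distrib power2_eq_square)
  finally show ?thesis .
qed

text \<open>Cauchy-Schwarz for the weights \<alpha> and 1 - \<alpha>. The factor is less than 1
  inside the unit interval, which leaves slack for terms of order \<open>t\<^sup>2\<close>.\<close>

lemma norm_axis_part:
  assumes "0 < \<alpha>" "\<alpha> < 1"
  shows "(norm (axis_part \<alpha> j v))\<^sup>2 \<le> (\<alpha>\<^sup>2 + (1 - \<alpha>)\<^sup>2) * (norm v)\<^sup>2"
proof -
  obtain m d1 d2 d3 where v: "v = (m, d1, d2, d3)" by (cases v) auto
  define d where "d = (if j = 1 then d1 else if j = 2 then d2 else d3)"
  have "norm (axis_part \<alpha> j v) \<le> \<alpha> * norm m + (1 - \<alpha>) * norm d"
    using assms norm_triangle_ineq[of "complex_of_real \<alpha> *\<^sub>C m" "complex_of_real (1 - \<alpha>) *\<^sub>C d"]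
    by (simp add: axis_part_def v d_def norm_scaleC del: of_real_diff)
  then have "(norm (axis_part \<alpha> j v))\<^sup>2 \<le> (\<alpha> * norm m + (1 - \<alpha>) * norm d)\<^sup>2"
    by (simp add: power_mono)
  also have "\<dots> \<le> (\<alpha>\<^sup>2 + (1 - \<alpha>)\<^sup>2) * ((norm m)\<^sup>2 + (norm d)\<^sup>2)"
  proof -
    have "0 \<le> (\<alpha> * norm d - (1 - \<alpha>) * norm m)\<^sup>2" by simp
    then show ?thesis by (simp add: power2_eq_square algebra_simps)
  qed
  also have "\<dots> \<le> (\<alpha>\<^sup>2 + (1 - \<alpha>)\<^sup>2) * (norm v)\<^sup>2"
    by (intro mult_left_mono) (auto simp: v d_def norm_Pair_square)
  finally show ?thesis .
qed

lemma sum_UNIV_option: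
  fixes F :: "'a::finite option \<Rightarrow> 'b::comm_monoid_add"
  shows "(\<Sum>s\<in>UNIV. F s) = F None + (\<Sum>j\<in>UNIV. F (Some j))"
  by (simp add: UNIV_option_conv sum.reindex)

text \<open>
  The kernel is supported on \<open>0\<close> and the three points \<open>t e\<^sub>j\<close>.  Its vectors at \<open>t e\<^sub>j\<close>
  are eigenvectors of \<open>R j\<close>, an explicit contraction whose restriction approximates the adjoint
  of \<open>nilpotent_tuple W j\<close>; difference quotients of the kernel vectors replace derivatives.
\<close>

lemma four_point_bound:
  fixes W' :: "3 \<Rightarrow> 'k::chilbert_space \<Rightarrow> 'k" and x y :: "nat \<Rightarrow> 'k"
  assumes bound: "Hinf_bound tridisk coords n \<phi> c" and W': "\<And>l. isometric_op (W' l)"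
    and \<alpha>: "0 < \<alpha>" "\<alpha> < 1" and t: "0 < t" "t < 1"
    and small: "(\<alpha>\<^sup>2 + (1 - \<alpha>)\<^sup>2) * (1 + t\<^sup>2 * (1 / (9 * \<alpha>\<^sup>2) + 2 / (3 * (1 - \<alpha>)\<^sup>2))) \<le> 1"
  defines "pt \<equiv> \<lambda>j. update_coord 0 j (complex_of_real t)"
  shows "(\<Sum>l<n. (norm (\<Sum>b<n. cnj (\<phi> 0 b l) *\<^sub>C y b
        + (\<Sum>j\<in>UNIV. cnj ((\<phi> (pt j) b l - \<phi> 0 b l) / complex_of_real t) *\<^sub>C W' j (x b))))\<^sup>2
      + (norm (\<Sum>b<n. \<Sum>j\<in>UNIV. cnj (\<phi> (pt j) b l) *\<^sub>C axis_embed \<alpha> j (x b)))\<^sup>2)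
    \<le> c\<^sup>2 * (\<Sum>b<n. (norm (y b))\<^sup>2 + (norm (x b))\<^sup>2 / \<alpha>\<^sup>2)"
proof -
  note W'lin = clinear_mapD[OF isometric_opD(1)[OF W']]
  have Pair_zero: "(0 :: 'k, 0 :: 'k \<times> 'k \<times> 'k \<times> 'k) = 0"
    by (simp add: zero_prod_def)
  define \<tau> where "\<tau> = complex_of_real t"
  have \<tau>: "\<tau> \<noteq> 0" "cnj \<tau> = \<tau>" "cmod \<tau> = t" using t by (simp_all add: \<tau>_def)
  have pt_nth: "pt j $ l = (if l = j then \<tau> else 0)" for j l
    by (simp add: pt_def \<tau>_def)
  have pt_inj: "pt i = pt j \<longleftrightarrow> i = j" and pt_nz: "pt j \<noteq> 0" for i j
    using \<tau> by (auto simp: vec_eq_iff pt_nth split: if_splits)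
  \<comment> \<open>The correction by \<open>1 / \<tau>\<close> is chosen so that the combination
    with the weights \<open>r\<close> below leaves exactly \<open>y b\<close> in the first
    component, while the values of \<phi> combine into difference quotients.\<close>
  define k0 where "k0 = (\<lambda>b. (y b - (1 / \<tau>) *\<^sub>C (\<Sum>j\<in>UNIV. W' j (x b)), 0 :: 'k \<times> 'k \<times> 'k \<times> 'k))"
  define kk where "kk = (\<lambda>j b. (W' j (x b), \<tau> *\<^sub>C axis_embed \<alpha> j (x b)))"
  define \<kappa> where "\<kappa> = (\<lambda>z b. if z = 0 then k0 b else if z = pt 1 then kk 1 b
    else if z = pt 2 then kk 2 b else if z = pt 3 then kk 3 b else 0)"
  have \<kappa>0: "\<kappa> 0 b = k0 b" for b by (simp add: \<kappa>_def)
  have \<kappa>pt: "\<kappa> (pt j) b = kk j b" for j b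
    using exhaust_3[of j] by (auto simp: \<kappa>_def pt_inj pt_nz)
  have \<kappa>_cases: "z = 0 \<or> (\<exists>j. z = pt j) \<or> \<kappa> z = (\<lambda>_. 0)" for z
    by (auto simp: \<kappa>_def)
  \<comment> \<open>\<open>R j\<close> reads off \<open>\<tau> *\<^sub>C x b\<close> from
    \<open>kk j b\<close> and rebuilds \<tau> times that vector. It annihilates \<open>k0\<close>
    and the other axis vectors, because \<open>axis_part\<close> is dual to
    \<open>axis_embed\<close>.\<close>
  define R where "R = (\<lambda>l (v :: 'k \<times> 'k \<times> 'k \<times> 'k \<times> 'k).
    (W' l (axis_part \<alpha> l (snd v)), \<tau> *\<^sub>C axis_embed \<alpha> l (axis_part \<alpha> l (snd v))))"
  note part = clinear_mapD[OF axis_part_linear]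
  note embed = clinear_mapD[OF axis_embed_linear]
  have "(\<lambda>z w a b. cinner (\<kappa> w b) (\<kappa> z a)) \<in> admissible_kernels tridisk coords n"
  proof (rule eigenvector_kernel_admissible)
    show "clinear_map (R l)" for l
      by (simp add: clinear_map_def R_def W'lin part embed scaleC_Pair scaleC_add_right scaleC_scaleC
          scaleC_prod_def[of _ "_ :: 'k \<times> 'k \<times> 'k \<times> 'k \<times> 'k"] mult_ac)
    show "norm (R l v) \<le> norm v" for l v
    proof (rule power2_le_imp_le)
      have "(norm (R l v))\<^sup>2 = (norm (axis_part \<alpha> l (snd v)))\<^sup>2
          * (1 + t\<^sup>2 * (1 / (9 * \<alpha>\<^sup>2) + 2 / (3 * (1 - \<alpha>)\<^sup>2)))"
        unfolding R_def norm_Pair_square norm_scaleC power_mult_distrib norm_axis_embed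
          isometric_opD(3)[OF W'] \<tau>(3) by (simp only: distrib_left mult_1_right mult_ac)
      also have "\<dots> \<le> ((\<alpha>\<^sup>2 + (1 - \<alpha>)\<^sup>2) * (norm (snd v))\<^sup>2)
          * (1 + t\<^sup>2 * (1 / (9 * \<alpha>\<^sup>2) + 2 / (3 * (1 - \<alpha>)\<^sup>2)))"
        by (intro mult_right_mono norm_axis_part \<alpha>) simp
      also have "\<dots> = ((\<alpha>\<^sup>2 + (1 - \<alpha>)\<^sup>2) * (1 + t\<^sup>2 * (1 / (9 * \<alpha>\<^sup>2) + 2 / (3 * (1 - \<alpha>)\<^sup>2)))) * (norm (snd v))\<^sup>2"
        by (simp only: mult_ac)
      also have "\<dots> \<le> 1 * (norm (snd v))\<^sup>2"
        by (intro mult_right_mono small) simp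
      also have "\<dots> \<le> (norm v)\<^sup>2"
        using norm_Pair_square[of "fst v" "snd v"] by simp
      finally show "(norm (R l v))\<^sup>2 \<le> (norm v)\<^sup>2" .
    qed simp
    show "R l (\<kappa> z a) = cnj (z $ l) *\<^sub>C \<kappa> z a" for l z a
      using \<kappa>_cases[of z]
    proof (elim disjE exE)
      assume "z = 0"
      then show ?thesis
        by (simp add: \<kappa>0 k0_def R_def part embed W'lin Pair_zero)
    next
      fix j assume z: "z = pt j"
      have "axis_part \<alpha> l (snd (kk j a)) = (if l = j then \<tau> *\<^sub>C x a else 0)"
        by (simp add: kk_def part axis_part_embed[OF \<alpha>])
      then show ?thesis
        unfolding z \<kappa>pt R_def
        by (simp add: pt_nth \<tau> kk_def scaleC_Pair W'lin embed Pair_zero)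
    next
      assume "\<kappa> z = (\<lambda>_. 0)"
      then show ?thesis
        by (simp add: R_def part embed W'lin Pair_zero)
    qed
  qed
  note adm = this
  define p where "p = (\<lambda>s. case s of None \<Rightarrow> 0 | Some j \<Rightarrow> pt j)"
  define r where "r = (\<lambda>s :: 3 option. case s of None \<Rightarrow> 1 | Some j \<Rightarrow> 1 / \<tau>)"
  have pt_tri: "pt j \<in> tridisk" for j
    using t by (auto simp: pt_def intro!: update_coord_in_tridisk zero_in_tridisk)
  have "range p \<subseteq> tridisk"
    using pt_tri zero_in_tridisk by (auto simp: p_def split: option.splits)
  note gram = Hinf_bound_gram[OF bound adm finite this, of r]
  have scale_kk: "(1 / \<tau>) *\<^sub>C kk j b = ((1 / \<tau>) *\<^sub>C W' j (x b), axis_embed \<alpha> j (x b))" for j b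
    using \<tau> by (simp add: kk_def scaleC_Pair scaleC_scaleC)
  have Pair_sum: "(\<Sum>i\<in>I. (f i, g i)) = (\<Sum>i\<in>I. f i, \<Sum>i\<in>I. g i)"
    for I :: "'i set" and f :: "'i \<Rightarrow> 'k" and g :: "'i \<Rightarrow> 'k \<times> 'k \<times> 'k \<times> 'k"
    by (simp add: prod_eq_iff fst_sum snd_sum)
  have right: "(\<Sum>s\<in>UNIV. r s *\<^sub>C \<kappa> (p s) b) = (y b, complex_of_real (1 / \<alpha>) *\<^sub>C x b, 0)" for b
    by (simp add: sum_UNIV_option r_def p_def \<kappa>0 \<kappa>pt scale_kk Pair_sum k0_def axis_embed_sum[OF \<alpha>]
        scaleC_sum_right del: of_real_divide)
  have left: "(\<Sum>s\<in>UNIV. \<Sum>b<n. (cnj (\<phi> (p s) b l) * r s) *\<^sub>C \<kappa> (p s) b)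
    = (\<Sum>b<n. cnj (\<phi> 0 b l) *\<^sub>C y b
        + (\<Sum>j\<in>UNIV. cnj ((\<phi> (pt j) b l - \<phi> 0 b l) / \<tau>) *\<^sub>C W' j (x b)),
      \<Sum>b<n. \<Sum>j\<in>UNIV. cnj (\<phi> (pt j) b l) *\<^sub>C axis_embed \<alpha> j (x b))" for l
  proof -
    have "(\<Sum>s\<in>UNIV. \<Sum>b<n. (cnj (\<phi> (p s) b l) * r s) *\<^sub>C \<kappa> (p s) b)
      = (\<Sum>b<n. \<Sum>s\<in>UNIV. cnj (\<phi> (p s) b l) *\<^sub>C (r s *\<^sub>C \<kappa> (p s) b))"
      unfolding scaleC_scaleC by (rule sum.swap)
    also have "\<dots> = (\<Sum>b<n. (cnj (\<phi> 0 b l) *\<^sub>C y b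
        + (\<Sum>j\<in>UNIV. cnj ((\<phi> (pt j) b l - \<phi> 0 b l) / \<tau>) *\<^sub>C W' j (x b)),
        \<Sum>j\<in>UNIV. cnj (\<phi> (pt j) b l) *\<^sub>C axis_embed \<alpha> j (x b)))"
    proof (intro sum.cong refl)
      fix b
      have "(\<Sum>s\<in>UNIV. cnj (\<phi> (p s) b l) *\<^sub>C (r s *\<^sub>C \<kappa> (p s) b))
        = cnj (\<phi> 0 b l) *\<^sub>C k0 b + (\<Sum>j\<in>UNIV. cnj (\<phi> (pt j) b l) *\<^sub>C ((1 / \<tau>) *\<^sub>C kk j b))"
        by (simp add: sum_UNIV_option r_def p_def \<kappa>0 \<kappa>pt)
      also have "\<dots> = (cnj (\<phi> 0 b l) *\<^sub>C y b - (\<Sum>j\<in>UNIV. (cnj (\<phi> 0 b l) * (1 / \<tau>)) *\<^sub>C W' j (x b))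
          + (\<Sum>j\<in>UNIV. (cnj (\<phi> (pt j) b l) * (1 / \<tau>)) *\<^sub>C W' j (x b)),
          \<Sum>j\<in>UNIV. cnj (\<phi> (pt j) b l) *\<^sub>C axis_embed \<alpha> j (x b))"
        unfolding scale_kk scaleC_Pair Pair_sum k0_def
        by (simp add: scaleC_diff_right scaleC_scaleC scaleC_sum_right)
      also have "cnj (\<phi> 0 b l) *\<^sub>C y b - (\<Sum>j\<in>UNIV. (cnj (\<phi> 0 b l) * (1 / \<tau>)) *\<^sub>C W' j (x b))
          + (\<Sum>j\<in>UNIV. (cnj (\<phi> (pt j) b l) * (1 / \<tau>)) *\<^sub>C W' j (x b))
        = cnj (\<phi> 0 b l) *\<^sub>C y b + (\<Sum>j\<in>UNIV. (cnj (\<phi> (pt j) b l) * (1 / \<tau>)) *\<^sub>C W' j (x b)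
          - (cnj (\<phi> 0 b l) * (1 / \<tau>)) *\<^sub>C W' j (x b))"
        by (simp add: sum_subtractf)
      also have "\<dots> = cnj (\<phi> 0 b l) *\<^sub>C y b
        + (\<Sum>j\<in>UNIV. cnj ((\<phi> (pt j) b l - \<phi> 0 b l) / \<tau>) *\<^sub>C W' j (x b))"
        by (simp add: scaleC_diff_left[symmetric] diff_divide_distrib \<tau>)
      finally show "(\<Sum>s\<in>UNIV. cnj (\<phi> (p s) b l) *\<^sub>C (r s *\<^sub>C \<kappa> (p s) b))
        = (cnj (\<phi> 0 b l) *\<^sub>C y b
        + (\<Sum>j\<in>UNIV. cnj ((\<phi> (pt j) b l - \<phi> 0 b l) / \<tau>) *\<^sub>C W' j (x b)),
        \<Sum>j\<in>UNIV. cnj (\<phi> (pt j) b l) *\<^sub>C axis_embed \<alpha> j (x b))" .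
    qed
    finally show ?thesis by (simp only: Pair_sum)
  qed
  have "(norm (y b, complex_of_real (1 / \<alpha>) *\<^sub>C x b, 0 :: 'k \<times> 'k \<times> 'k))\<^sup>2 = (norm (y b))\<^sup>2 + (norm (x b))\<^sup>2 / \<alpha>\<^sup>2" for b
    unfolding norm_Pair_square norm_scaleC norm_of_real power_mult_distrib power2_abs
    by (simp add: power_divide)
  with gram show ?thesis
    unfolding left right norm_Pair_square[of "\<Sum>b<n. _ b"] \<tau>_def by (simp only:)
qed

section \<open>Limits of the four-point bounds and duality\<close>

text \<open>The order of the limits matters: for fixed \<alpha> < 1 the slack in
  \<open>norm_axis_part\<close> absorbs the \<open>t\<^sup>2\<close> term as \<open>t\<close> tends
  to 0, and only then may \<alpha> tend to 1, where the slack disappears.\<close>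

lemma nilpotent_adjoint_bound:
  fixes W' :: "3 \<Rightarrow> 'k::chilbert_space \<Rightarrow> 'k" and x y :: "nat \<Rightarrow> 'k"
  assumes bound: "Hinf_bound tridisk coords n \<phi> c" and W': "\<And>l. isometric_op (W' l)"
    and \<phi>: "\<And>i j. i < n \<Longrightarrow> j < n \<Longrightarrow> (\<lambda>z. \<phi> z i j) \<in> Hinf_scalar tridisk coords"
  shows "(\<Sum>l<n. (norm (\<Sum>b<n. cnj (\<phi> 0 b l) *\<^sub>C y b
        + (\<Sum>j\<in>UNIV. cnj (coord_deriv j (\<lambda>z. \<phi> z b l)) *\<^sub>C W' j (x b))))\<^sup>2
      + (norm (\<Sum>b<n. cnj (\<phi> 0 b l) *\<^sub>C x b))\<^sup>2)
    \<le> c\<^sup>2 * (\<Sum>b<n. (norm (y b))\<^sup>2 + (norm (x b))\<^sup>2)"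
proof -
  define top where "top = (\<lambda>l. \<Sum>b<n. cnj (\<phi> 0 b l) *\<^sub>C y b
        + (\<Sum>j\<in>UNIV. cnj (coord_deriv j (\<lambda>z. \<phi> z b l)) *\<^sub>C W' j (x b)))"
  define bot where "bot = (\<lambda>l. \<Sum>b<n. cnj (\<phi> 0 b l) *\<^sub>C x b)"
  have step: "(\<Sum>l<n. (norm (top l))\<^sup>2 + (norm (bot l))\<^sup>2 / \<alpha>\<^sup>2)
    \<le> c\<^sup>2 * (\<Sum>b<n. (norm (y b))\<^sup>2 + (norm (x b))\<^sup>2 / \<alpha>\<^sup>2)" if \<alpha>: "0 < \<alpha>" "\<alpha> < 1" for \<alpha> :: real
  proof -
    define pt where "pt = (\<lambda>t j. update_coord 0 j (complex_of_real t))"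
    define L1 where "L1 = (\<lambda>t l. \<Sum>b<n. cnj (\<phi> 0 b l) *\<^sub>C y b
        + (\<Sum>j\<in>UNIV. cnj ((\<phi> (pt t j) b l - \<phi> 0 b l) / complex_of_real t) *\<^sub>C W' j (x b)))"
    define L2 where "L2 = (\<lambda>t l. \<Sum>b<n. \<Sum>j\<in>UNIV. cnj (\<phi> (pt t j) b l) *\<^sub>C axis_embed \<alpha> j (x b))"
    have deriv: "((\<lambda>t. (\<phi> (pt t j) b l - \<phi> 0 b l) / complex_of_real t)
        \<longlongrightarrow> coord_deriv j (\<lambda>z. \<phi> z b l)) (at_right 0)"
      and cont: "((\<lambda>t. \<phi> (pt t j) b l) \<longlongrightarrow> \<phi> 0 b l) (at_right 0)"
      if bl: "b < n" "l < n" for j b l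
    proof -
      have D: "((\<lambda>u. \<phi> (update_coord 0 j u) b l) has_field_derivative coord_deriv j (\<lambda>z. \<phi> z b l)) (at 0)"
        using coord_has_derivative[OF \<phi>[OF bl]] .
      then have "((\<lambda>u. (\<phi> (update_coord 0 j u) b l - \<phi> 0 b l) / u) \<longlongrightarrow> coord_deriv j (\<lambda>z. \<phi> z b l)) (at 0)"
        by (simp add: DERIV_def)
      from filterlim_compose[OF this filterlim_of_real_at_right_0]
      show "((\<lambda>t. (\<phi> (pt t j) b l - \<phi> 0 b l) / complex_of_real t)
        \<longlongrightarrow> coord_deriv j (\<lambda>z. \<phi> z b l)) (at_right 0)"
        by (simp add: pt_def)
      have "((\<lambda>u. \<phi> (update_coord 0 j u) b l) \<longlongrightarrow> \<phi> 0 b l) (at 0)"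
        using DERIV_isCont[OF D] by (simp add: isCont_def)
      from filterlim_compose[OF this filterlim_of_real_at_right_0]
      show "((\<lambda>t. \<phi> (pt t j) b l) \<longlongrightarrow> \<phi> 0 b l) (at_right 0)"
        by (simp add: pt_def)
    qed
    have L1: "((\<lambda>t. L1 t l) \<longlongrightarrow> top l) (at_right 0)" if "l < n" for l
      unfolding L1_def top_def using that
      by (intro tendsto_sum tendsto_add tendsto_const tendsto_scaleC_left tendsto_cnj deriv) auto
    have L2: "((\<lambda>t. L2 t l) \<longlongrightarrow> (complex_of_real (1 / \<alpha>) *\<^sub>C bot l, 0)) (at_right 0)" if "l < n" for l
    proof -
      have "((\<lambda>t. L2 t l) \<longlongrightarrow> (\<Sum>b<n. \<Sum>j\<in>UNIV. cnj (\<phi> 0 b l) *\<^sub>C axis_embed \<alpha> j (x b))) (at_right 0)"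
        unfolding L2_def using that by (intro tendsto_sum tendsto_scaleC_left tendsto_cnj cont) auto
      also have "(\<Sum>b<n. \<Sum>j\<in>UNIV. cnj (\<phi> 0 b l) *\<^sub>C axis_embed \<alpha> j (x b))
        = (\<Sum>b<n. (cnj (\<phi> 0 b l) *\<^sub>C (complex_of_real (1 / \<alpha>) *\<^sub>C x b), 0))"
        by (simp only: scaleC_sum_right[symmetric] axis_embed_sum[OF \<alpha>] scaleC_Pair scaleC_0_right)
      also have "\<dots> = (complex_of_real (1 / \<alpha>) *\<^sub>C bot l, 0)"
        by (simp add: prod_eq_iff fst_sum snd_sum bot_def scaleC_sum_right scaleC_scaleC mult_ac)
      finally show ?thesis .
    qed
    define g where "g = 1 / (9 * \<alpha>\<^sup>2) + 2 / (3 * (1 - \<alpha>)\<^sup>2)"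
    have "((\<lambda>t. (\<alpha>\<^sup>2 + (1 - \<alpha>)\<^sup>2) * (1 + t\<^sup>2 * g)) \<longlongrightarrow> (\<alpha>\<^sup>2 + (1 - \<alpha>)\<^sup>2) * (1 + 0\<^sup>2 * g)) (at_right 0)"
      by (intro tendsto_intros)
    \<comment> \<open>The slack is \<open>1 - (\<alpha>\<^sup>2 + (1 - \<alpha>)\<^sup>2) = 2 *
      \<alpha> * (1 - \<alpha>)\<close>.\<close>
    moreover have "(\<alpha>\<^sup>2 + (1 - \<alpha>)\<^sup>2) * (1 + 0\<^sup>2 * g) < 1"
    proof -
      have "0 < \<alpha> * (1 - \<alpha>)" using \<alpha> by simp
      then show ?thesis by (simp add: power2_eq_square algebra_simps)
    qed
    ultimately have "\<forall>\<^sub>F t in at_right 0. (\<alpha>\<^sup>2 + (1 - \<alpha>)\<^sup>2) * (1 + t\<^sup>2 * g) < 1"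
      by (rule order_tendstoD(2))
    moreover have "\<forall>\<^sub>F t in at_right 0. 0 < t \<and> t < (1::real)"
      using eventually_at_right_real[of 0 "1::real"] by simp
    ultimately have ev: "\<forall>\<^sub>F t in at_right 0. (\<Sum>l<n. (norm (L1 t l))\<^sup>2 + (norm (L2 t l))\<^sup>2)
      \<le> c\<^sup>2 * (\<Sum>b<n. (norm (y b))\<^sup>2 + (norm (x b))\<^sup>2 / \<alpha>\<^sup>2)"
    proof eventually_elim
      case (elim t)
      then show ?case
        unfolding L1_def L2_def pt_def g_def by (intro four_point_bound[OF bound W' \<alpha>]) auto
    qed
    have lim: "((\<lambda>t. \<Sum>l<n. (norm (L1 t l))\<^sup>2 + (norm (L2 t l))\<^sup>2)
      \<longlongrightarrow> (\<Sum>l<n. (norm (top l))\<^sup>2 + (norm (complex_of_real (1 / \<alpha>) *\<^sub>C bot l, 0 :: 'k \<times> 'k \<times> 'k))\<^sup>2)) (at_right 0)"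
      by (intro tendsto_sum tendsto_add tendsto_power tendsto_norm L1 L2) auto
    have "(norm (complex_of_real (1 / \<alpha>) *\<^sub>C bot l, 0 :: 'k \<times> 'k \<times> 'k))\<^sup>2 = (norm (bot l))\<^sup>2 / \<alpha>\<^sup>2" for l
      unfolding norm_Pair_square norm_scaleC norm_of_real power_mult_distrib power2_abs
      by (simp add: power_divide)
    with tendsto_upperbound[OF lim ev] show ?thesis by simp
  qed
  have "(\<Sum>l<n. (norm (top l))\<^sup>2 + (norm (bot l))\<^sup>2 / 1\<^sup>2)
    \<le> c\<^sup>2 * (\<Sum>b<n. (norm (y b))\<^sup>2 + (norm (x b))\<^sup>2 / 1\<^sup>2)"
  proof (rule tendsto_le)
    show "((\<lambda>\<alpha>. c\<^sup>2 * (\<Sum>b<n. (norm (y b))\<^sup>2 + (norm (x b))\<^sup>2 / \<alpha>\<^sup>2))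
      \<longlongrightarrow> c\<^sup>2 * (\<Sum>b<n. (norm (y b))\<^sup>2 + (norm (x b))\<^sup>2 / 1\<^sup>2)) (at_left 1)"
      by (intro tendsto_intros) auto
    show "((\<lambda>\<alpha>. \<Sum>l<n. (norm (top l))\<^sup>2 + (norm (bot l))\<^sup>2 / \<alpha>\<^sup>2)
      \<longlongrightarrow> (\<Sum>l<n. (norm (top l))\<^sup>2 + (norm (bot l))\<^sup>2 / 1\<^sup>2)) (at_left 1)"
      by (intro tendsto_intros) auto
    have "\<forall>\<^sub>F \<alpha> in at_left 1. \<alpha> \<in> {0<..<1::real}"
      by (rule eventually_at_left_real) simp
    then show "\<forall>\<^sub>F \<alpha> in at_left 1. (\<Sum>l<n. (norm (top l))\<^sup>2 + (norm (bot l))\<^sup>2 / \<alpha>\<^sup>2)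
      \<le> c\<^sup>2 * (\<Sum>b<n. (norm (y b))\<^sup>2 + (norm (x b))\<^sup>2 / \<alpha>\<^sup>2)"
      by eventually_elim (auto intro: step)
  qed simp
  then show ?thesis by (simp add: top_def bot_def)
qed

text \<open>The norm is given with its triangle inequality, and squaring that inequality yields
  Cauchy-Schwarz.\<close>

lemma Re_cinner_le: "Re (cinner u v) \<le> norm (u::'a::chilbert_space) * norm v"
proof -
  have "(norm (u + v))\<^sup>2 \<le> (norm u + norm v)\<^sup>2"
    by (intro power_mono norm_triangle_ineq norm_ge_zero)
  then show ?thesis
    by (simp add: norm_add_square power2_sum)
qed

text \<open>Duality: for the image \<open>g\<close> of \<open>h\<close>, the square of its norm is
  the inner product of \<open>h\<close> with the adjoint applied to \<open>g\<close>. The adjoint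
  bound gives at most \<open>c\<close> times the norms of \<open>h\<close> and \<open>g\<close>, and
  one factor cancels.\<close>

lemma eval_nilpotent_bound:
  fixes W :: "3 \<Rightarrow> 'k::chilbert_space \<Rightarrow> 'k" and h :: "nat \<Rightarrow> 'k \<times> 'k"
  assumes W: "\<And>l. unitary_op (W l)" and bound: "Hinf_bound tridisk coords n \<phi> c"
    and \<phi>: "\<And>i j. i < n \<Longrightarrow> j < n \<Longrightarrow> (\<lambda>z. \<phi> z i j) \<in> Hinf_scalar tridisk coords"
  shows "sqrt (\<Sum>i<n. (norm (\<Sum>j<n. eval_tuple (nilpotent_tuple W) (\<lambda>z. \<phi> z i j) (h j)))\<^sup>2)
    \<le> c * sqrt (\<Sum>j<n. (norm (h j))\<^sup>2)"
proof -
  note Wlin = clinear_mapD[OF isometric_opD(1)[OF unitary_opD(1)[OF W]]]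
  define \<pi> where "\<pi> = eval_tuple (nilpotent_tuple W)"
  have \<pi>: "\<pi> f x = f 0 *\<^sub>C x + (\<Sum>l\<in>UNIV. coord_deriv l f *\<^sub>C nilpotent_tuple W l x)" for f x
    unfolding \<pi>_def by (rule eval_nilpotent_tuple) (rule Wlin(3))
  define W' where "W' = (\<lambda>l. inv (W l))"
  have W': "isometric_op (W' l)" for l
  proof -
    have "cinner (W' l x) (W' l y) = cinner x y" for x y
      using isometric_opD(2)[OF unitary_opD(1)[OF W], of l "W' l x" "W' l y"] unitary_opD(4)[OF W]
      by (simp add: W'_def)
    then show ?thesis
      using unitary_inverse(3)[OF W] by (simp add: isometric_op_def W'_def)
  qed
  define adj where "adj = (\<lambda>f v. (cnj (f 0) *\<^sub>C fst v,
    cnj (f 0) *\<^sub>C snd v + (\<Sum>j\<in>UNIV. cnj (coord_deriv j f) *\<^sub>C W' j (fst v))))"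
  have adj: "cinner (\<pi> f u) v = cinner u (adj f v)" for f u v
    by (cases u; cases v)
      (simp add: \<pi> adj_def sum_3 cinner_add_left cinner_add_right cinner_scaleC_left cinner_scaleC_right
        cinner_Pair nilpotent_tuple_def unitary_inverse(1)[OF W] W'_def distrib_left)
  define g where "g = (\<lambda>i. \<Sum>j<n. \<pi> (\<lambda>z. \<phi> z i j) (h j))"
  define w where "w = (\<lambda>j. \<Sum>i<n. adj (\<lambda>z. \<phi> z i j) (g i))"
  define G where "G = (\<Sum>i<n. (norm (g i))\<^sup>2)"
  have c: "0 \<le> c" using bound by (simp add: Hinf_bound_def)
  have "w l = (\<Sum>b<n. cnj (\<phi> 0 b l) *\<^sub>C fst (g b),
      \<Sum>b<n. cnj (\<phi> 0 b l) *\<^sub>C snd (g b) + (\<Sum>j\<in>UNIV. cnj (coord_deriv j (\<lambda>z. \<phi> z b l)) *\<^sub>C W' j (fst (g b))))" for l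
    by (simp add: w_def adj_def prod_eq_iff fst_sum snd_sum)
  then have w_norm: "(\<Sum>l<n. (norm (w l))\<^sup>2) \<le> c\<^sup>2 * G"
    using nilpotent_adjoint_bound[OF bound W' \<phi>, where x = "\<lambda>b. fst (g b)" and y = "\<lambda>b. snd (g b)"]
    by (simp add: norm_Pair_square G_def norm_prod_def add.commute)
  have "complex_of_real G = (\<Sum>i<n. cinner (g i) (g i))"
    by (simp add: G_def cinner_self)
  also have "\<dots> = (\<Sum>i<n. \<Sum>j<n. cinner (h j) (adj (\<lambda>z. \<phi> z i j) (g i)))"
    by (intro sum.cong refl) (subst g_def, simp add: cinner_sum_left adj)
  also have "\<dots> = (\<Sum>j<n. cinner (h j) (w j))"
    unfolding w_def cinner_sum_right by (rule sum.swap)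
  finally have "G = Re (\<Sum>j<n. cinner (h j) (w j))"
    by (metis Re_complex_of_real)
  also have "\<dots> \<le> (\<Sum>j<n. norm (h j) * norm (w j))"
    unfolding Re_sum by (intro sum_mono Re_cinner_le)
  also have "\<dots> \<le> L2_set (\<lambda>j. norm (h j)) {..<n} * L2_set (\<lambda>j. norm (w j)) {..<n}"
    using L2_set_mult_ineq[of "\<lambda>j. norm (h j)" "\<lambda>j. norm (w j)" "{..<n}"] by simp
  also have "\<dots> \<le> L2_set (\<lambda>j. norm (h j)) {..<n} * (c * sqrt G)"
  proof (rule mult_left_mono)
    have "L2_set (\<lambda>j. norm (w j)) {..<n} \<le> sqrt (c\<^sup>2 * G)"
      unfolding L2_set_def using w_norm by simp
    then show "L2_set (\<lambda>j. norm (w j)) {..<n} \<le> c * sqrt G"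
      using c by (simp add: real_sqrt_mult)
  qed (simp add: L2_set_nonneg)
  finally have le: "G \<le> L2_set (\<lambda>j. norm (h j)) {..<n} * (c * sqrt G)" .
  have "sqrt G \<le> c * L2_set (\<lambda>j. norm (h j)) {..<n}"
  proof (cases "G = 0")
    case True
    then show ?thesis using c by (simp add: L2_set_nonneg)
  next
    case False
    have "0 \<le> G" by (simp add: G_def sum_nonneg)
    with False have "0 < sqrt G" by simp
    moreover have "sqrt G * sqrt G \<le> (c * L2_set (\<lambda>j. norm (h j)) {..<n}) * sqrt G"
      using le \<open>0 \<le> G\<close> by (simp add: mult_ac)
    ultimately show ?thesis by (simp only: mult_le_cancel_right_pos)
  qed
  then show ?thesis
    by (simp add: G_def g_def L2_set_def \<pi>_def)
qed

lemma eval_nilpotent_completely_contractive: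
  fixes W :: "3 \<Rightarrow> 'k::chilbert_space \<Rightarrow> 'k"
  assumes W: "\<And>l. unitary_op (W l)"
  shows "completely_contractive tridisk coords (eval_tuple (nilpotent_tuple W))"
  unfolding completely_contractive_def
proof (intro allI impI)
  fix n :: nat and \<phi> and h :: "nat \<Rightarrow> 'k \<times> 'k"
  assume "\<forall>i<n. \<forall>j<n. (\<lambda>z. \<phi> z i j) \<in> Hinf_scalar tridisk coords"
  then have \<phi>: "\<And>i j. i < n \<Longrightarrow> j < n \<Longrightarrow> (\<lambda>z. \<phi> z i j) \<in> Hinf_scalar tridisk coords"
    by blast
  define L where "L = sqrt (\<Sum>i<n. (norm (\<Sum>j<n. eval_tuple (nilpotent_tuple W) (\<lambda>z. \<phi> z i j) (h j)))\<^sup>2)"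
  define s where "s = sqrt (\<Sum>j<n. (norm (h j))\<^sup>2)"
  have le: "L \<le> c * s" if "Hinf_bound tridisk coords n \<phi> c" for c
    unfolding L_def s_def by (rule eval_nilpotent_bound[OF W that \<phi>])
  obtain C where C: "Hinf_bound tridisk coords n \<phi> C"
    using Hinf_matrix_bounded[of n \<phi>] \<phi> by blast
  have "L \<le> Hinf_norm tridisk coords n \<phi> * s"
  proof (cases "s = 0")
    case True
    then show ?thesis using le[OF C] by simp
  next
    case False
    have "0 \<le> s" by (simp add: s_def sum_nonneg)
    with False have "0 < s" by simp
    \<comment> \<open>Every bound \<open>c\<close> dominates \<open>L / s\<close>, hence so does the
      infimum; the case \<open>s = 0\<close> was separated for this division.\<close>
    have "L / s \<le> Hinf_norm tridisk coords n \<phi>"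
      unfolding Hinf_norm_def
    proof (rule cInf_greatest)
      show "{c. Hinf_bound tridisk coords n \<phi> c} \<noteq> {}" using C by blast
      show "L / s \<le> c" if "c \<in> {c. Hinf_bound tridisk coords n \<phi> c}" for c
        using le that \<open>0 < s\<close> by (simp add: pos_divide_le_eq)
    qed
    then show ?thesis using \<open>0 < s\<close> by (simp add: pos_divide_le_eq)
  qed
  then show "sqrt (\<Sum>i<n. (norm (\<Sum>j<n. eval_tuple (nilpotent_tuple W) (\<lambda>z. \<phi> z i j) (h j)))\<^sup>2)
    \<le> Hinf_norm tridisk coords n \<phi> * sqrt (\<Sum>j<n. (norm (h j))\<^sup>2)"
    by (simp add: L_def s_def)
qed

theorem lemma3p12:
  fixes U V :: "'k::chilbert_space \<Rightarrow> 'k"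
    and T :: "3 \<Rightarrow> 'k \<times> 'k \<Rightarrow> 'k \<times> 'k"
    and \<pi> :: "(complex ^ 3 \<Rightarrow> complex) \<Rightarrow> 'k \<times> 'k \<Rightarrow> 'k \<times> 'k"
  assumes U: "unitary_op U" and V: "unitary_op V"
    and anticommute: "\<And>x. U (V x) = - V (U x)"
    and T1: "T 1 = (\<lambda>(x, y). (y, 0))"
    and T2: "T 2 = (\<lambda>(x, y). (U y, 0))"
    and T3: "T 3 = (\<lambda>(x, y). (V y, 0))"
  defines "\<pi> \<equiv> eval_tuple T"
  shows "(\<forall>j. \<pi> (\<lambda>z. z $ j) = T j)
    \<and> alg_representation tridisk coords \<pi> \<and> unital \<pi>
    \<and> completely_contractive tridisk coords \<pi>
    \<and> dilations_trivial TYPE('b::chilbert_space) tridisk coords \<pi>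
    \<and> (boundary_representation TYPE('b) tridisk coords \<pi> \<longleftrightarrow> irreducible_ops {U, V})"
proof -
  \<comment> \<open>The identity as \<open>W 1\<close> puts the three coordinates into the same
    form.\<close>
  define W where "W = (\<lambda>l::3. if l = 1 then id else if l = 2 then U else V)"
  have W_simps: "W 1 = id" "W 2 = U" "W 3 = V"
    by (simp_all add: W_def)
  have "unitary_op (id :: 'k \<Rightarrow> 'k)"
    by (simp add: unitary_op_def isometric_op_def clinear_map_def)
  then have W: "unitary_op (W l)" for l
    using U V by (simp add: W_def)
  have T_eq: "T = nilpotent_tuple W"
  proof
    fix l :: 3
    show "T l = nilpotent_tuple W l"
      using exhaust_3[of l] T1 T2 T3 by (auto simp: nilpotent_tuple_def W_simps)
  qed
  have \<pi>: "\<pi> = eval_tuple (nilpotent_tuple W)"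
    by (simp add: \<pi>_def T_eq)
  note Wlin = clinear_mapD[OF isometric_opD(1)[OF unitary_opD(1)[OF W]]]
  have eval: "\<pi> f x = f 0 *\<^sub>C x + (\<Sum>l\<in>UNIV. coord_deriv l f *\<^sub>C T l x)" for f x
    unfolding \<pi> T_eq by (rule eval_nilpotent_tuple) (rule Wlin(3))
  have "\<forall>j. \<pi> (\<lambda>z. z $ j) = T j"
  proof
    fix j :: 3
    show "\<pi> (\<lambda>z. z $ j) = T j"
      using exhaust_3[of j] by (auto simp: fun_eq_iff eval coord_deriv_coord sum_3)
  qed
  moreover have "alg_representation tridisk coords \<pi>"
    unfolding \<pi> by (rule eval_nilpotent_representation) (rule unitary_opD(1)[OF W])
  moreover have "unital \<pi>"
    by (simp add: unital_def fun_eq_iff eval coord_deriv_def)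
  moreover have "completely_contractive tridisk coords \<pi>"
    unfolding \<pi> by (rule eval_nilpotent_completely_contractive[OF W])
  moreover have "dilations_trivial TYPE('b) tridisk coords \<pi>"
    unfolding \<pi> by (rule nilpotent_tuple_dilations_trivial[OF W]) (simp_all add: W_simps anticommute)
  moreover have "irreducible_ops (\<pi> ` Hinf_scalar tridisk coords) \<longleftrightarrow> irreducible_ops {U, V}"
    using irreducible_nilpotent_tuple_iff[OF W] by (simp add: \<pi> W_simps)
  ultimately show ?thesis
    by (simp add: boundary_representation_def)
qed

end
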